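(* Let $Y\sim\mathrm{SBM}(\theta,B)$ with $\theta\in[k]^n$ (every community nonempty), $B\in(0,1]^{k\times k}$ symmetric and full rank with smallest absolute eigenvalue $\lambda_B>0$, and $\max B\ge\log n/n$. Let $\varepsilon\in(0,\infty]$, let $\gamma\ge0$, and let $\hat\theta_\varepsilon$ be the output of Algorithm A (below) applied to $\mathcal M_\varepsilon(Y)$ (where $\mathcal M_\infty(Y)=Y$) with approximation error $\gamma$. There exists a universal constant $c_1$ such that if $$\frac{(2+\gamma)kn}{n_{\min}^2\lambda_B^2}g_\varepsilon(B)<c_1^{-1},$$ then with probability at least $1-n^{-1}$, $$\tilde L(\theta,\hat\theta_\varepsilon)\le c_1\frac{(2+\gamma)kn}{n_{\min}^2\lambda_B^2}g_\varepsilon(B)\quad\text{and}\quad L(\theta,\hat\theta_\varepsilon)\le c_1\frac{(2+\gamma)k\,n'_{\max}}{n_{\min}^2\lambda_B^2}g_\varepsilon(B).$$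
   Context: $\mathrm{SBM}(\theta,B)$: $Y$ symmetric $n\times n$ binary with zero diagonal, entries $Y_{ij}$ ($i<j$) independent $\mathrm{Bernoulli}(B_{\theta_i\theta_j})$. $C_j=\{i:\theta_i=j\}$, $n_j=|C_j|$, $n_{\min}=\min_jn_j$, $n'_{\max}$ the second largest of $n_1,\dots,n_k$; $\max B=\max_{ij}B_{ij}$. Symmetric edge-flip mechanism $\mathcal M_\varepsilon$ ($\varepsilon<\infty$): given $Y$, $\mathcal M_\varepsilon(Y)$ is the symmetric zero-diagonal binary matrix whose entries $(i<j)$ are, independently given $Y$, $1-Y_{ij}$ w.p. $\frac1{1+e^\varepsilon}$ and $Y_{ij}$ w.p. $\frac{e^\varepsilon}{1+e^\varepsilon}$. $g_\varepsilon(B)=\frac{e^\varepsilon+1}{e^\varepsilon-1}\left(\max B+\frac1{e^\varepsilon-1}\right)$ for $\varepsilon<\infty$, and $g_\infty(B)=\max B$. $(1+\gamma)$-approximate $k$-means: for $\hat U\in\mathbb R^{n\times k}$, let $\mathbb G^{n\times k}$ be the set of $n\times k$ 0/1 matrices with exactly one 1 per row. A pair $(\hat\Theta,\hat X)$ with $\hat\Theta\in\mathbb G^{n\times k}$, $\hat X\in\mathbb R^{k\times k}$ is a $(1+\gamma)$-approximate $k$-means solution if $\|\hat\Theta\hat X-\hat U\|_F^2\le(1+\gamma)\inf_{\Theta\in\mathbb G^{n\times k},X\in\mathbb R^{k\times k}}\|\Theta X-\hat U\|_F^2$; the induced labels are $\hat\theta_i=$ the column index of the 1 in row $i$ of $\hat\Theta$.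 Algorithm A (input: edge-flipped matrix $A$, $k$, $\gamma$, $\varepsilon$): set $A_\downarrow=A$ if $\varepsilon=\infty$ and $A_\downarrow=A-(e^\varepsilon+1)^{-1}(\mathbf 1_n\mathbf 1_n^T-I_n)$ otherwise; let $\hat U_\downarrow\in\mathbb R^{n\times k}$ have as columns orthonormal eigenvectors of $A_\downarrow$ for its $k$ largest eigenvalues in absolute value; return the labels $\hat\theta$ of a $(1+\gamma)$-approximate $k$-means solution on the rows of $\hat U_\downarrow$. Misclassification: with $S_{[k]}$ the permutations of $[k]$, $L(\theta,\hat\theta)=\min_{\sigma\in S_{[k]}}\frac1n\sum_{i=1}^n\mathbf 1\{\sigma(\hat\theta_i)\ne\theta_i\}$ and $\tilde L(\theta,\hat\theta)=\max_{j\in[k]}\min_{\sigma\in S_{[k]}}\frac1{|C_j|}\sum_{i\in C_j}\mathbf 1\{\sigma(\hat\theta_i)\ne j\}$. *)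

theory Defs
  imports "HOL-Probability.Probability" "HOL-Combinatorics.Permutations"
begin

text \<open>Conventions: vertices are 0..n-1, communities/labels are 0..k-1.
  Matrices are functions nat => nat => _, only entries with indices in range matter.\<close>

definition upper_pairs :: "nat \<Rightarrow> (nat \<times> nat) set" where
  "upper_pairs n = {(i, j). i < j \<and> j < n}"

definition symm_of :: "(nat \<times> nat \<Rightarrow> bool) \<Rightarrow> nat \<Rightarrow> nat \<Rightarrow> bool" where
  "symm_of P i j = (if i < j then P (i, j) else if j < i then P (j, i) else False)"

definition sbm_pmf :: "nat \<Rightarrow> (nat \<Rightarrow> nat) \<Rightarrow> (nat \<Rightarrow> nat \<Rightarrow> real) \<Rightarrow> (nat \<Rightarrow> nat \<Rightarrow> bool) pmf" where
  "sbm_pmf n \<theta> B = map_pmf symm_of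
     (Pi_pmf (upper_pairs n) False (\<lambda>(i, j). bernoulli_pmf (B (\<theta> i) (\<theta> j))))"

definition edge_flip :: "nat \<Rightarrow> ereal \<Rightarrow> (nat \<Rightarrow> nat \<Rightarrow> bool) \<Rightarrow> (nat \<Rightarrow> nat \<Rightarrow> bool) pmf" where
  "edge_flip n \<epsilon> Y = (if \<epsilon> = \<infinity> then return_pmf Y else
     map_pmf symm_of (Pi_pmf (upper_pairs n) False (\<lambda>(i, j).
        map_pmf (\<lambda>f. if f then \<not> Y i j else Y i j)
          (bernoulli_pmf (1 / (1 + exp (real_of_ereal \<epsilon>)))))))"

definition observed_pmf :: "nat \<Rightarrow> (nat \<Rightarrow> nat) \<Rightarrow> (nat \<Rightarrow> nat \<Rightarrow> real) \<Rightarrow> ereal \<Rightarrow> (nat \<Rightarrow> nat \<Rightarrow> bool) pmf" where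
  "observed_pmf n \<theta> B \<epsilon> = bind_pmf (sbm_pmf n \<theta> B) (edge_flip n \<epsilon>)"

definition debias :: "ereal \<Rightarrow> (nat \<Rightarrow> nat \<Rightarrow> bool) \<Rightarrow> nat \<Rightarrow> nat \<Rightarrow> real" where
  "debias \<epsilon> A i j = (if \<epsilon> = \<infinity> then (if A i j then 1 else 0)
     else (if A i j then 1 else 0) - (if i \<noteq> j then 1 / (exp (real_of_ereal \<epsilon>) + 1) else 0))"

definition orthonormal_cols :: "nat \<Rightarrow> nat \<Rightarrow> (nat \<Rightarrow> nat \<Rightarrow> real) \<Rightarrow> bool" where
  "orthonormal_cols n m V \<longleftrightarrow>
     (\<forall>a<m. \<forall>b<m. (\<Sum>i<n. V i a * V i b) = (if a = b then 1 else 0))"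

text \<open>U (n x k) has as columns orthonormal eigenvectors of the n x n matrix M for its k largest
  eigenvalues in absolute value (counted with multiplicity): U consists of the first k columns of an
  orthonormal eigenbasis V of M whose eigenvalues mu satisfy |mu b| <= |mu a| for a < k <= b.\<close>
definition top_k_eigvecs :: "nat \<Rightarrow> nat \<Rightarrow> (nat \<Rightarrow> nat \<Rightarrow> real) \<Rightarrow> (nat \<Rightarrow> nat \<Rightarrow> real) \<Rightarrow> bool" where
  "top_k_eigvecs n k M U \<longleftrightarrow> (\<exists>V \<mu>. orthonormal_cols n n V \<and>
     (\<forall>a<n. \<forall>i<n. (\<Sum>j<n. M i j * V j a) = \<mu> a * V i a) \<and>
     (\<forall>a<k. \<forall>b. k \<le> b \<and> b < n \<longrightarrow> \<bar>\<mu> b\<bar> \<le> \<bar>\<mu> a\<bar>) \<and>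
     (\<forall>i<n. \<forall>a<k. U i a = V i a))"

text \<open>A labelling lab : [n] -> [k] encodes a matrix in G^{n x k} (row i has its 1 in column lab i).\<close>
definition labeling :: "nat \<Rightarrow> nat \<Rightarrow> (nat \<Rightarrow> nat) \<Rightarrow> bool" where
  "labeling n k lab \<longleftrightarrow> (\<forall>i<n. lab i < k)"

text \<open>||Theta X - U||_F^2.\<close>
definition km_cost :: "nat \<Rightarrow> nat \<Rightarrow> (nat \<Rightarrow> nat \<Rightarrow> real) \<Rightarrow> (nat \<Rightarrow> nat) \<Rightarrow> (nat \<Rightarrow> nat \<Rightarrow> real) \<Rightarrow> real" where
  "km_cost n k U lab X = (\<Sum>i<n. \<Sum>c<k. (X (lab i) c - U i c)\<^sup>2)"

definition approx_kmeans :: "nat \<Rightarrow> nat \<Rightarrow> real \<Rightarrow> (nat \<Rightarrow> nat \<Rightarrow> real) \<Rightarrow> (nat \<Rightarrow> nat) \<Rightarrow> bool" where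
  "approx_kmeans n k \<gamma> U lab \<longleftrightarrow> labeling n k lab \<and>
     (\<exists>X. km_cost n k U lab X \<le> (1 + \<gamma>) *
        (INF p \<in> {p. labeling n k (fst p)}. km_cost n k U (fst p) (snd p)))"

definition algA_output :: "nat \<Rightarrow> nat \<Rightarrow> real \<Rightarrow> ereal \<Rightarrow> (nat \<Rightarrow> nat \<Rightarrow> bool) \<Rightarrow> (nat \<Rightarrow> nat) \<Rightarrow> bool" where
  "algA_output n k \<gamma> \<epsilon> A lab \<longleftrightarrow>
     (\<exists>U. top_k_eigvecs n k (debias \<epsilon> A) U \<and> approx_kmeans n k \<gamma> U lab)"

definition comm :: "nat \<Rightarrow> (nat \<Rightarrow> nat) \<Rightarrow> nat \<Rightarrow> nat set" where
  "comm n \<theta> j = {i. i < n \<and> \<theta> i = j}"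

definition n_min :: "nat \<Rightarrow> nat \<Rightarrow> (nat \<Rightarrow> nat) \<Rightarrow> nat" where
  "n_min n k \<theta> = Min ((\<lambda>j. card (comm n \<theta> j)) ` {..<k})"

definition n_max2 :: "nat \<Rightarrow> nat \<Rightarrow> (nat \<Rightarrow> nat) \<Rightarrow> nat" where
  "n_max2 n k \<theta> = (if k < 2 then 0 else rev (sort (map (\<lambda>j. card (comm n \<theta> j)) [0..<k])) ! 1)"

definition maxB :: "nat \<Rightarrow> (nat \<Rightarrow> nat \<Rightarrow> real) \<Rightarrow> real" where
  "maxB k B = Max {B i j | i j. i < k \<and> j < k}"

definition full_rank :: "nat \<Rightarrow> (nat \<Rightarrow> nat \<Rightarrow> real) \<Rightarrow> bool" where
  "full_rank k B \<longleftrightarrow> (\<forall>v. (\<forall>i<k. (\<Sum>j<k. B i j * v j) = 0) \<longrightarrow> (\<forall>j<k. v j = 0))"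

definition is_eigenvalue :: "nat \<Rightarrow> (nat \<Rightarrow> nat \<Rightarrow> real) \<Rightarrow> real \<Rightarrow> bool" where
  "is_eigenvalue k B \<mu> \<longleftrightarrow>
     (\<exists>v. (\<exists>i<k. v i \<noteq> 0) \<and> (\<forall>i<k. (\<Sum>j<k. B i j * v j) = \<mu> * v i))"

text \<open>lambda_B: smallest absolute eigenvalue of the (symmetric, hence real-diagonalisable) B.\<close>
definition lambda_min :: "nat \<Rightarrow> (nat \<Rightarrow> nat \<Rightarrow> real) \<Rightarrow> real" where
  "lambda_min k B = Min {\<bar>\<mu>\<bar> | \<mu>. is_eigenvalue k B \<mu>}"

definition g_eps :: "ereal \<Rightarrow> nat \<Rightarrow> (nat \<Rightarrow> nat \<Rightarrow> real) \<Rightarrow> real" where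
  "g_eps \<epsilon> k B = (if \<epsilon> = \<infinity> then maxB k B else
     (exp (real_of_ereal \<epsilon>) + 1) / (exp (real_of_ereal \<epsilon>) - 1) *
       (maxB k B + 1 / (exp (real_of_ereal \<epsilon>) - 1)))"

definition Lmis :: "nat \<Rightarrow> nat \<Rightarrow> (nat \<Rightarrow> nat) \<Rightarrow> (nat \<Rightarrow> nat) \<Rightarrow> real" where
  "Lmis n k \<theta> \<theta>h = Min ((\<lambda>\<sigma>. real (card {i. i < n \<and> \<sigma> (\<theta>h i) \<noteq> \<theta> i}) / real n)
     ` {\<sigma>. \<sigma> permutes {..<k}})"

definition Ltil :: "nat \<Rightarrow> nat \<Rightarrow> (nat \<Rightarrow> nat) \<Rightarrow> (nat \<Rightarrow> nat) \<Rightarrow> real" where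
  "Ltil n k \<theta> \<theta>h = Max ((\<lambda>j. Min ((\<lambda>\<sigma>. real (card {i \<in> comm n \<theta> j. \<sigma> (\<theta>h i) \<noteq> j})
        / real (card (comm n \<theta> j))) ` {\<sigma>. \<sigma> permutes {..<k}})) ` {..<k})"

end

theory Submission
  imports Defs "HOL-Combinatorics.List_Permutation"
begin

text \<open>Debiasing makes the expectation of the observed matrix, up to its diagonal, the block matrix
  \<open>P = s \<Theta> B \<Theta>\<^sup>T\<close> with \<open>s = (e\<^sup>\<epsilon> - 1) / (e\<^sup>\<epsilon> + 1)\<close>, and \<open>s\<^sup>2 g\<^sub>\<epsilon>(B)\<close> is the largest possible edge
  probability \<open>Q\<close> after flipping. Hence everything reduces to the bound \<open>|A - E A|\<^sup>2 \<le> C n Q\<close> with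
  probability \<open>1 - 1/n\<close> in the regime \<open>n Q \<ge> (ln n) / 2\<close>, followed by a perturbation argument.

  The norm bound follows Bandeira and van Handel: the trace of the \<open>2 p\<close>-th power, with \<open>p\<close> of order
  \<open>n Q\<close>, is a sum over closed walks, and by grouping the walks by shape its expectation is at most
  \<open>n / r\<close> times that of an \<open>r \<times> r\<close> matrix with independent subgaussian entries, \<open>r = 2 p\<close>.
  For the latter matrix a net argument is affordable because its dimension is comparable to \<open>p\<close>.

  For the perturbation, the \<open>k\<close> leading eigenvectors of the debiased matrix almost contain the column
  space of \<open>\<Theta>\<close> (Weyl and Davis-Kahan). So the cluster means of their rows form a cheap \<open>k\<close>-means
  solution, and its centers for communities of sizes \<open>n\<^sub>j\<close> and \<open>n\<^sub>l\<close> have squared distance at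
  least \<open>(1/n\<^sub>j + 1/n\<^sub>l) / 2\<close>; no alignment with the eigenvectors of \<open>P\<close> is needed.\<close>

section \<open>Euclidean vectors and matrices indexed by natural numbers\<close>

text \<open>The obstacle is sparsity. A centered edge variable has variance at most
  \<open>Q\<close>, but its subgaussian constant can be far larger, so a net in dimension n with a
  union bound does not reach a squared norm of order n \<open>Q\<close>. Counting walks uses only
  that all moments of order at least 2 are at most \<open>Q\<close>, and the comparison moves the
  problem to a matrix whose entries have variance of order 1. The choice p = d, the integer above n
  \<open>Q\<close>, serves three ends. A weight sum n \<open>Q\<close> becomes a number d of free
  vertices; in dimension 2 d the net and the exponential moments cost only a constant to the power
  d; and d \<ge> (ln n) / 2 makes the prefactor n affordable. The density hypothesis on
  \<open>maxB\<close> enters only for this last point. The huge constants are these powers, kept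
  explicit and not optimised. Norms and distances are squared throughout, so square roots are rarely
  met, and every dimension argument goes back to \<open>underdetermined\<close>.\<close>

definition dot :: "nat \<Rightarrow> (nat \<Rightarrow> real) \<Rightarrow> (nat \<Rightarrow> real) \<Rightarrow> real" where
  "dot n x y = (\<Sum>i<n. x i * y i)"

definition mv :: "nat \<Rightarrow> (nat \<Rightarrow> nat \<Rightarrow> real) \<Rightarrow> (nat \<Rightarrow> real) \<Rightarrow> nat \<Rightarrow> real" where
  "mv n M x i = (\<Sum>j<n. M i j * x j)"

definition op_bound :: "nat \<Rightarrow> (nat \<Rightarrow> nat \<Rightarrow> real) \<Rightarrow> real \<Rightarrow> bool" where
  "op_bound n M c \<longleftrightarrow> (\<forall>x. dot n (mv n M x) (mv n M x) \<le> c * dot n x x)"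

lemma dot_commute: "dot n x y = dot n y x"
  by (simp add: dot_def mult.commute)

lemma dot_nonneg: "0 \<le> dot n x x"
  by (simp add: dot_def sum_nonneg)

lemma dot_eq_0D: "dot n x x = 0 \<Longrightarrow> i < n \<Longrightarrow> x i = 0"
  by (auto simp: dot_def sum_nonneg_eq_0_iff)

lemma dot_sum_left: "dot n (\<lambda>i. \<Sum>a\<in>A. c a * f a i) y = (\<Sum>a\<in>A. c a * dot n (f a) y)"
  unfolding dot_def by (simp add: sum_distrib_left sum_distrib_right mult.assoc sum.swap[of _ _ A])

lemma dot_sum_right: "dot n y (\<lambda>i. \<Sum>a\<in>A. c a * f a i) = (\<Sum>a\<in>A. c a * dot n y (f a))"
  by (simp add: dot_commute[of n y] dot_sum_left)

lemma dot_scale_left: "dot n (\<lambda>i. c * x i) y = c * dot n x y"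
  by (simp add: dot_def sum_distrib_left mult.assoc)

lemma dot_scale_right: "dot n y (\<lambda>i. c * x i) = c * dot n y x"
  by (simp add: dot_commute[of n y] dot_scale_left)

lemma dot_diff_left: "dot n (\<lambda>i. x i - z i) y = dot n x y - dot n z y"
  by (simp add: dot_def left_diff_distrib sum_subtractf)

lemma dot_diff_right: "dot n y (\<lambda>i. x i - z i) = dot n y x - dot n y z"
  by (simp add: dot_commute[of n y] dot_diff_left)

lemma dot_cong: "(\<And>i. i < n \<Longrightarrow> x i = x' i) \<Longrightarrow> (\<And>i. i < n \<Longrightarrow> y i = y' i) \<Longrightarrow> dot n x y = dot n x' y'"
  by (simp add: dot_def)

lemma dot_Cauchy_Schwarz: "(dot n x y)\<^sup>2 \<le> dot n x x * dot n y y"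
  using Cauchy_Schwarz_ineq_sum[of x y "{..<n}"] by (simp add: dot_def power2_eq_square)

lemma mv_sum: "mv n M (\<lambda>i. \<Sum>a\<in>A. c a * f a i) i = (\<Sum>a\<in>A. c a * mv n M (f a) i)"
  unfolding mv_def
  by (simp add: sum_distrib_left sum_distrib_right mult.assoc mult.left_commute sum.swap[of _ _ A])

lemma mv_scale: "mv n M (\<lambda>i. c * x i) i = c * mv n M x i"
  by (simp add: mv_def sum_distrib_left mult.left_commute)

lemma mv_add: "mv n M (\<lambda>i. x i + y i) i = mv n M x i + mv n M y i"
  by (simp add: mv_def distrib_left sum.distrib)

lemma mv_diff: "mv n M (\<lambda>i. x i - y i) i = mv n M x i - mv n M y i"
  by (simp add: mv_def right_diff_distrib sum_subtractf)

lemma mv_matrix_diff: "mv n (\<lambda>i j. M i j - P i j) x i = mv n M x i - mv n P x i"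
  by (simp add: mv_def left_diff_distrib sum_subtractf)

lemma dot_mv_swap: "dot n x (mv n M y) = dot n (mv n (\<lambda>i j. M j i) x) y"
  unfolding dot_def mv_def
  by (simp add: sum_distrib_left sum_distrib_right mult_ac) (rule sum.swap)

lemma dot_mv_symm:
  assumes "\<And>i j. i < n \<Longrightarrow> j < n \<Longrightarrow> M i j = M j i"
  shows "dot n x (mv n M y) = dot n (mv n M x) y"
proof -
  have "mv n (\<lambda>i j. M j i) x i = mv n M x i" if "i < n" for i
    unfolding mv_def using assms that by (intro sum.cong) auto
  then show ?thesis
    unfolding dot_mv_swap by (intro dot_cong) auto
qed

text \<open>Gaussian elimination, by induction on the number of equations: a nonzero coefficient in
  the last equation eliminates one unknown from the others. It yields dimension bounds, surjectivity
  of full rank matrices and the intersection of subspaces.\<close>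

lemma underdetermined:
  fixes F :: "nat \<Rightarrow> nat \<Rightarrow> real"
  shows "\<exists>c. (\<exists>b\<le>m. c b \<noteq> 0) \<and> (\<forall>i<m. (\<Sum>b\<le>m. F i b * c b) = 0)"
proof (induction m arbitrary: F)
  case 0
  show ?case by (intro exI[of _ "\<lambda>_. 1"]) auto
next
  case (Suc m)
  show ?case
  proof (cases "\<exists>b\<le>Suc m. F m b \<noteq> 0")
    case False
    obtain c where c: "\<exists>b\<le>m. c b \<noteq> 0" "\<forall>i<m. (\<Sum>b\<le>m. F i b * c b) = 0"
      using Suc.IH[of F] by auto
    define c' where "c' = (\<lambda>b. if b \<le> m then c b else 0)"
    have *: "(\<Sum>b\<le>m. F i b * c' b) = (\<Sum>b\<le>m. F i b * c b)" for i
      by (intro sum.cong) (auto simp: c'_def)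
    have "(\<Sum>b\<le>Suc m. F i b * c' b) = 0" if "i < Suc m" for i
    proof (cases "i = m")
      case True
      with False show ?thesis by (intro sum.neutral) auto
    next
      case neq: False
      with that c * show ?thesis by (simp add: c'_def)
    qed
    moreover have "\<exists>b\<le>Suc m. c' b \<noteq> 0"
      using c(1) unfolding c'_def by (metis le_SucI)
    ultimately show ?thesis by blast
  next
    case True
    then obtain p where p: "p \<le> Suc m" "F m p \<noteq> 0" by auto
    \<comment> \<open>\<open>s\<close> enumerates the unknowns other than the pivot
      \<open>p\<close>; \<open>G\<close> is the system after elimination of \<open>p\<close>. Below,
      \<open>c'\<close> undoes the renumbering and reads off its value at \<open>p\<close> from
      equation \<open>m\<close>.\<close>
    define s where "s = (\<lambda>b. if b < p then b else Suc b)"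
    define G where "G = (\<lambda>i b. F i (s b) - F i p * F m (s b) / F m p)"
    obtain c where c: "\<exists>b\<le>m. c b \<noteq> 0" "\<forall>i<m. (\<Sum>b\<le>m. G i b * c b) = 0"
      using Suc.IH[of G] by auto
    have s_bij: "bij_betw s {..m} ({..Suc m} - {p})"
      by (rule bij_betw_byWitness[where f' = "\<lambda>b. if b < p then b else b - 1"])
         (use p in \<open>auto simp: s_def\<close>)
    define c' where "c' = (\<lambda>b. if b = p then - (\<Sum>b\<le>m. F m (s b) * c b) / F m p
        else c (if b < p then b else b - 1))"
    have c's: "c' (s b) = c b" for b by (auto simp: c'_def s_def)
    have split: "(\<Sum>b\<le>Suc m. F i b * c' b) = F i p * c' p + (\<Sum>b\<le>m. F i (s b) * c b)" for i
    proof -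
      have "(\<Sum>b\<le>Suc m. F i b * c' b) = F i p * c' p + (\<Sum>b\<in>{..Suc m} - {p}. F i b * c' b)"
        using p(1) by (subst sum.remove[of _ p]) auto
      also have "(\<Sum>b\<in>{..Suc m} - {p}. F i b * c' b) = (\<Sum>b\<le>m. F i (s b) * c' (s b))"
        by (rule sum.reindex_bij_betw[OF s_bij, symmetric])
      finally show ?thesis by (simp add: c's)
    qed
    have "(\<Sum>b\<le>Suc m. F i b * c' b) = 0" if "i < Suc m" for i
    proof (cases "i = m")
      case True
      with p show ?thesis by (simp only: split) (simp add: c'_def)
    next
      case neq: False
      have "0 = (\<Sum>b\<le>m. G i b * c b)" using c(2) neq that by auto
      also have "\<dots> = (\<Sum>b\<le>m. F i (s b) * c b) - F i p / F m p * (\<Sum>b\<le>m. F m (s b) * c b)"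
        unfolding G_def left_diff_distrib sum_subtractf sum_distrib_left by (simp add: mult_ac)
      finally show ?thesis by (simp only: split) (simp add: c'_def)
    qed
    moreover obtain b where "b \<le> m" "c b \<noteq> 0" using c(1) by auto
    then have "s b \<le> Suc m" "c' (s b) \<noteq> 0" by (simp_all add: c's, simp add: s_def)
    ultimately show ?thesis by blast
  qed
qed

text \<open>The n + 1 vectors satisfy a nontrivial linear relation; its inner product with a vector
  of nonzero coefficient leaves only that vector's squared norm.\<close>

lemma orthogonal_nonzero_card:
  fixes V :: "nat \<Rightarrow> nat \<Rightarrow> real"
  assumes "\<And>a b. a \<le> n \<Longrightarrow> b \<le> n \<Longrightarrow> a \<noteq> b \<Longrightarrow> dot n (V a) (V b) = 0"
  shows "\<exists>a\<le>n. dot n (V a) (V a) = 0"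
proof (rule ccontr)
  assume neg: "\<not> ?thesis"
  obtain c where c: "\<exists>b\<le>n. c b \<noteq> 0" "\<forall>i<n. (\<Sum>b\<le>n. V b i * c b) = 0"
    using underdetermined[of n "\<lambda>i b. V b i"] by auto
  obtain b where b: "b \<le> n" "c b \<noteq> 0" using c(1) by auto
  have "0 = dot n (\<lambda>i. \<Sum>a\<le>n. c a * V a i) (V b)"
    using c(2) by (simp add: dot_def mult.commute)
  also have "\<dots> = (\<Sum>a\<le>n. c a * dot n (V a) (V b))" by (rule dot_sum_left)
  also have "\<dots> = (\<Sum>a\<le>n. if a = b then c b * dot n (V b) (V b) else 0)"
    using assms b by (intro sum.cong) auto
  also have "\<dots> = c b * dot n (V b) (V b)" using b by simp
  finally show False using b neg by auto
qed

lemma orthonormal_expansion: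
  assumes V: "orthonormal_cols n n V" and i: "i < n"
  shows "x i = (\<Sum>a<n. dot n (\<lambda>i. V i a) x * V i a)"
proof -
  define y where "y = (\<lambda>i. x i - (\<Sum>a<n. dot n (\<lambda>i. V i a) x * V i a))"
  \<comment> \<open>The residual \<open>y\<close> is orthogonal to all n columns, and together they
    are n + 1 orthogonal vectors. The columns are unit vectors, so it is \<open>y\<close> that
    vanishes.\<close>
  define W where "W = (\<lambda>a. if a < n then (\<lambda>i. V i a) else y)"
  have VV: "dot n (\<lambda>i. V i a) (\<lambda>i. V i b) = (if a = b then 1 else 0)" if "a < n" "b < n" for a b
    using V that by (auto simp: orthonormal_cols_def dot_def)
  have Vy: "dot n (\<lambda>i. V i a) y = 0" if "a < n" for a
  proof -
    have "dot n (\<lambda>i. V i a) y = dot n (\<lambda>i. V i a) x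
      - (\<Sum>b<n. dot n (\<lambda>i. V i b) x * dot n (\<lambda>i. V i a) (\<lambda>i. V i b))"
      unfolding y_def by (simp add: dot_diff_right dot_sum_right)
    also have "(\<Sum>b<n. dot n (\<lambda>i. V i b) x * dot n (\<lambda>i. V i a) (\<lambda>i. V i b))
       = (\<Sum>b<n. if b = a then dot n (\<lambda>i. V i a) x else 0)"
      using that by (intro sum.cong) (auto simp: VV)
    finally show ?thesis using that by simp
  qed
  have "\<exists>a\<le>n. dot n (W a) (W a) = 0"
  proof (rule orthogonal_nonzero_card)
    fix a b assume "a \<le> n" "b \<le> n" "a \<noteq> b"
    then show "dot n (W a) (W b) = 0"
      using Vy VV by (auto simp: W_def dot_commute[of n y])
  qed
  then have "dot n y y = 0"
    using VV unfolding W_def by (metis le_neq_implies_less zero_neq_one)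
  from dot_eq_0D[OF this i] show ?thesis by (simp add: y_def)
qed

lemma orthonormal_Parseval:
  assumes V: "orthonormal_cols n n V"
  shows "dot n x y = (\<Sum>a<n. dot n (\<lambda>i. V i a) x * dot n (\<lambda>i. V i a) y)"
proof -
  have "dot n x y = dot n (\<lambda>i. \<Sum>a<n. dot n (\<lambda>i. V i a) x * V i a) y"
    using orthonormal_expansion[OF V] by (intro dot_cong) auto
  then show ?thesis by (simp add: dot_sum_left)
qed

text \<open>Eigenvectors of distinct eigenvalues are orthogonal. Finiteness is what gives the
  \<open>Min\<close> in \<open>lambda_min\<close> its meaning.\<close>

lemma symmetric_eigenvalues_finite:
  fixes B :: "nat \<Rightarrow> nat \<Rightarrow> real"
  assumes sym: "\<And>i j. i < k \<Longrightarrow> j < k \<Longrightarrow> B i j = B j i"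
  shows "finite {\<mu>. is_eigenvalue k B \<mu>}"
proof (rule ccontr)
  assume "infinite {\<mu>. is_eigenvalue k B \<mu>}"
  then obtain f :: "nat \<Rightarrow> real" where f: "inj f" "range f \<subseteq> {\<mu>. is_eigenvalue k B \<mu>}"
    using infinite_countable_subset by blast
  then have "\<forall>a. \<exists>v. (\<exists>i<k. v i \<noteq> 0) \<and> (\<forall>i<k. mv k B v i = f a * v i)"
    unfolding is_eigenvalue_def mv_def by blast
  then obtain v where v: "\<And>a. \<exists>i<k. v a i \<noteq> 0" "\<And>a i. i < k \<Longrightarrow> mv k B (v a) i = f a * v a i"
    by metis
  have "dot k (v a) (v b) = 0" if "a \<noteq> b" for a b
  proof -
    have "f b * dot k (v a) (v b) = dot k (v a) (mv k B (v b))"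
      using v(2) by (subst dot_cong[OF refl v(2)]) (auto simp: dot_scale_right)
    also have "\<dots> = dot k (mv k B (v a)) (v b)" by (rule dot_mv_symm[OF sym])
    also have "\<dots> = f a * dot k (v a) (v b)"
      by (subst dot_cong[OF v(2) refl]) (auto simp: dot_scale_left)
    finally show ?thesis using f(1) that by (auto dest: injD)
  qed
  then obtain a where "dot k (v a) (v a) = 0"
    using orthogonal_nonzero_card[of k v] by auto
  with v(1)[of a] show False using dot_eq_0D by blast
qed

lemma dot_mv_min_attained:
  fixes B :: "nat \<Rightarrow> nat \<Rightarrow> real"
  assumes "0 < k"
  obtains w where "dot k w w = 1" "\<And>x. dot k (mv k B w) (mv k B w) * dot k x x \<le> dot k (mv k B x) (mv k B x)"
proof -
  \<comment> \<open>Coordinates from \<open>k\<close> on are pinned to 0, so the cube is a product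
    of compact sets and compact by Tychonoff, and the unit sphere is a closed part of it.\<close>
  define S where "S = PiE UNIV (\<lambda>i. if i < k then {-1..1::real} else {0}) \<inter> {x. dot k x x = 1}"
  have comp: "compact (PiE UNIV (\<lambda>i::nat. if i < k then {-1..1::real} else {0}))"
    using compactin_PiE[of "\<lambda>_. euclidean" UNIV "\<lambda>i::nat. if i < k then {-1..1::real} else {0}"]
    by (simp add: euclidean_product_topology)
  have cont: "continuous_on UNIV (\<lambda>x. dot k x x)" "continuous_on UNIV (\<lambda>x. dot k (mv k B x) (mv k B x))"
    unfolding dot_def mv_def by (intro continuous_intros continuous_on_product_coordinates)+
  have "closed {x. dot k x x = 1}"
    by (intro closed_Collect_eq cont continuous_intros)
  then have "compact S" unfolding S_def by (rule compact_Int_closed[OF comp])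
  moreover have "(\<lambda>i. if i = 0 then 1 else 0) \<in> S"
    using assms by (auto simp: S_def dot_def if_distrib cong: if_cong)
  ultimately obtain w where w: "w \<in> S" "\<And>y. y \<in> S \<Longrightarrow> dot k (mv k B w) (mv k B w) \<le> dot k (mv k B y) (mv k B y)"
    using continuous_attains_inf[of S "\<lambda>x. dot k (mv k B x) (mv k B x)"] cont(2)
      continuous_on_subset by (metis (no_types, lifting) empty_iff top_greatest)
  have "dot k (mv k B w) (mv k B w) * dot k x x \<le> dot k (mv k B x) (mv k B x)" for x
  proof (cases "dot k x x = 0")
    case True
    then show ?thesis by (simp add: dot_nonneg)
  next
    case False
    define r where "r = sqrt (dot k x x)"
    have r: "r > 0" "r\<^sup>2 = dot k x x"
      using False dot_nonneg[of k x] by (auto simp: r_def)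
    define y where "y = (\<lambda>i. if i < k then 1 / r * x i else 0)"
    have yy: "dot k y y = 1"
    proof -
      have "dot k y y = dot k (\<lambda>i. 1 / r * x i) (\<lambda>i. 1 / r * x i)"
        by (intro dot_cong) (auto simp: y_def)
      also have "\<dots> = 1" by (simp only: dot_scale_left dot_scale_right r(2)[symmetric]) (use r(1) in \<open>simp add: power2_eq_square\<close>)
      finally show ?thesis .
    qed
    have "- 1 \<le> y i \<and> y i \<le> 1" if "i < k" for i
    proof -
      have "y i * y i \<le> dot k y y" unfolding dot_def
        by (rule member_le_sum) (use that in auto)
      then have "\<bar>y i\<bar> \<le> 1" using yy by (simp only: abs_square_le_1 flip: power2_eq_square)
      then show ?thesis by linarith
    qed
    moreover have "y i = 0" if "\<not> i < k" for i using that by (simp add: y_def)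
    ultimately have "y \<in> S" using yy by (auto simp: S_def)
    from w(2)[OF this]
    have "dot k (mv k B w) (mv k B w) \<le> dot k (mv k B y) (mv k B y)" .
    also have "mv k B y = (\<lambda>i. 1 / r * mv k B x i)"
      unfolding mv_def y_def by (simp add: sum_distrib_left mult_ac)
    also have "dot k \<dots> \<dots> = dot k (mv k B x) (mv k B x) / r\<^sup>2"
      by (simp only: dot_scale_left dot_scale_right) (simp add: power2_eq_square)
    finally show ?thesis using False dot_nonneg[of k x] by (simp add: r(2) pos_le_divide_eq)
  qed
  moreover have "dot k w w = 1" using w(1) by (simp add: S_def)
  ultimately show ?thesis using that by blast
qed

text \<open>A minimiser \<open>w\<close> of \<open>|B x|\<^sup>2\<close> on the sphere satisfies \<open>B\<^sup>2 w = m\<^sup>2 w\<close>; factoring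
  \<open>(B + m) (B - m) w = 0\<close> shows that \<open>m\<close> or \<open>- m\<close> is an eigenvalue of \<open>B\<close>.\<close>
lemma symmetric_lower_bound:
  fixes B :: "nat \<Rightarrow> nat \<Rightarrow> real"
  assumes k: "0 < k" and sym: "\<And>i j. i < k \<Longrightarrow> j < k \<Longrightarrow> B i j = B j i"
    and pos: "0 \<le> lambda_min k B"
  shows "(lambda_min k B)\<^sup>2 * dot k x x \<le> dot k (mv k B x) (mv k B x)"
proof -
  obtain w where w: "dot k w w = 1"
    "\<And>x. dot k (mv k B w) (mv k B w) * dot k x x \<le> dot k (mv k B x) (mv k B x)"
    using dot_mv_min_attained[OF k] by blast
  define q where "q = dot k (mv k B w) (mv k B w)"
  define m where "m = sqrt q"
  have m: "m \<ge> 0" "m\<^sup>2 = q" using dot_nonneg[of k "mv k B w"] by (auto simp: m_def q_def)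
  \<comment> \<open>Up to a factor 2 this is the gradient at \<open>w\<close> of |B x|^2 - q |x|^2,
    a function that is nonnegative and vanishes at \<open>w\<close>. Moving from \<open>w\<close>
    along \<open>h\<close> shows that it must be zero.\<close>
  define h where "h = (\<lambda>i. mv k B (mv k B w) i - q * w i)"
  have "dot k h h = 0"
  proof (rule ccontr)
    assume "dot k h h \<noteq> 0"
    then have hh: "dot k h h > 0" using dot_nonneg[of k h] by auto
    have key: "0 \<le> 2 * t * dot k h h + t\<^sup>2 * dot k (mv k B h) (mv k B h)" for t
    proof -
      have "q * dot k (\<lambda>i. w i + t * h i) (\<lambda>i. w i + t * h i)
         \<le> dot k (mv k B (\<lambda>i. w i + t * h i)) (mv k B (\<lambda>i. w i + t * h i))"
        unfolding q_def by (rule w(2))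
      also have "mv k B (\<lambda>i. w i + t * h i) = (\<lambda>i. mv k B w i + t * mv k B h i)"
        by (rule ext) (simp add: mv_add mv_scale)
      also have "dot k \<dots> \<dots> = q + 2 * t * dot k (mv k B w) (mv k B h) + t\<^sup>2 * dot k (mv k B h) (mv k B h)"
        unfolding q_def dot_def
        by (simp add: algebra_simps power2_eq_square sum.distrib sum_distrib_left)
      also have "dot k (mv k B w) (mv k B h) = dot k (mv k B (mv k B w)) h"
        by (rule dot_mv_symm[OF sym])
      also have "dot k (\<lambda>i. w i + t * h i) (\<lambda>i. w i + t * h i) = 1 + 2 * t * dot k w h + t\<^sup>2 * dot k h h"
        unfolding w(1)[symmetric] dot_def
        by (simp add: algebra_simps power2_eq_square sum.distrib sum_distrib_left)
      finally have "0 \<le> 2 * t * (dot k (mv k B (mv k B w)) h - q * dot k w h)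
          + t\<^sup>2 * dot k (mv k B h) (mv k B h) - q * t\<^sup>2 * dot k h h"
        by (simp add: algebra_simps)
      moreover have "dot k (mv k B (mv k B w)) h - q * dot k w h = dot k h h"
        by (subst (3) h_def) (simp add: dot_diff_left dot_scale_left)
      moreover have "q * t\<^sup>2 * dot k h h \<ge> 0" using dot_nonneg[of k h] m(2)
        by (metis mult_nonneg_nonneg zero_le_power2)
      ultimately show ?thesis by simp
    qed
    define Q where "Q = dot k (mv k B h) (mv k B h)"
    have Q: "Q \<ge> 0" by (simp add: Q_def dot_nonneg)
    \<comment> \<open>The minimiser of the quadratic with \<open>Q + 1\<close> in place of
      \<open>Q\<close>; the added 1 keeps the denominator positive when B h = 0.\<close>
    define t where "t = - dot k h h / (Q + 1)"
    have "0 \<le> 2 * t * dot k h h + t\<^sup>2 * Q" using key Q_def by simp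
    also have "\<dots> \<le> 2 * t * dot k h h + t\<^sup>2 * (Q + 1)"
      by (simp add: algebra_simps)
    also have "\<dots> = t * (2 * dot k h h + t * (Q + 1))"
      by (simp add: algebra_simps power2_eq_square)
    also have "t * (Q + 1) = - dot k h h" using Q by (simp add: t_def)
    also have "t * (2 * dot k h h + - dot k h h) = - ((dot k h h)\<^sup>2 / (Q + 1))"
      by (simp add: t_def power2_eq_square)
    also have "\<dots> < 0" using hh Q by simp
    finally show False by simp
  qed
  then have BB: "mv k B (mv k B w) i = m\<^sup>2 * w i" if "i < k" for i
    using dot_eq_0D[OF _ that, of h] m by (simp add: h_def)
  define u where "u = (\<lambda>i. mv k B w i - m * w i)"
  have "is_eigenvalue k B m \<or> is_eigenvalue k B (- m)"
  proof (cases "\<exists>i<k. u i \<noteq> 0")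
    case True
    have "mv k B u i = - m * u i" if "i < k" for i
      unfolding u_def by (simp add: mv_diff mv_scale BB[OF that] algebra_simps power2_eq_square)
    with True show ?thesis unfolding is_eigenvalue_def mv_def by blast
  next
    case False
    have "\<exists>i<k. w i \<noteq> 0" using w(1) by (auto simp: dot_def intro: ccontr)
    moreover have "\<forall>i<k. mv k B w i = m * w i" using False by (auto simp: u_def)
    ultimately show ?thesis unfolding is_eigenvalue_def mv_def by blast
  qed
  then have mem: "m \<in> {\<bar>\<mu>\<bar> | \<mu>. is_eigenvalue k B \<mu>}" using m(1) by force
  have "finite {\<bar>\<mu>\<bar> | \<mu>. is_eigenvalue k B \<mu>}"
    using symmetric_eigenvalues_finite[OF sym] by (simp add: setcompr_eq_image)
  then have "lambda_min k B \<le> m" unfolding lambda_min_def using mem by (rule Min_le)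
  then have "(lambda_min k B)\<^sup>2 \<le> q" using pos m by (metis power_mono)
  then have "(lambda_min k B)\<^sup>2 * dot k x x \<le> q * dot k x x"
    by (intro mult_right_mono dot_nonneg)
  with w(2)[of x] show ?thesis by (simp add: q_def)
qed

text \<open>Appending - a as an extra column gives k equations in k + 1 unknowns. By injectivity a
  nontrivial solution has a nonzero last coordinate, by which it can be divided.\<close>

lemma full_rank_surj:
  assumes "full_rank k B"
  obtains w where "\<And>i. i < k \<Longrightarrow> mv k B w i = a i"
proof -
  define F where "F = (\<lambda>i b. if b < k then B i b else - a i)"
  obtain c where c: "\<exists>b\<le>k. c b \<noteq> 0" "\<forall>i<k. (\<Sum>b\<le>k. F i b * c b) = 0"
    using underdetermined[of k F] by auto
  have "(\<Sum>b\<le>k. F i b * c b) = mv k B c i - a i * c k" for i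
    by (simp add: F_def mv_def lessThan_Suc_atMost[symmetric] cong: if_cong)
  then have eq: "\<And>i. i < k \<Longrightarrow> mv k B c i = a i * c k" using c(2) by simp
  have "c k \<noteq> 0"
  proof
    assume 0: "c k = 0"
    then have "\<forall>i<k. mv k B c i = 0" using eq by simp
    then have "\<forall>j<k. c j = 0" using assms unfolding full_rank_def mv_def by blast
    with 0 c(1) show False by (metis le_neq_implies_less)
  qed
  then have "mv k B (\<lambda>j. 1 / c k * c j) i = a i" if "i < k" for i
    by (simp only: mv_scale eq[OF that]) simp
  then show ?thesis using that by blast
qed

section \<open>Shapes of closed walks\<close>

definition ed :: "nat \<Rightarrow> nat \<Rightarrow> nat \<times> nat" where
  "ed x y = (min x y, max x y)"

text \<open>Walks are lists read from the right: the head is the vertex visited last.\<close>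
fun edges :: "nat list \<Rightarrow> (nat \<times> nat) list" where
  "edges (x # y # zs) = ed x y # edges (y # zs)"
| "edges _ = []"

fun wt :: "(nat \<Rightarrow> nat \<Rightarrow> real) \<Rightarrow> nat list \<Rightarrow> real" where
  "wt X (x # y # zs) = X x y * wt X (y # zs)"
| "wt X _ = 1"

text \<open>The weight of the tree of discovery edges: a step counts only when it reaches a vertex
  for the first time. This is the part of a walk's weight that can be summed out one vertex at a
  time.\<close>

fun fresh_wt :: "(nat \<Rightarrow> nat \<Rightarrow> real) \<Rightarrow> nat list \<Rightarrow> real" where
  "fresh_wt w (x # y # zs) = (if x \<in> set (y # zs) then 1 else w x y) * fresh_wt w (y # zs)"
| "fresh_wt w _ = 1"

text \<open>Equality of shapes: one walk is an injective relabelling of the vertices of the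
  other.\<close>

definition sim :: "nat list \<Rightarrow> nat list \<Rightarrow> bool" where
  "sim u v \<longleftrightarrow> length u = length v \<and> (\<forall>i<length u. \<forall>j<length u. u ! i = u ! j \<longleftrightarrow> v ! i = v ! j)"

text \<open>These are the walks whose expected weight can be nonzero: a loop meets the zero
  diagonal, and an edge used exactly once contributes a factor of mean 0.\<close>

definition good :: "nat list \<Rightarrow> bool" where
  "good u \<longleftrightarrow> (\<forall>e\<in>set (edges u). fst e \<noteq> snd e \<and> 2 \<le> count_list (edges u) e)"

definition walks :: "nat \<Rightarrow> nat \<Rightarrow> nat list set" where
  "walks n L = {u. set u \<subseteq> {..<n} \<and> length u = Suc L}"

definition good_closed :: "nat \<Rightarrow> nat \<Rightarrow> nat list set" where
  "good_closed n L = {u \<in> walks n L. hd u = last u \<and> good u}"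

definition sim_class :: "nat \<Rightarrow> nat list \<Rightarrow> nat list set" where
  "sim_class n v = {u. set u \<subseteq> {..<n} \<and> sim u v}"

lemma ed_eq_iff: "ed a b = ed c d \<longleftrightarrow> a = c \<and> b = d \<or> a = d \<and> b = c"
  by (auto simp: ed_def min_def max_def)

lemma length_edges: "length (edges u) = length u - 1"
  by (induction u rule: edges.induct) auto

lemma nth_edges: "Suc t < length u \<Longrightarrow> edges u ! t = ed (u ! t) (u ! Suc t)"
proof (induction u arbitrary: t rule: edges.induct)
  case (1 x y zs)
  then show ?case by (cases t) auto
qed auto

lemma edges_subset: "e \<in> set (edges u) \<Longrightarrow> fst e \<in> set u \<and> snd e \<in> set u"
  by (induction u rule: edges.induct) (auto simp: ed_def min_def max_def split: if_splits)

lemma finite_walks: "finite (walks n L)"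
  unfolding walks_def using finite_lists_length_eq[of "{..<n}" "Suc L"] by simp

lemma finite_good_closed: "finite (good_closed n L)"
  using finite_walks by (auto simp: good_closed_def)

lemma finite_sim_class: "finite (sim_class n v)"
  by (rule finite_subset[OF _ finite_lists_length_eq[of "{..<n}" "length v"]])
     (auto simp: sim_class_def sim_def)

lemma sim_commute: "sim u v \<longleftrightarrow> sim v u"
  by (auto simp: sim_def)

lemma sim_Cons:
  "sim (x # u) (y # v) \<longleftrightarrow> sim u v \<and> (\<forall>i<length u. x = u ! i \<longleftrightarrow> y = v ! i)"
proof
  assume a: "sim (x # u) (y # v)"
  then have l: "length u = length v" by (simp add: sim_def)
  have "u ! i = u ! j \<longleftrightarrow> v ! i = v ! j" if "i < length u" "j < length u" for i j
    using a that unfolding sim_def by (metis Suc_less_eq length_Cons nth_Cons_Suc)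
  moreover have "x = u ! i \<longleftrightarrow> y = v ! i" if "i < length u" for i
    using a that unfolding sim_def by (metis Suc_less_eq length_Cons nth_Cons_Suc nth_Cons_0 zero_less_Suc)
  ultimately show "sim u v \<and> (\<forall>i<length u. x = u ! i \<longleftrightarrow> y = v ! i)"
    using l by (simp add: sim_def)
next
  assume "sim u v \<and> (\<forall>i<length u. x = u ! i \<longleftrightarrow> y = v ! i)"
  then show "sim (x # u) (y # v)"
    by (auto simp: sim_def nth_Cons split: nat.split)
qed

lemma sim_Cons_mem: "sim (x # u) (y # v) \<Longrightarrow> x \<in> set u \<longleftrightarrow> y \<in> set v"
  unfolding sim_Cons by (auto simp: in_set_conv_nth sim_def)

lemma sim_card: "sim u v \<Longrightarrow> card (set u) = card (set v)"
proof (induction u arbitrary: v)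
  case Nil
  then show ?case by (simp add: sim_def)
next
  case (Cons x u)
  then obtain y v' where v: "v = y # v'" by (cases v) (auto simp: sim_def)
  with Cons show ?case using sim_Cons_mem[of x u y v'] by (auto simp: sim_Cons card_insert_if)
qed

lemma sim_hd_last: "sim u v \<Longrightarrow> u \<noteq> [] \<Longrightarrow> hd u = last u \<Longrightarrow> hd v = last v"
proof -
  assume a: "sim u v" "u \<noteq> []" "hd u = last u"
  then have "v \<noteq> []" "length v = length u" by (auto simp: sim_def)
  with a have "u ! 0 = u ! (length u - 1)" by (simp add: hd_conv_nth last_conv_nth)
  moreover have "0 < length u" "length u - 1 < length u" using a by auto
  ultimately have "v ! 0 = v ! (length u - 1)" using a(1) unfolding sim_def by blast
  then show ?thesis using \<open>v \<noteq> []\<close> \<open>length v = length u\<close> by (simp add: hd_conv_nth last_conv_nth)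
qed

lemma count_list_nth: "count_list xs a = card {s. s < length xs \<and> xs ! s = a}"
  by (simp add: count_list_eq_length_filter length_filter_conv_card eq_commute)

text \<open>Whether two steps use the same undirected edge is decided by the equality pattern of the
  vertices, so edge multiplicities depend only on the shape.\<close>

lemma sim_good:
  assumes s: "sim u v" and g: "good u"
  shows "good v"
proof -
  have l: "length u = length v" using s by (simp add: sim_def)
  have eq: "edges u ! s = edges u ! t \<longleftrightarrow> edges v ! s = edges v ! t"
    if "Suc s < length u" "Suc t < length u" for s t
    using s that l by (simp add: nth_edges ed_eq_iff) (simp add: sim_def)
  have "fst (edges v ! t) \<noteq> snd (edges v ! t) \<and> 2 \<le> count_list (edges v) (edges v ! t)"
    if t: "Suc t < length u" for t
  proof -
    have m: "edges u ! t \<in> set (edges u)" using t by (intro nth_mem) (simp add: length_edges)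
    have "count_list (edges u) (edges u ! t) = count_list (edges v) (edges v ! t)"
      unfolding count_list_nth using eq t l
      by (intro arg_cong[where f = card]) (auto simp: length_edges)
    moreover have "u ! t \<noteq> u ! Suc t"
      using g m t by (auto simp: good_def nth_edges ed_def)
    then have "v ! t \<noteq> v ! Suc t" using s t l by (auto simp: sim_def)
    then have "fst (edges v ! t) \<noteq> snd (edges v ! t)"
      using t l by (auto simp: nth_edges ed_def min_def max_def)
    ultimately show ?thesis using g m by (auto simp: good_def)
  qed
  note * = this
  show ?thesis
    unfolding good_def
  proof
    fix e assume "e \<in> set (edges v)"
    then obtain t where t: "t < length (edges v)" "e = edges v ! t" by (auto simp: in_set_conv_nth)
    with l have "Suc t < length u" by (simp add: length_edges)
    from *[OF this] t show "fst e \<noteq> snd e \<and> 2 \<le> count_list (edges v) e" by simp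
  qed
qed

lemma good_closed_sim:
  assumes "u \<in> good_closed n L"
  shows "sim_class r u = {v \<in> good_closed r L. sim v u}"
proof -
  have "u \<noteq> []" using assms by (auto simp: good_closed_def walks_def)
  then show ?thesis using assms
    by (auto simp: sim_class_def good_closed_def walks_def sim_commute[of _ u]
        intro: sim_good sim_hd_last) (auto simp: sim_def)
qed

lemma sum_sim_class_Cons:
  fixes F :: "nat list \<Rightarrow> real"
  shows "sum F (sim_class n (y # v))
    = (\<Sum>u\<in>sim_class n v. \<Sum>x\<in>{x. x < n \<and> (\<forall>i<length u. x = u ! i \<longleftrightarrow> y = v ! i)}. F (x # u))"
proof -
  have "sum F (sim_class n (y # v)) = (\<Sum>(u, x)\<in>(SIGMA u:sim_class n v.
      {x. x < n \<and> (\<forall>i<length u. x = u ! i \<longleftrightarrow> y = v ! i)}). F (x # u))"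
  proof (rule sum.reindex_bij_witness[where j = "\<lambda>u. (tl u, hd u)" and i = "\<lambda>(u, x). x # u"])
    fix a assume "a \<in> sim_class n (y # v)"
    then obtain x u where "a = x # u" "set a \<subseteq> {..<n}" "sim a (y # v)"
      by (cases a) (auto simp: sim_class_def sim_def)
    then show "(case (tl a, hd a) of (u, x) \<Rightarrow> x # u) = a"
      "(tl a, hd a) \<in> (SIGMA u:sim_class n v. {x. x < n \<and> (\<forall>i<length u. x = u ! i \<longleftrightarrow> y = v ! i)})"
      "(case (tl a, hd a) of (u, x) \<Rightarrow> F (x # u)) = F a"
      by (auto simp: sim_class_def sim_Cons)
  qed (auto simp: sim_class_def sim_Cons)
  then show ?thesis by (subst sum.Sigma) (auto simp: finite_sim_class)
qed

section \<open>Summing and counting walks of a given shape\<close>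

lemma fresh_wt_nonneg: "(\<And>x y. 0 \<le> w x y) \<Longrightarrow> 0 \<le> fresh_wt w u"
  by (induction w u rule: fresh_wt.induct) auto

text \<open>Build the walk along its shape. The initial vertex has n choices, each later new vertex
  costs a row sum of \<open>w\<close>, at most \<open>d\<close>, and a return to a known vertex is
  forced and costs 1.\<close>

lemma sum_fresh_wt_le:
  fixes d :: nat
  assumes w: "\<And>x y. 0 \<le> w x y" "\<And>y. y < n \<Longrightarrow> (\<Sum>x<n. w x y) \<le> real d"
    and v: "v \<noteq> []"
  shows "(\<Sum>u\<in>sim_class n v. fresh_wt w u) \<le> real n * real d ^ (card (set v) - 1)"
  using v
proof (induction v)
  case (Cons y v)
  show ?case
  proof (cases "v = []")
    case True
    have "sim_class n [] = {[]}" by (auto simp: sim_class_def sim_def)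
    with True show ?thesis by (subst sum_sim_class_Cons) simp
  next
    case False
    have IH: "(\<Sum>u\<in>sim_class n v. fresh_wt w u) \<le> real n * real d ^ (card (set v) - 1)"
      using Cons.IH False by auto
    have cv: "card (set v) \<ge> 1" using False by (simp add: Suc_le_eq card_gt_0_iff)
    let ?S = "\<lambda>u. {x. x < n \<and> (\<forall>i<length u. x = u ! i \<longleftrightarrow> y = v ! i)}"
    have "(\<Sum>x\<in>?S u. fresh_wt w (x # u)) \<le> (if y \<in> set v then 1 else real d) * fresh_wt w u"
      if u: "u \<in> sim_class n v" for u
    proof -
      have uv: "sim u v" "set u \<subseteq> {..<n}" using u by (auto simp: sim_class_def)
      with False obtain a zs where az: "u = a # zs" by (cases u) (auto simp: sim_def)
      have l: "length u = length v" using uv by (simp add: sim_def)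
      have nn: "0 \<le> fresh_wt w u" by (rule fresh_wt_nonneg) (rule w(1))
      show ?thesis
      proof (cases "y \<in> set v")
        case True
        then obtain i where i: "i < length v" "y = v ! i" by (auto simp: in_set_conv_nth)
        have sub: "?S u \<subseteq> {u ! i}" using i l by auto
        have "(\<Sum>x\<in>?S u. fresh_wt w (x # u)) = (\<Sum>x\<in>?S u. fresh_wt w u)"
        proof (rule sum.cong[OF refl])
          fix x assume "x \<in> ?S u"
          then have "x = u ! i" using sub by auto
          then have "x \<in> set u" using i l by simp
          then show "fresh_wt w (x # u) = fresh_wt w u" by (simp add: az)
        qed
        also have "\<dots> \<le> (\<Sum>x\<in>{u ! i}. fresh_wt w u)"
          by (rule sum_mono2) (use sub nn in auto)
        finally show ?thesis using True by simp
      next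
        case False
        have "(\<Sum>x\<in>?S u. fresh_wt w (x # u)) = (\<Sum>x\<in>?S u. w x a * fresh_wt w u)"
        proof (rule sum.cong[OF refl])
          fix x assume "x \<in> ?S u"
          then have "x \<notin> set u" using False l by (auto simp: in_set_conv_nth)
          then show "fresh_wt w (x # u) = w x a * fresh_wt w u" by (simp add: az)
        qed
        also have "\<dots> \<le> (\<Sum>x<n. w x a * fresh_wt w u)"
          by (rule sum_mono2) (use nn w(1) in auto)
        also have "\<dots> = (\<Sum>x<n. w x a) * fresh_wt w u" by (simp add: sum_distrib_right)
        also have "\<dots> \<le> real d * fresh_wt w u"
          using uv(2) az by (intro mult_right_mono w(2) nn) auto
        finally show ?thesis using False by simp
      qed
    qed
    then have "(\<Sum>u\<in>sim_class n (y # v). fresh_wt w u)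
       \<le> (\<Sum>u\<in>sim_class n v. (if y \<in> set v then 1 else real d) * fresh_wt w u)"
      unfolding sum_sim_class_Cons by (rule sum_mono)
    also have "\<dots> = (if y \<in> set v then 1 else real d) * (\<Sum>u\<in>sim_class n v. fresh_wt w u)"
      by (simp add: sum_distrib_left)
    also have "\<dots> \<le> (if y \<in> set v then 1 else real d) * (real n * real d ^ (card (set v) - 1))"
      by (intro mult_left_mono IH) auto
    also have "\<dots> = real n * real d ^ (card (set (y # v)) - 1)"
      using cv by (cases "card (set v)") (auto simp: card_insert_if insert_absorb)
    finally show ?thesis .
  qed
qed simp

text \<open>The mirror image of the preceding bound, now from below. When the last new vertex is
  chosen, \<open>card (set v) - 1\<close> labels are taken, so the hypothesis still leaves
  \<open>d\<close> of the \<open>r\<close>.\<close>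

lemma card_sim_class_ge:
  assumes "v \<noteq> []" "d + card (set v) \<le> Suc r"
  shows "real r * real d ^ (card (set v) - 1) \<le> real (card (sim_class r v))"
  using assms
proof (induction v)
  case (Cons y v)
  show ?case
  proof (cases "v = []")
    case True
    have "sim_class r [] = {[]}" by (auto simp: sim_class_def sim_def)
    with True have "real (card (sim_class r (y # v))) = real r"
      using sum_sim_class_Cons[of "\<lambda>_. 1" r y v] by simp
    with True show ?thesis by simp
  next
    case False
    have IH: "real r * real d ^ (card (set v) - 1) \<le> real (card (sim_class r v))"
    proof (rule Cons.IH[OF False])
      have "card (set v) \<le> card (set (y # v))" by (intro card_mono) auto
      with Cons.prems(2) show "d + card (set v) \<le> Suc r" by linarith
    qed
    have cv: "card (set v) \<ge> 1" using False by (simp add: Suc_le_eq card_gt_0_iff)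
    let ?S = "\<lambda>u. {x. x < r \<and> (\<forall>i<length u. x = u ! i \<longleftrightarrow> y = v ! i)}"
    have "(if y \<in> set v then 1 else real d) \<le> (\<Sum>x\<in>?S u. 1)"
      if u: "u \<in> sim_class r v" for u
    proof -
      have uv: "sim u v" "set u \<subseteq> {..<r}" using u by (auto simp: sim_class_def)
      have l: "length u = length v" using uv by (simp add: sim_def)
      show ?thesis
      proof (cases "y \<in> set v")
        case True
        then obtain i where i: "i < length v" "y = v ! i" by (auto simp: in_set_conv_nth)
        have "u ! i < r" using subsetD[OF uv(2) nth_mem[of i u]] i(1) l by simp
        moreover have "u ! i = u ! j \<longleftrightarrow> y = v ! j" if "j < length u" for j
          unfolding i(2) using uv(1) i(1) l that by (auto simp: sim_def)
        ultimately have "u ! i \<in> ?S u" by (intro CollectI conjI allI impI)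
        then have "{u ! i} \<subseteq> ?S u" by (rule insert_subsetI) (rule empty_subsetI)
        then have "card {u ! i} \<le> card (?S u)" by (rule card_mono[rotated]) simp
        then have "1 \<le> real (card (?S u))" by simp
        then show ?thesis using True by (simp only: if_True real_of_card)
      next
        case False
        have "card ({..<r} - set u) \<le> card (?S u)"
        proof (rule card_mono)
          show "{..<r} - set u \<subseteq> ?S u"
          proof
            fix x assume x: "x \<in> {..<r} - set u"
            have "x \<noteq> u ! i \<and> y \<noteq> v ! i" if "i < length u" for i
              using x False l that by auto
            with x show "x \<in> ?S u" by simp
          qed
        qed auto
        moreover have "card ({..<r} - set u) = r - card (set v)"
          using uv(2) by (subst card_Diff_subset) (auto simp: sim_card[OF uv(1)])
        moreover have "d + card (set v) \<le> r"
          using Cons.prems False by simp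
        ultimately have "real d \<le> real (card (?S u))" by linarith
        then show ?thesis using False by (simp only: if_False real_of_card)
      qed
    qed
    then have "(\<Sum>u\<in>sim_class r v. if y \<in> set v then 1 else real d) \<le> (\<Sum>u\<in>sim_class r (y # v). 1)"
      unfolding sum_sim_class_Cons by (rule sum_mono)
    then have "(if y \<in> set v then 1 else real d) * real (card (sim_class r v)) \<le> real (card (sim_class r (y # v)))"
      by (simp add: mult.commute split: if_splits)
    moreover have "(if y \<in> set v then 1 else real d) * (real r * real d ^ (card (set v) - 1))
        \<le> (if y \<in> set v then 1 else real d) * real (card (sim_class r v))"
      by (intro mult_left_mono IH) auto
    moreover have "(if y \<in> set v then 1 else real d) * (real r * real d ^ (card (set v) - 1))
        = real r * real d ^ (card (set (y # v)) - 1)"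
      using cv by (cases "card (set v)") (auto simp: card_insert_if insert_absorb)
    ultimately show ?thesis by linarith
  qed
qed simp

lemma card_set_le_edges: "u \<noteq> [] \<Longrightarrow> card (set u) \<le> Suc (card (set (edges u)))"
proof (induction u rule: edges.induct)
  case (1 x y zs)
  show ?case
  proof (cases "x \<in> set (y # zs)")
    case True
    then have "card (set (x # y # zs)) = card (set (y # zs))" by (simp add: insert_absorb)
    also have "\<dots> \<le> Suc (card (set (edges (y # zs))))" using 1 by simp
    also have "\<dots> \<le> Suc (card (set (edges (x # y # zs))))" by (simp add: card_insert_le)
    finally show ?thesis .
  next
    case False
    have "ed x y \<notin> set (edges (y # zs))"
    proof
      assume "ed x y \<in> set (edges (y # zs))"
      from edges_subset[OF this] False show False
        by (auto simp: ed_def min_def max_def split: if_splits)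
    qed
    then show ?thesis using 1 False by simp
  qed
qed auto

text \<open>Discovery edges are pairwise distinct, and every other edge has weight at most 1 and may
  be dropped.\<close>

lemma prod_edges_le_fresh_wt:
  assumes w: "\<And>x y. 0 \<le> w x y" "\<And>x y. w x y \<le> 1" "\<And>x y. w x y = w y x"
  shows "(\<Prod>e\<in>set (edges u). w (fst e) (snd e)) \<le> fresh_wt w u"
proof (induction u rule: edges.induct)
  case (1 x y zs)
  have we: "w (fst (ed x y)) (snd (ed x y)) = w x y"
    using w(3) by (auto simp: ed_def min_def max_def)
  have nn: "0 \<le> (\<Prod>e\<in>set (edges (y # zs)). w (fst e) (snd e))" by (intro prod_nonneg) (simp add: w)
  show ?case
  proof (cases "x \<in> set (y # zs)")
    case True
    have "(\<Prod>e\<in>set (edges (x # y # zs)). w (fst e) (snd e)) \<le> (\<Prod>e\<in>set (edges (y # zs)). w (fst e) (snd e))"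
      using nn w(1,2) by (auto simp: prod.insert_if we intro: mult_left_le_one_le)
    with 1 True show ?thesis by auto
  next
    case False
    have "ed x y \<notin> set (edges (y # zs))"
    proof
      assume "ed x y \<in> set (edges (y # zs))"
      from edges_subset[OF this] False show False
        by (auto simp: ed_def min_def max_def split: if_splits)
    qed
    then show ?thesis using 1 False w(1) by (auto simp: we intro: mult_left_mono)
  qed
qed auto

text \<open>In 2 p steps with each edge used at least twice there are at most p distinct edges.
  Hence \<open>d + p \<le> r\<close> leaves enough room for relabelling on \<open>r\<close>
  vertices.\<close>

lemma good_card_le:
  assumes "good u" "length u = Suc (2 * p)"
  shows "card (set u) \<le> Suc p"
proof -
  have "2 * card (set (edges u)) = (\<Sum>e\<in>set (edges u). 2)" by simp
  also have "\<dots> \<le> (\<Sum>e\<in>set (edges u). count_list (edges u) e)"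
    using assms(1) by (intro sum_mono) (auto simp: good_def)
  also have "\<dots> = 2 * p" using assms(2) by (simp add: sum_count_set length_edges)
  finally show ?thesis using card_set_le_edges[of u] assms(2) by (cases u) auto
qed

text \<open>Double counting of the pairs of good closed walks \<open>u\<close> on \<open>n\<close> and \<open>v\<close> on \<open>r\<close> vertices that
  have the same shape.\<close>
lemma good_walks_comparison:
  fixes d p r n :: nat
  assumes w: "\<And>x y. 0 \<le> w x y" "\<And>y. y < n \<Longrightarrow> (\<Sum>x<n. w x y) \<le> real d"
    and d: "0 < d" "d + p \<le> r"
  shows "real r * (\<Sum>u\<in>good_closed n (2 * p). fresh_wt w u) \<le> real n * real (card (good_closed r (2 * p)))"
proof -
  let ?A = "good_closed n (2 * p)" and ?B = "good_closed r (2 * p)"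
  let ?m = "\<lambda>u. card (set u) - 1"
  \<comment> \<open>Each \<open>u\<close> hands the share
    \<open>fresh_wt w u / real d ^ ?m v\<close> to all its relabellings \<open>v\<close> on
    \<open>r\<close> vertices. There are at least \<open>real r * real d ^ ?m u\<close> of them,
    while each \<open>v\<close> receives at most \<open>n\<close> in total.\<close>
  have "real r * fresh_wt w u \<le> (\<Sum>v\<in>{v \<in> ?B. sim v u}. fresh_wt w u / real d ^ ?m v)"
    if u: "u \<in> ?A" for u
  proof -
    have un: "u \<noteq> []" "length u = Suc (2 * p)" "good u"
      using u by (auto simp: good_closed_def walks_def)
    have "d + card (set u) \<le> Suc r" using good_card_le[OF un(3,2)] d by simp
    from card_sim_class_ge[OF un(1) this]
    have "real r \<le> real (card (sim_class r u)) / real d ^ ?m u" using d by (simp add: field_simps)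
    from mult_right_mono[OF this fresh_wt_nonneg[of w u, OF w(1)]]
    have "real r * fresh_wt w u \<le> (\<Sum>v\<in>sim_class r u. fresh_wt w u / real d ^ ?m u)"
      by (simp add: field_simps)
    also have "\<dots> = (\<Sum>v\<in>sim_class r u. fresh_wt w u / real d ^ ?m v)"
      by (intro sum.cong) (auto simp: sim_class_def sim_card)
    finally show ?thesis using good_closed_sim[OF u, of r] by simp
  qed
  then have "real r * (\<Sum>u\<in>?A. fresh_wt w u) \<le> (\<Sum>u\<in>?A. \<Sum>v\<in>{v \<in> ?B. sim v u}. fresh_wt w u / real d ^ ?m v)"
    unfolding sum_distrib_left by (rule sum_mono)
  also have "\<dots> = (\<Sum>v\<in>?B. \<Sum>u\<in>{u \<in> ?A. sim v u}. fresh_wt w u / real d ^ ?m v)"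
    by (rule sum.swap_restrict) (rule finite_good_closed)+
  also have "\<dots> \<le> (\<Sum>v\<in>?B. real n)"
  proof (rule sum_mono)
    fix v assume v: "v \<in> ?B"
    then have "v \<noteq> []" by (auto simp: good_closed_def walks_def)
    from sum_fresh_wt_le[OF w this]
    have "(\<Sum>u\<in>sim_class n v. fresh_wt w u) / real d ^ ?m v \<le> real n"
      using d by (simp add: field_simps)
    moreover have "{u \<in> ?A. sim v u} = sim_class n v"
      using good_closed_sim[OF v, of n] sim_commute by auto
    ultimately show "(\<Sum>u\<in>{u \<in> ?A. sim v u}. fresh_wt w u / real d ^ ?m v) \<le> real n"
      by (simp add: sum_divide_distrib)
  qed
  finally show ?thesis by (simp add: mult.commute)
qed

section \<open>Moments of random symmetric matrices\<close>

definition sym_mat :: "(nat \<times> nat \<Rightarrow> bool \<Rightarrow> real) \<Rightarrow> (nat \<times> nat \<Rightarrow> bool) \<Rightarrow> nat \<Rightarrow> nat \<Rightarrow> real" where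
  "sym_mat f \<omega> i j = (if i = j then 0 else f (ed i j) (\<omega> (ed i j)))"

definition walk_trace :: "nat \<Rightarrow> (nat \<Rightarrow> nat \<Rightarrow> real) \<Rightarrow> nat \<Rightarrow> real" where
  "walk_trace n X L = (\<Sum>u\<in>{u \<in> walks n L. hd u = last u}. wt X u)"

lemma sym_mat_symmetric: "sym_mat f \<omega> i j = sym_mat f \<omega> j i"
  by (simp add: sym_mat_def ed_def min.commute max.commute)

lemma finite_upper_pairs [simp]: "finite (upper_pairs n)"
  by (rule finite_subset[of _ "{..<n} \<times> {..<n}"]) (auto simp: upper_pairs_def)

lemma ed_in_upper_pairs: "i < n \<Longrightarrow> j < n \<Longrightarrow> i \<noteq> j \<Longrightarrow> ed i j \<in> upper_pairs n"
  by (auto simp: ed_def upper_pairs_def min_def max_def)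

lemma finite_set_Pi_pmf_bool:
  fixes D :: "'a \<Rightarrow> bool pmf"
  shows "finite A \<Longrightarrow> finite (set_pmf (Pi_pmf A d D))"
  by (simp add: set_Pi_pmf finite_PiE_dflt)

lemma integrable_Pi_pmf_bool:
  fixes D :: "'a \<Rightarrow> bool pmf" and F :: "('a \<Rightarrow> bool) \<Rightarrow> real"
  shows "finite A \<Longrightarrow> integrable (measure_pmf (Pi_pmf A d D)) F"
  by (intro integrable_measure_pmf_finite finite_set_Pi_pmf_bool)

text \<open>The library version requires nonnegative factors.\<close>
lemma expectation_prod_Pi_pmf_bool:
  fixes D :: "'a \<Rightarrow> bool pmf" and g :: "'a \<Rightarrow> bool \<Rightarrow> real"
  assumes A: "finite A"
  shows "measure_pmf.expectation (Pi_pmf A d D) (\<lambda>\<omega>. \<Prod>e\<in>A. g e (\<omega> e))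
    = (\<Prod>e\<in>A. measure_pmf.expectation (D e) (g e))"
proof -
  let ?S = "PiE_dflt A d (\<lambda>_. UNIV :: bool set)"
  have fin: "finite ?S" using A by (intro finite_PiE_dflt) auto
  have "measure_pmf.expectation (Pi_pmf A d D) (\<lambda>\<omega>. \<Prod>e\<in>A. g e (\<omega> e))
    = (\<Sum>\<omega>\<in>?S. (\<Prod>e\<in>A. g e (\<omega> e)) * pmf (Pi_pmf A d D) \<omega>)"
    by (rule integral_measure_pmf_real[OF fin]) (use A in \<open>auto simp: set_Pi_pmf PiE_dflt_def\<close>)
  also have "\<dots> = (\<Sum>\<omega>\<in>?S. \<Prod>e\<in>A. g e (\<omega> e) * pmf (D e) (\<omega> e))"
    using A by (intro sum.cong) (auto simp: pmf_Pi PiE_dflt_def prod.distrib)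
  also have "\<dots> = (\<Sum>\<omega>\<in>PiE A (\<lambda>_. UNIV). \<Prod>e\<in>A. g e (\<omega> e) * pmf (D e) (\<omega> e))"
    by (rule sum.reindex_bij_witness[where j = "\<lambda>h. restrict h A" and i = "\<lambda>h x. if x \<in> A then h x else d"])
       (auto simp: PiE_dflt_def PiE_def extensional_def fun_eq_iff)
  also have "\<dots> = (\<Prod>e\<in>A. \<Sum>b\<in>UNIV. g e b * pmf (D e) b)"
    using A by (intro prod_sum_PiE[symmetric]) auto
  also have "\<dots> = (\<Prod>e\<in>A. measure_pmf.expectation (D e) (g e))"
    by (intro prod.cong refl integral_measure_pmf_real[symmetric]) auto
  finally show ?thesis .
qed

lemma wt_loop: "e \<in> set (edges u) \<Longrightarrow> fst e = snd e \<Longrightarrow> wt (sym_mat f \<omega>) u = 0"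
  by (induction u rule: edges.induct) (auto simp: ed_def sym_mat_def min_def max_def split: if_splits)

lemma wt_eq_prod:
  assumes "set u \<subseteq> {..<n}" "\<forall>e\<in>set (edges u). fst e \<noteq> snd e"
  shows "wt (sym_mat f \<omega>) u = (\<Prod>e\<in>upper_pairs n. f e (\<omega> e) ^ count_list (edges u) e)"
  using assms
proof (induction u rule: edges.induct)
  case (1 x y zs)
  have ne: "x \<noteq> y" using 1(3) by (auto simp: ed_def)
  then have m: "ed x y \<in> upper_pairs n" using 1(2) by (intro ed_in_upper_pairs) auto
  have "(\<Prod>e\<in>upper_pairs n. f e (\<omega> e) ^ count_list (edges (x # y # zs)) e)
    = (\<Prod>e\<in>upper_pairs n. (if e = ed x y then f e (\<omega> e) else 1) * f e (\<omega> e) ^ count_list (edges (y # zs)) e)"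
    by (intro prod.cong) auto
  also have "\<dots> = f (ed x y) (\<omega> (ed x y)) * (\<Prod>e\<in>upper_pairs n. f e (\<omega> e) ^ count_list (edges (y # zs)) e)"
    using m by (simp add: prod.distrib)
  finally show ?case using 1 ne by (simp add: sym_mat_def)
qed auto

lemma expectation_wt:
  assumes "set u \<subseteq> {..<n}" "\<forall>e\<in>set (edges u). fst e \<noteq> snd e"
  shows "measure_pmf.expectation (Pi_pmf (upper_pairs n) d D) (\<lambda>\<omega>. wt (sym_mat f \<omega>) u)
    = (\<Prod>e\<in>upper_pairs n. measure_pmf.expectation (D e) (\<lambda>b. f e b ^ count_list (edges u) e))"
  unfolding wt_eq_prod[OF assms] by (rule expectation_prod_Pi_pmf_bool) simp

lemma edges_in_upper_pairs:
  assumes "set u \<subseteq> {..<n}" "\<forall>e\<in>set (edges u). fst e \<noteq> snd e"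
  shows "set (edges u) \<subseteq> upper_pairs n"
  using assms
proof (induction u rule: edges.induct)
  case (1 x y zs)
  then show ?case using ed_in_upper_pairs[of x n y] by (auto simp: ed_def)
qed auto

definition cbern :: "(nat \<times> nat \<Rightarrow> real) \<Rightarrow> nat \<times> nat \<Rightarrow> bool \<Rightarrow> real" where
  "cbern q e b = (if b then 1 else 0) - q e"

text \<open>For order at least 2, the factor q (1 - q) splits off both terms and leaves an average
  of powers of numbers at most 1.\<close>

lemma centered_bernoulli_moment:
  fixes q :: real
  assumes q: "0 \<le> q" "q \<le> 1"
  defines "M \<equiv> \<lambda>c. measure_pmf.expectation (bernoulli_pmf q) (\<lambda>b. ((if b then 1 else 0) - q) ^ c)"
  shows "M 0 = 1" "M 1 = 0" "2 \<le> c \<Longrightarrow> \<bar>M c\<bar> \<le> q"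
proof -
  have M: "M c = (1 - q) ^ c * q + (- q) ^ c * (1 - q)" for c
    using q by (simp add: M_def)
  show "M 0 = 1" "M 1 = 0" by (simp_all add: M algebra_simps)
  assume "2 \<le> c"
  then obtain c' where c: "c = Suc (Suc c')" by (metis Suc_le_D numeral_2_eq_2 Suc_le_mono)
  have "\<bar>M c\<bar> \<le> \<bar>(1 - q) ^ c * q\<bar> + \<bar>(- q) ^ c * (1 - q)\<bar>" unfolding M by (rule abs_triangle_ineq)
  also have "\<dots> = (1 - q) ^ c * q + q ^ c * (1 - q)"
    using q by (simp add: abs_mult power_abs)
  also have "\<dots> = q * (1 - q) * ((1 - q) * (1 - q) ^ c' + q * q ^ c')"
    by (simp add: c algebra_simps)
  also have "\<dots> \<le> q * (1 - q) * ((1 - q) * 1 + q * 1)"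
    using q by (intro mult_left_mono add_mono power_le_one) auto
  also have "\<dots> \<le> q" using q by (simp add: algebra_simps)
  finally show "\<bar>M c\<bar> \<le> q" .
qed

text \<open>A simple edge kills the expectation. In a good walk each distinct edge gives at most one
  factor \<open>q\<close>, however often it is used, and these factors are then bounded by the
  discovery tree.\<close>

lemma expectation_wt_centered:
  assumes u: "set u \<subseteq> {..<n}"
    and q: "\<And>e. e \<in> upper_pairs n \<Longrightarrow> 0 \<le> q e \<and> q e \<le> 1"
    and w: "\<And>x y. w x y = (if x < n \<and> y < n \<and> x \<noteq> y then q (ed x y) else 0)"
  shows "measure_pmf.expectation (Pi_pmf (upper_pairs n) d (\<lambda>e. bernoulli_pmf (q e)))
      (\<lambda>\<omega>. wt (sym_mat (cbern q) \<omega>) u) \<le> (if good u then fresh_wt w u else 0)"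
    (is "?E \<le> _")
proof (cases "\<forall>e\<in>set (edges u). fst e \<noteq> snd e")
  case False
  then show ?thesis using wt_loop by (auto simp: good_def)
next
  case True
  let ?M = "\<lambda>e. measure_pmf.expectation (bernoulli_pmf (q e)) (\<lambda>b. cbern q e b ^ count_list (edges u) e)"
  have E: "?E = (\<Prod>e\<in>upper_pairs n. ?M e)" by (rule expectation_wt[OF u True])
  have sub: "set (edges u) \<subseteq> upper_pairs n" by (rule edges_in_upper_pairs[OF u True])
  note M = centered_bernoulli_moment[of "q e" for e, folded cbern_def]
  show ?thesis
  proof (cases "good u")
    case False
    then obtain e where e: "e \<in> set (edges u)" "count_list (edges u) e < 2"
      using True by (auto simp: good_def not_le)
    then have "count_list (edges u) e = 1" using count_list_0_iff[of "edges u" e] by linarith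
    moreover have "e \<in> upper_pairs n" using e sub by auto
    ultimately have "?M e = 0" using M(2)[of e] q[of e] by simp
    then have "?E = 0" unfolding E using e sub by (intro prod_zero) auto
    with False show ?thesis by simp
  next
    case True
    have "?E \<le> \<bar>\<Prod>e\<in>upper_pairs n. ?M e\<bar>" unfolding E by simp
    also have "\<dots> = (\<Prod>e\<in>upper_pairs n. \<bar>?M e\<bar>)" by (rule abs_prod)
    also have "\<dots> = (\<Prod>e\<in>set (edges u). \<bar>?M e\<bar>)"
      using sub q M(1) by (intro prod.mono_neutral_right) (auto simp: count_list_0_iff)
    also have "\<dots> \<le> (\<Prod>e\<in>set (edges u). w (fst e) (snd e))"
    proof (rule prod_mono)
      fix e assume e: "e \<in> set (edges u)"
      then have eu: "e \<in> upper_pairs n" using sub by auto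
      then have "w (fst e) (snd e) = q e"
        by (auto simp: w upper_pairs_def ed_def min_def max_def)
      moreover have "\<bar>?M e\<bar> \<le> q e" using M(3) q[OF eu] True e by (auto simp: good_def)
      ultimately show "0 \<le> \<bar>?M e\<bar> \<and> \<bar>?M e\<bar> \<le> w (fst e) (snd e)" by simp
    qed
    also have "\<dots> \<le> fresh_wt w u"
    proof (rule prod_edges_le_fresh_wt)
      show "0 \<le> w x y" "w x y \<le> 1" for x y
        using q[OF ed_in_upper_pairs[of x n y]] by (auto simp: w)
      show "w x y = w y x" for x y by (auto simp: w ed_def min_def max_def)
    qed
    finally show ?thesis using True by simp
  qed
qed

text \<open>Evaluated at a coin that is true with probability \<open>1/3\<close>, this variable is centered and all
  its moments of order at least \<open>2\<close> are at least \<open>1\<close>. Unlike a Rademacher variable it dominates odd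
  moments too, so the adjacency matrix need not be symmetrized.\<close>
definition cmpv :: "nat \<times> nat \<Rightarrow> bool \<Rightarrow> real" where
  "cmpv e b = (if b then 2 else - 1)"

abbreviation cmp_pmf :: "nat \<Rightarrow> (nat \<times> nat \<Rightarrow> bool) pmf" where
  "cmp_pmf r \<equiv> Pi_pmf (upper_pairs r) False (\<lambda>_. bernoulli_pmf (1 / 3))"

lemma cmpv_moment:
  fixes e :: "nat \<times> nat"
  defines "M \<equiv> \<lambda>c. measure_pmf.expectation (bernoulli_pmf (1 / 3)) (\<lambda>b. cmpv e b ^ c)"
  shows "M 0 = 1" "0 \<le> M c" "2 \<le> c \<Longrightarrow> 1 \<le> M c"
proof -
  have M: "M c = (2 ^ c + 2 * (- 1) ^ c) / 3" for c
    by (simp add: M_def cmpv_def)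
  have sgn: "(- 1 :: real) ^ c \<ge> - 1" for c by (cases "even c") auto
  show "M 0 = 1" by (simp add: M)
  have ge: "1 \<le> M c" if "2 \<le> c" for c
  proof (cases "c = 2")
    case True
    then show ?thesis by (simp add: M)
  next
    case False
    with that have "(2::real) ^ 3 \<le> 2 ^ c" by (intro power_increasing) auto
    with sgn[of c] show ?thesis unfolding M by simp
  qed
  then show "2 \<le> c \<Longrightarrow> 1 \<le> M c" .
  have "c = 0 \<or> c = 1 \<or> 2 \<le> c" by linarith
  then show "0 \<le> M c" using ge[of c] by (auto simp: M)
qed

text \<open>Summed over closed walks, this bounds the number of good ones by the expected trace of
  the comparison matrix; nonnegative moments allow the walks that are not good to be added.\<close>

lemma expectation_wt_cmp:
  assumes u: "set u \<subseteq> {..<r}"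
  shows "(if good u then 1 else 0) \<le> measure_pmf.expectation (cmp_pmf r) (\<lambda>\<omega>. wt (sym_mat cmpv \<omega>) u)"
proof (cases "\<forall>e\<in>set (edges u). fst e \<noteq> snd e")
  case False
  then show ?thesis using wt_loop by (auto simp: good_def)
next
  case True
  let ?M = "\<lambda>e. measure_pmf.expectation (bernoulli_pmf (1 / 3)) (\<lambda>b. cmpv e b ^ count_list (edges u) e)"
  have "(if good u then 1 else 0) \<le> (\<Prod>e\<in>upper_pairs r. ?M e)"
  proof (cases "good u")
    case g: True
    have "1 \<le> ?M e" for e
      using cmpv_moment(1)[of e] cmpv_moment(3)[of "count_list (edges u) e" e] g
      by (cases "e \<in> set (edges u)") (auto simp: good_def)
    then show ?thesis by (simp add: g prod_ge_1)
  next
    case False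
    then show ?thesis using cmpv_moment(2) by (simp add: prod_nonneg)
  qed
  then show ?thesis unfolding expectation_wt[OF u True] .
qed

lemma expectation_walk_trace:
  fixes D :: "nat \<times> nat \<Rightarrow> bool pmf"
  shows "measure_pmf.expectation (Pi_pmf (upper_pairs n) d D) (\<lambda>\<omega>. walk_trace n (sym_mat f \<omega>) L)
    = (\<Sum>u\<in>{u \<in> walks n L. hd u = last u}.
        measure_pmf.expectation (Pi_pmf (upper_pairs n) d D) (\<lambda>\<omega>. wt (sym_mat f \<omega>) u))"
  unfolding walk_trace_def by (intro Bochner_Integration.integral_sum integrable_Pi_pmf_bool) simp

lemma trace_comparison:
  fixes q :: "nat \<times> nat \<Rightarrow> real" and d p r n :: nat
  assumes q: "\<And>e. e \<in> upper_pairs n \<Longrightarrow> 0 \<le> q e \<and> q e \<le> Q" and Q: "Q \<le> 1" "0 \<le> Q" "real n * Q \<le> real d"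
    and d: "0 < d" "d + p \<le> r"
  shows "real r * measure_pmf.expectation (Pi_pmf (upper_pairs n) False (\<lambda>e. bernoulli_pmf (q e)))
        (\<lambda>\<omega>. walk_trace n (sym_mat (cbern q) \<omega>) (2 * p))
    \<le> real n * measure_pmf.expectation (cmp_pmf r) (\<lambda>\<omega>. walk_trace r (sym_mat cmpv \<omega>) (2 * p))"
proof -
  define w where "w = (\<lambda>x y. if x < n \<and> y < n \<and> x \<noteq> y then q (ed x y) else 0)"
  have q1: "0 \<le> q e \<and> q e \<le> 1" if "e \<in> upper_pairs n" for e using q[OF that] Q by auto
  have wb: "0 \<le> w x y" "w x y \<le> Q" for x y
    using q[OF ed_in_upper_pairs[of x n y]] Q by (auto simp: w_def)
  have ws: "(\<Sum>x<n. w x y) \<le> real d" for y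
  proof -
    have "(\<Sum>x<n. w x y) \<le> (\<Sum>x<n. Q)" by (intro sum_mono wb)
    with Q show ?thesis by simp
  qed
  have split: "(\<Sum>u\<in>{u \<in> walks m (2 * p). hd u = last u}. if good u then F u else 0) = sum F (good_closed m (2 * p))"
    for F :: "nat list \<Rightarrow> real" and m
    by (subst sum.inter_filter[symmetric])
       (auto simp: finite_walks good_closed_def intro!: arg_cong2[where f = sum])
  have "measure_pmf.expectation (Pi_pmf (upper_pairs n) False (\<lambda>e. bernoulli_pmf (q e)))
        (\<lambda>\<omega>. walk_trace n (sym_mat (cbern q) \<omega>) (2 * p)) \<le>
      (\<Sum>u\<in>{u \<in> walks n (2 * p). hd u = last u}. if good u then fresh_wt w u else 0)"
    unfolding expectation_walk_trace
  proof (intro sum_mono expectation_wt_centered)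
    fix u assume "u \<in> {u \<in> walks n (2 * p). hd u = last u}"
    then show "set u \<subseteq> {..<n}" by (simp add: walks_def)
  qed (use q1 in \<open>auto simp: w_def\<close>)
  also have "\<dots> = (\<Sum>u\<in>good_closed n (2 * p). fresh_wt w u)" by (rule split)
  finally have "real r * measure_pmf.expectation (Pi_pmf (upper_pairs n) False (\<lambda>e. bernoulli_pmf (q e)))
        (\<lambda>\<omega>. walk_trace n (sym_mat (cbern q) \<omega>) (2 * p)) \<le> real r * (\<Sum>u\<in>good_closed n (2 * p). fresh_wt w u)"
    by (intro mult_left_mono) auto
  also have "\<dots> \<le> real n * real (card (good_closed r (2 * p)))"
    by (rule good_walks_comparison[OF wb(1) ws d])
  also have "real (card (good_closed r (2 * p))) = (\<Sum>u\<in>{u \<in> walks r (2 * p). hd u = last u}. if good u then 1 else 0)"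
    by (subst split) simp
  also have "\<dots> \<le> measure_pmf.expectation (cmp_pmf r) (\<lambda>\<omega>. walk_trace r (sym_mat cmpv \<omega>) (2 * p))"
    unfolding expectation_walk_trace
    by (intro sum_mono expectation_wt_cmp) (auto simp: walks_def)
  finally show ?thesis by (simp add: mult_left_mono)
qed

section \<open>Traces, operator norms and nets\<close>

fun mp :: "nat \<Rightarrow> (nat \<Rightarrow> nat \<Rightarrow> real) \<Rightarrow> nat \<Rightarrow> nat \<Rightarrow> nat \<Rightarrow> real" where
  "mp n M 0 i j = (if i = j then 1 else 0)"
| "mp n M (Suc L) i j = (\<Sum>l<n. M i l * mp n M L l j)"

lemma mp_eq_walks:
  assumes "i < n" "j < n"
  shows "mp n X L i j = (\<Sum>u\<in>{u \<in> walks n L. hd u = i \<and> last u = j}. wt X u)"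
  using assms(1)
proof (induction L arbitrary: i)
  case 0
  have "{u \<in> walks n 0. hd u = i \<and> last u = j} = (if i = j then {[i]} else {})"
    using 0 by (auto simp: walks_def length_Suc_conv)
  then show ?case by simp
next
  case (Suc L)
  have "(\<Sum>u\<in>{u \<in> walks n (Suc L). hd u = i \<and> last u = j}. wt X u)
    = (\<Sum>(l, u)\<in>(SIGMA l:{..<n}. {u \<in> walks n L. hd u = l \<and> last u = j}). X i l * wt X u)"
  proof (rule sum.reindex_bij_witness[where j = "\<lambda>u. (hd (tl u), tl u)" and i = "\<lambda>(l, u). i # u"])
    fix a assume "a \<in> {u \<in> walks n (Suc L). hd u = i \<and> last u = j}"
    then obtain l zs where "a = i # l # zs" "set (l # zs) \<subseteq> {..<n}" "length zs = L" "last (l # zs) = j"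
      by (auto simp: walks_def length_Suc_conv)
    then show "(case (hd (tl a), tl a) of (l, u) \<Rightarrow> i # u) = a"
      "(hd (tl a), tl a) \<in> (SIGMA l:{..<n}. {u \<in> walks n L. hd u = l \<and> last u = j})"
      "(case (hd (tl a), tl a) of (l, u) \<Rightarrow> X i l * wt X u) = wt X a"
      by (auto simp: walks_def)
  qed (use Suc.prems in \<open>auto simp: walks_def\<close>)
  also have "\<dots> = (\<Sum>l<n. X i l * mp n X L l j)"
    by (subst sum.Sigma[symmetric]) (auto simp: finite_walks Suc.IH sum_distrib_left)
  finally show ?case by simp
qed

lemma walk_trace_eq: "walk_trace n X L = (\<Sum>i<n. mp n X L i i)"
proof -
  have "(\<Sum>i<n. mp n X L i i) = (\<Sum>i<n. \<Sum>u\<in>{u \<in> {u \<in> walks n L. hd u = last u}. hd u = i}. wt X u)"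
    by (intro sum.cong refl) (auto simp: mp_eq_walks intro!: sum.cong)
  also have "\<dots> = walk_trace n X L"
    unfolding walk_trace_def
  proof (rule sum.group)
    show "hd ` {u \<in> walks n L. hd u = last u} \<subseteq> {..<n}"
    proof safe
      fix u assume "u \<in> walks n L"
      then have "u \<noteq> []" "set u \<subseteq> {..<n}" by (auto simp: walks_def)
      then show "hd u < n" using hd_in_set by blast
    qed
  qed (auto simp: finite_walks)
  finally show ?thesis by simp
qed

lemma mp_add: "i < n \<Longrightarrow> mp n M (a + b) i j = (\<Sum>l<n. mp n M a i l * mp n M b l j)"
proof (induction a arbitrary: i)
  case 0
  have "(\<Sum>l<n. mp n M 0 i l * mp n M b l j) = (\<Sum>l<n. if i = l then mp n M b l j else 0)"
    by (intro sum.cong) auto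
  with 0 show ?case by simp
next
  case (Suc a)
  have "mp n M (Suc a + b) i j = (\<Sum>m<n. \<Sum>l<n. M i m * mp n M a m l * mp n M b l j)"
    using Suc.IH by (simp add: sum_distrib_left mult.assoc)
  also have "\<dots> = (\<Sum>l<n. \<Sum>m<n. M i m * mp n M a m l * mp n M b l j)" by (rule sum.swap)
  finally show ?case by (simp add: sum_distrib_right)
qed

lemma mp_symm:
  assumes sym: "\<And>i j. M i j = M j i"
  shows "i < n \<Longrightarrow> j < n \<Longrightarrow> mp n M L i j = mp n M L j i"
proof (induction L arbitrary: i j)
  case (Suc L)
  have one: "mp n M (Suc 0) l i = M l i" if "l < n" for l
  proof -
    have "mp n M (Suc 0) l i = (\<Sum>m<n. if m = i then M l m else 0)"
      unfolding mp.simps by (intro sum.cong) auto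
    with Suc.prems show ?thesis by simp
  qed
  have "mp n M (L + Suc 0) j i = (\<Sum>l<n. mp n M L j l * mp n M (Suc 0) l i)"
    by (rule mp_add) fact
  also have "\<dots> = (\<Sum>l<n. M i l * mp n M L l j)"
    using Suc one sym by (intro sum.cong) (auto simp: mult.commute)
  finally show ?case by simp
qed auto

text \<open>The trace of the power 2 p is the squared Frobenius norm of the power p. It is therefore
  nonnegative, as Markov's inequality requires, and it dominates the squared norm of that
  power.\<close>

lemma walk_trace_double:
  assumes sym: "\<And>i j. M i j = M j i"
  shows "walk_trace n M (2 * p) = (\<Sum>i<n. \<Sum>j<n. (mp n M p i j)\<^sup>2)"
  unfolding walk_trace_eq mult_2
  by (intro sum.cong refl) (auto simp: mp_add power2_eq_square mp_symm[OF sym] intro!: sum.cong)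

lemma mv_mp: "i < n \<Longrightarrow> mv n (mp n M L) x i = (mv n M ^^ L) x i"
proof (induction L arbitrary: i)
  case 0
  have "mv n (mp n M 0) x i = (\<Sum>j<n. if j = i then x j else 0)"
    unfolding mv_def by (intro sum.cong) auto
  also have "\<dots> = x i" using 0 by simp
  finally show ?case by (simp only: funpow_0)
next
  case (Suc L)
  have "mv n (mp n M (Suc L)) x i = (\<Sum>l<n. M i l * mv n (mp n M L) x l)"
    unfolding mv_def by (simp add: sum_distrib_left sum_distrib_right mult.assoc) (rule sum.swap)
  also have "\<dots> = mv n M ((mv n M ^^ L) x) i"
    unfolding mv_def[of n M "(mv n M ^^ L) x"] using Suc.IH by (intro sum.cong) auto
  finally show ?case by (simp only: funpow.simps o_apply)
qed

text \<open>The sequence \<open>|M\<^sup>j x|\<^sup>2\<close> is log-convex, so \<open>|M x|\<^sup>2\<^sup>p \<le> |M\<^sup>p x|\<^sup>2 |x|\<^sup>2\<^sup>p\<^sup>-\<^sup>2\<close>; this replaces the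
  spectral theorem.\<close>
lemma op_bound_of_trace:
  assumes sym: "\<And>i j. M i j = M j i" and c: "0 \<le> c" and p: "0 < p"
    and tr: "walk_trace n M (2 * p) \<le> c ^ p"
  shows "op_bound n M c"
  unfolding op_bound_def
proof
  fix x
  define a where "a = (\<lambda>j. dot n ((mv n M ^^ j) x) ((mv n M ^^ j) x))"
  have a0: "0 \<le> a j" for j by (simp add: a_def dot_nonneg)
  \<comment> \<open>Symmetry moves one factor \<open>M\<close> to the other side of the inner
    product; Cauchy-Schwarz does the rest.\<close>
  have conv: "a (Suc j) * a (Suc j) \<le> a j * a (Suc (Suc j))" for j
  proof -
    have "a (Suc j) = dot n ((mv n M ^^ j) x) ((mv n M ^^ Suc (Suc j)) x)"
      by (simp add: a_def dot_mv_symm[of n M, OF sym])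
    then have "(a (Suc j))\<^sup>2 \<le> a j * a (Suc (Suc j))"
      unfolding a_def by (metis dot_Cauchy_Schwarz)
    then show ?thesis by (simp add: power2_eq_square)
  qed
  \<comment> \<open>Monotonicity of the ratios a (j + 1) / a j in product form, since terms may
    vanish.\<close>
  have step: "a 1 * a j \<le> a (Suc j) * a 0" for j
  proof (induction j)
    case (Suc j)
    show ?case
    proof (cases "a (Suc j) = 0")
      case True
      then show ?thesis by (simp add: a0)
    next
      case False
      then have pos: "a (Suc j) > 0" using a0[of "Suc j"] by simp
      have "a (Suc j) * (a 1 * a (Suc j)) = a 1 * (a (Suc j) * a (Suc j))" by simp
      also have "\<dots> \<le> a 1 * (a j * a (Suc (Suc j)))" by (intro mult_left_mono conv a0)
      also have "\<dots> = (a 1 * a j) * a (Suc (Suc j))" by simp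
      also have "\<dots> \<le> (a (Suc j) * a 0) * a (Suc (Suc j))" by (intro mult_right_mono Suc a0)
      also have "\<dots> = a (Suc j) * (a (Suc (Suc j)) * a 0)" by simp
      finally show ?thesis using pos by (simp only: mult_le_cancel_left_pos)
    qed
  qed simp
  have pw: "a 1 ^ Suc j \<le> a (Suc j) * a 0 ^ j" for j
  proof (induction j)
    case (Suc j)
    have "a 1 ^ Suc (Suc j) = a 1 * a 1 ^ Suc j" by simp
    also have "\<dots> \<le> a 1 * (a (Suc j) * a 0 ^ j)" by (intro mult_left_mono Suc a0)
    also have "\<dots> = (a 1 * a (Suc j)) * a 0 ^ j" by simp
    also have "\<dots> \<le> (a (Suc (Suc j)) * a 0) * a 0 ^ j"
      using step[of "Suc j"] by (intro mult_right_mono zero_le_power a0)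
    finally show ?case by (simp add: mult.assoc)
  qed simp
  obtain p' where p': "p = Suc p'" using p by (cases p) auto
  have "a p = (\<Sum>i<n. (mv n (mp n M p) x i)\<^sup>2)"
    by (simp add: a_def dot_def mv_mp power2_eq_square)
  also have "\<dots> \<le> (\<Sum>i<n. (\<Sum>j<n. (mp n M p i j)\<^sup>2) * a 0)"
    unfolding mv_def a_def dot_def funpow_0 power2_eq_square[of "x _", symmetric]
    using Cauchy_Schwarz_ineq_sum[of _ x "{..<n}"] by (intro sum_mono) (simp add: power2_eq_square)
  also have "\<dots> = walk_trace n M (2 * p) * a 0"
    by (simp add: walk_trace_double[OF sym] sum_distrib_right)
  also have "\<dots> \<le> c ^ p * a 0" by (intro mult_right_mono tr a0)
  finally have "a p * a 0 ^ p' \<le> c ^ p * a 0 * a 0 ^ p'"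
    by (intro mult_right_mono zero_le_power a0)
  with pw[of p'] have "a 1 ^ p \<le> (c * a 0) ^ p" by (simp add: p' power_mult_distrib mult_ac)
  then have "a 1 \<le> c * a 0"
    using p c a0 by (simp add: power_mono_iff)
  then show "dot n (mv n M x) (mv n M x) \<le> c * dot n x x" by (simp add: a_def)
qed

lemma trace_le_op_bound:
  assumes sym: "\<And>i j. M i j = M j i" and c: "0 \<le> c" and M: "op_bound n M c"
  shows "walk_trace n M (2 * p) \<le> real n * c ^ p"
proof -
  have it: "dot n ((mv n M ^^ j) x) ((mv n M ^^ j) x) \<le> c ^ j * dot n x x" for j x
  proof (induction j)
    case (Suc j)
    have "dot n ((mv n M ^^ Suc j) x) ((mv n M ^^ Suc j) x) \<le> c * dot n ((mv n M ^^ j) x) ((mv n M ^^ j) x)"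
      using M by (simp add: op_bound_def)
    also have "\<dots> \<le> c * (c ^ j * dot n x x)" by (intro mult_left_mono Suc c)
    finally show ?case by (simp add: mult.assoc)
  qed simp
  have "walk_trace n M (2 * p) = (\<Sum>j<n. \<Sum>i<n. (mp n M p i j)\<^sup>2)"
    unfolding walk_trace_double[OF sym] by (rule sum.swap)
  also have "\<dots> \<le> (\<Sum>j<n. c ^ p)"
  proof (rule sum_mono)
    fix j assume j: "j \<in> {..<n}"
    let ?e = "\<lambda>i. if i = j then 1 else 0 :: real"
    have "mv n (mp n M p) ?e i = mp n M p i j" for i
      using j by (simp add: mv_def if_distrib cong: if_cong)
    then have "(\<Sum>i<n. (mp n M p i j)\<^sup>2) = dot n ((mv n M ^^ p) ?e) ((mv n M ^^ p) ?e)"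
      by (simp add: dot_def mv_mp[symmetric] power2_eq_square)
    also have "\<dots> \<le> c ^ p * dot n ?e ?e" by (rule it)
    also have "dot n ?e ?e = 1" using j by (simp add: dot_def if_distrib cong: if_cong)
    finally show "(\<Sum>i<n. (mp n M p i j)\<^sup>2) \<le> c ^ p" by simp
  qed
  finally show ?thesis by simp
qed

text \<open>Integer points of the ball of squared radius \<open>4 r\<close>; scaled by \<open>1 / sqrt r\<close> they form the net
  of the argument. Rounding coordinatewise towards the sign of a linear form does not decrease the
  form, so bounding a bilinear form on the net bounds it on the unit ball without any loss.\<close>
definition net :: "nat \<Rightarrow> (nat \<Rightarrow> int) set" where
  "net r = {z \<in> PiE {..<r} (\<lambda>_. {- int (4 * r)..int (4 * r)}). (\<Sum>i<r. (z i)\<^sup>2) \<le> int (4 * r)}"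

abbreviation rv :: "(nat \<Rightarrow> int) \<Rightarrow> nat \<Rightarrow> real" where
  "rv z \<equiv> \<lambda>i. real_of_int (z i)"

lemma finite_net [simp]: "finite (net r)"
  by (rule finite_subset[OF _ finite_PiE[of "{..<r}" "\<lambda>_. {- int (4 * r)..int (4 * r)}"]])
     (auto simp: net_def)

lemma sum_half_powers: "(\<Sum>z\<in>{- int m..int m}. (1 / 2 :: real) ^ nat \<bar>z\<bar>) = 3 - 2 * (1 / 2) ^ m"
proof (induction m)
  case (Suc m)
  have "{- int (Suc m)..int (Suc m)} = insert (int (Suc m)) (insert (- int (Suc m)) {- int m..int m})"
    by auto
  then have "(\<Sum>z\<in>{- int (Suc m)..int (Suc m)}. (1 / 2 :: real) ^ nat \<bar>z\<bar>)
     = (1 / 2) ^ Suc m + ((1 / 2) ^ Suc m + (\<Sum>z\<in>{- int m..int m}. (1 / 2 :: real) ^ nat \<bar>z\<bar>))"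
    by (simp add: nat_add_distrib)
  then show ?case by (simp add: Suc)
qed simp

lemma int_abs_le_square: "\<bar>z\<bar> \<le> z\<^sup>2" for z :: int
proof (cases "z = 0")
  case False
  then have "1 * \<bar>z\<bar> \<le> \<bar>z\<bar> * \<bar>z\<bar>" by (intro mult_right_mono) auto
  then show ?thesis by (simp add: power2_eq_square)
qed simp

text \<open>Each net point has weight exp (4 r - |z|^2) at least 1. Over the enclosing cube this
  weight factors into one-dimensional sums, each at most 3 by comparison with the two-sided
  geometric series of ratio 1/2.\<close>

lemma card_net: "real (card (net r)) \<le> (3 * exp 4) ^ r"
proof -
  let ?I = "{- int (4 * r)..int (4 * r)}"
  have one: "exp (- (real_of_int z)\<^sup>2) \<le> (1 / 2) ^ nat \<bar>z\<bar>" for z :: int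
  proof -
    have "\<bar>z\<bar> \<le> z\<^sup>2" by (rule int_abs_le_square)
    then have "real_of_int \<bar>z\<bar> \<le> real_of_int (z\<^sup>2)" by (simp only: of_int_le_iff)
    then have "exp (- (real_of_int z)\<^sup>2) \<le> exp (- real (nat \<bar>z\<bar>))" by simp
    also have "\<dots> = exp (- 1) ^ nat \<bar>z\<bar>" by (simp add: exp_of_nat_mult[symmetric])
    also have "\<dots> \<le> (1 / 2) ^ nat \<bar>z\<bar>"
      using exp_ge_add_one_self[of 1] by (intro power_mono) (auto simp: exp_minus field_simps)
    finally show ?thesis .
  qed
  have "real (card (net r)) = (\<Sum>z\<in>net r. 1)" by simp
  also have "\<dots> \<le> (\<Sum>z\<in>net r. exp (4 * real r) * (\<Prod>i<r. exp (- (rv z i)\<^sup>2)))"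
  proof (rule sum_mono)
    fix z assume "z \<in> net r"
    then have "(\<Sum>i<r. (z i)\<^sup>2) \<le> int (4 * r)" by (simp add: net_def)
    then have "real_of_int (\<Sum>i<r. (z i)\<^sup>2) \<le> real_of_int (int (4 * r))" by (simp only: of_int_le_iff)
    then have "1 \<le> exp (4 * real r - (\<Sum>i<r. (rv z i)\<^sup>2))" by simp
    also have "\<dots> = exp (4 * real r) * (\<Prod>i<r. exp (- (rv z i)\<^sup>2))"
      by (simp only: diff_conv_add_uminus sum_negf[symmetric] exp_add exp_sum finite_lessThan)
    finally show "1 \<le> exp (4 * real r) * (\<Prod>i<r. exp (- (rv z i)\<^sup>2))" .
  qed
  also have "\<dots> \<le> (\<Sum>z\<in>PiE {..<r} (\<lambda>_. ?I). exp (4 * real r) * (\<Prod>i<r. exp (- (rv z i)\<^sup>2)))"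
  proof (rule sum_mono2)
    show "finite (PiE {..<r} (\<lambda>_. ?I))" by (rule finite_PiE) auto
    show "net r \<subseteq> PiE {..<r} (\<lambda>_. ?I)" unfolding net_def by (rule Collect_subset)
  qed (intro mult_nonneg_nonneg prod_nonneg, auto)
  also have "\<dots> = exp (4 * real r) * (\<Prod>i<r. \<Sum>z\<in>?I. exp (- (real_of_int z)\<^sup>2))"
    by (subst prod_sum_PiE) (auto simp only: sum_distrib_left finite_lessThan finite_atLeastAtMost_int)
  also have "\<dots> \<le> exp (4 * real r) * (\<Prod>i<r. 3)"
  proof (intro mult_left_mono prod_mono conjI)
    have "(\<Sum>z\<in>?I. exp (- (real_of_int z)\<^sup>2)) \<le> (\<Sum>z\<in>?I. (1 / 2) ^ nat \<bar>z\<bar>)"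
      by (intro sum_mono one)
    also have "\<dots> \<le> 3" by (subst sum_half_powers) simp
    finally show "(\<Sum>z\<in>?I. exp (- (real_of_int z)\<^sup>2)) \<le> 3" .
  qed (auto intro: sum_nonneg)
  also have "\<dots> = (3 * exp 4) ^ r"
    by (simp add: power_mult_distrib mult.commute[of _ 4] exp_of_nat2_mult)
  finally show ?thesis .
qed

lemma net_rounding:
  assumes x: "dot r x x \<le> 1"
  obtains z where "z \<in> net r" "sqrt (real r) * dot r x c \<le> dot r (rv z) c"
proof
  define y where "y = (\<lambda>i. sqrt (real r) * x i)"
  define z where "z = (\<lambda>i. if i < r then if 0 \<le> c i then \<lceil>y i\<rceil> else \<lfloor>y i\<rfloor> else undefined)"
  have close: "\<bar>rv z i - y i\<bar> \<le> 1" if "i < r" for i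
    using that unfolding z_def by (simp; linarith)
  \<comment> \<open>Summed over i with |x| at most 1, the two terms give 2 r + 2 r: this is where
    the radius 4 r in \<open>net\<close> comes from.\<close>
  have sq: "(rv z i)\<^sup>2 \<le> 2 * (real r * (x i)\<^sup>2) + 2" if "i < r" for i
  proof -
    have "(rv z i)\<^sup>2 \<le> 2 * (y i)\<^sup>2 + 2 * (rv z i - y i)\<^sup>2"
      using zero_le_power2[of "2 * y i - rv z i"] by (simp add: power2_eq_square algebra_simps)
    moreover have "(rv z i - y i)\<^sup>2 \<le> 1" using close[OF that] by (simp add: abs_square_le_1)
    moreover have "(y i)\<^sup>2 = real r * (x i)\<^sup>2" by (simp add: y_def power_mult_distrib)
    ultimately show ?thesis by linarith
  qed
  have "(\<Sum>i<r. (rv z i)\<^sup>2) \<le> (\<Sum>i<r. 2 * (real r * (x i)\<^sup>2) + 2)" by (rule sum_mono) (simp add: sq)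
  also have "\<dots> = 2 * real r * dot r x x + 2 * real r"
    by (simp add: sum.distrib sum_distrib_left dot_def power2_eq_square mult_ac)
  also have "\<dots> \<le> 4 * real r" using mult_left_mono[OF x, of "2 * real r"] by simp
  finally have "real_of_int (\<Sum>i<r. (z i)\<^sup>2) \<le> real_of_int (int (4 * r))" by simp
  then have le: "(\<Sum>i<r. (z i)\<^sup>2) \<le> int (4 * r)" by (simp only: of_int_le_iff)
  have "- int (4 * r) \<le> z i \<and> z i \<le> int (4 * r)" if "i < r" for i
  proof -
    have "\<bar>z i\<bar> \<le> (z i)\<^sup>2" by (rule int_abs_le_square)
    also have "(z i)\<^sup>2 \<le> (\<Sum>i<r. (z i)\<^sup>2)" by (rule member_le_sum) (use that in auto)
    also note le
    finally show ?thesis by (simp add: abs_le_iff)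
  qed
  then show "z \<in> net r" unfolding net_def using le by (auto simp: PiE_def extensional_def z_def)
  have "y i * c i \<le> rv z i * c i" if "i < r" for i
  proof (cases "0 \<le> c i")
    case True
    then show ?thesis using that by (auto simp: z_def intro!: mult_right_mono)
  next
    case False
    then show ?thesis using that by (auto simp: z_def intro!: mult_right_mono_neg)
  qed
  then have "dot r y c \<le> dot r (rv z) c" unfolding dot_def by (intro sum_mono) auto
  then show "sqrt (real r) * dot r x c \<le> dot r (rv z) c" by (simp add: y_def dot_scale_left)
qed

text \<open>Round x with y fixed, then y with the rounded x fixed. Each rounding gains a factor
  \<open>sqrt (real r)\<close>, which explains the scale \<open>real r * \<kappa>\<close> in the
  hypothesis. The norm bound follows by testing with the normalisations of x0 and Y x0.\<close>

lemma op_bound_of_net: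
  assumes r: "0 < r" and k: "0 \<le> \<kappa>"
    and net: "\<And>z z'. z \<in> net r \<Longrightarrow> z' \<in> net r \<Longrightarrow> dot r (rv z) (mv r Y (rv z')) \<le> real r * \<kappa>"
  shows "op_bound r Y (\<kappa>\<^sup>2)"
  unfolding op_bound_def
proof
  fix x0
  have ball: "dot r x (mv r Y y) \<le> \<kappa>" if x: "dot r x x \<le> 1" and y: "dot r y y \<le> 1" for x y
  proof -
    obtain z where z: "z \<in> net r" "sqrt (real r) * dot r x (mv r Y y) \<le> dot r (rv z) (mv r Y y)"
      using net_rounding[OF x] by blast
    let ?c = "mv r (\<lambda>i j. Y j i) (rv z)"
    obtain z' where z': "z' \<in> net r" "sqrt (real r) * dot r y ?c \<le> dot r (rv z') ?c"
      using net_rounding[OF y] by blast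
    have "real r * dot r x (mv r Y y) = sqrt (real r) * (sqrt (real r) * dot r x (mv r Y y))"
      by simp
    also have "\<dots> \<le> sqrt (real r) * dot r (rv z) (mv r Y y)" by (intro mult_left_mono z) auto
    also have "\<dots> = sqrt (real r) * dot r y ?c" by (subst dot_mv_swap) (simp add: dot_commute)
    also have "\<dots> \<le> dot r (rv z') ?c" by (rule z')
    also have "\<dots> = dot r (rv z) (mv r Y (rv z'))" by (subst dot_mv_swap[of _ _ Y]) (simp add: dot_commute)
    also have "\<dots> \<le> real r * \<kappa>" by (rule net[OF z(1) z'(1)])
    finally show ?thesis using r by simp
  qed
  let ?y = "mv r Y x0"
  define a b where "a = sqrt (dot r x0 x0)" and "b = sqrt (dot r ?y ?y)"
  have ab: "a\<^sup>2 = dot r x0 x0" "b\<^sup>2 = dot r ?y ?y" "0 \<le> a" "0 \<le> b"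
    by (simp_all add: a_def b_def dot_nonneg)
  have "b \<le> \<kappa> * a"
  proof (cases "a = 0 \<or> b = 0")
    case True
    have "b = 0" if "a = 0"
    proof -
      have "x0 i = 0" if "i < r" for i using dot_eq_0D[OF _ that, of x0] ab(1) \<open>a = 0\<close> by simp
      then have "?y = (\<lambda>i. 0)" by (auto simp: mv_def)
      then show ?thesis by (simp add: b_def dot_def)
    qed
    with True ab k show ?thesis by auto
  next
    case False
    with ab have pos: "0 < a" "0 < b" by auto
    have "dot r (\<lambda>i. 1 / b * ?y i) (mv r Y (\<lambda>i. 1 / a * x0 i)) \<le> \<kappa>"
    proof (rule ball)
      show "dot r (\<lambda>i. 1 / b * ?y i) (\<lambda>i. 1 / b * ?y i) \<le> 1"
        using pos by (simp only: dot_scale_left dot_scale_right ab(2)[symmetric]) (simp add: power2_eq_square)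
      show "dot r (\<lambda>i. 1 / a * x0 i) (\<lambda>i. 1 / a * x0 i) \<le> 1"
        using pos by (simp only: dot_scale_left dot_scale_right ab(1)[symmetric]) (simp add: power2_eq_square)
    qed
    also have "mv r Y (\<lambda>i. 1 / a * x0 i) = (\<lambda>i. 1 / a * ?y i)" by (rule ext) (rule mv_scale)
    also have "dot r (\<lambda>i. 1 / b * ?y i) \<dots> = b / a"
      using pos by (simp only: dot_scale_left dot_scale_right ab(2)[symmetric]) (simp add: power2_eq_square)
    finally show ?thesis using pos by (simp add: field_simps)
  qed
  then have "b\<^sup>2 \<le> (\<kappa> * a)\<^sup>2" using ab(4) by (rule power_mono)
  then show "dot r ?y ?y \<le> \<kappa>\<^sup>2 * dot r x0 x0" by (simp add: ab power_mult_distrib)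
qed

text \<open>The maximum over net pairs is replaced by a sum of powers, with \<kappa> its root of
  order 2 p. The inequality is deterministic and linear in those powers, so an expectation passes
  through it.\<close>

lemma walk_trace_le_net_sum:
  assumes sym: "\<And>i j. Y i j = Y j i" and r: "0 < r" and p: "0 < p"
  shows "walk_trace r Y (2 * p)
    \<le> real r * (\<Sum>z\<in>net r. \<Sum>z'\<in>net r. (dot r (rv z) (mv r Y (rv z')) / real r) ^ (2 * p))"
proof -
  define s where "s = (\<lambda>z z'. dot r (rv z) (mv r Y (rv z')) / real r)"
  define Q where "Q = (\<Sum>z\<in>net r. \<Sum>z'\<in>net r. s z z' ^ (2 * p))"
  have nn: "0 \<le> s z z' ^ (2 * p)" for z z' by simp
  have Q0: "0 \<le> Q" unfolding Q_def by (intro sum_nonneg nn)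
  define \<kappa> where "\<kappa> = root (2 * p) Q"
  have k: "0 \<le> \<kappa>" "\<kappa> ^ (2 * p) = Q" using Q0 p by (auto simp: \<kappa>_def)
  have "op_bound r Y (\<kappa>\<^sup>2)"
  proof (rule op_bound_of_net[OF r k(1)])
    fix z z' assume z: "z \<in> net r" "z' \<in> net r"
    have "s z z' ^ (2 * p) \<le> (\<Sum>z'\<in>net r. s z z' ^ (2 * p))"
      by (rule member_le_sum) (use z in auto)
    also have "\<dots> \<le> Q" unfolding Q_def
      by (rule member_le_sum[where f = "\<lambda>z. \<Sum>z'\<in>net r. s z z' ^ (2 * p)"]) (use z in \<open>auto intro: sum_nonneg\<close>)
    finally have "\<bar>s z z'\<bar> ^ (2 * p) \<le> \<kappa> ^ (2 * p)" using k(2) by (simp add: power_even_abs)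
    then have "\<bar>s z z'\<bar> \<le> \<kappa>" using p k(1) by (simp add: power_mono_iff del: power_mult)
    then have "s z z' \<le> \<kappa>" by simp
    then show "dot r (rv z) (mv r Y (rv z')) \<le> real r * \<kappa>" using r by (simp add: s_def field_simps)
  qed
  from trace_le_op_bound[OF sym _ this, of p] have "walk_trace r Y (2 * p) \<le> real r * Q"
    using k by (simp add: power_mult)
  then show ?thesis by (simp add: Q_def s_def)
qed

section \<open>Concentration of the adjacency matrix\<close>

lemma power_le_fact_exp:
  fixes x :: real
  assumes "0 \<le> x"
  shows "x ^ m \<le> fact m * exp x"
proof -
  have s: "(\<lambda>k. x ^ k /\<^sub>R fact k) sums exp x" by (rule exp_converges)
  have "(\<Sum>k\<in>{m}. x ^ k /\<^sub>R fact k) \<le> (\<Sum>k. x ^ k /\<^sub>R fact k)"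
    by (rule sum_le_suminf) (use s assms in \<open>auto simp: sums_iff\<close>)
  then have "x ^ m /\<^sub>R fact m \<le> exp x" using s by (simp add: sums_iff)
  then show ?thesis by (simp add: field_simps)
qed

lemma even_power_le_exp:
  fixes x :: real
  shows "x ^ (2 * p) \<le> fact (2 * p) * (exp x + exp (- x))"
proof -
  have "x ^ (2 * p) = \<bar>x\<bar> ^ (2 * p)" by (simp add: power_even_abs)
  also have "\<dots> \<le> fact (2 * p) * exp \<bar>x\<bar>" by (rule power_le_fact_exp) simp
  also have "\<dots> \<le> fact (2 * p) * (exp x + exp (- x))"
    by (intro mult_left_mono) (auto simp: abs_if)
  finally show ?thesis .
qed

text \<open>Hoeffding's lemma for a centered variable of range 3. For negative s the variable is
  reflected, which replaces success probability 1/3 by 2/3.\<close>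

lemma cmpv_mgf:
  "measure_pmf.expectation (bernoulli_pmf (1 / 3)) (\<lambda>b. exp (s * cmpv e b)) \<le> exp (9 / 8 * s\<^sup>2)"
proof -
  have E: "measure_pmf.expectation (bernoulli_pmf (1 / 3)) (\<lambda>b. exp (s * cmpv e b)) = (exp (2 * s) + 2 * exp (- s)) / 3"
    by (simp add: cmpv_def mult.commute)
  show ?thesis
  proof (cases "0 \<le> s")
    case True
    have "1 + 1 / 3 * (exp (3 * s) - 1) > 0" using True by (simp add: add_pos_nonneg)
    then have "(exp (2 * s) + 2 * exp (- s)) / 3 = exp (- (3 * s) * (1 / 3) + ln (1 + 1 / 3 * (exp (3 * s) - 1)))"
      by (subst exp_add) (simp add: field_simps flip: exp_add)
    also have "\<dots> \<le> exp ((3 * s)\<^sup>2 / 8)"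
      using Hoeffdings_lemma_aux[of "3 * s" "1 / 3"] True by simp
    finally show ?thesis by (simp add: E power_mult_distrib)
  next
    case False
    have "1 + 2 / 3 * (exp (- 3 * s) - 1) > 0" using False by (simp add: add_pos_nonneg)
    then have "(exp (2 * s) + 2 * exp (- s)) / 3 = exp (- (- 3 * s) * (2 / 3) + ln (1 + 2 / 3 * (exp (- 3 * s) - 1)))"
      by (subst exp_add) (simp add: field_simps flip: exp_add)
    also have "\<dots> \<le> exp ((- 3 * s)\<^sup>2 / 8)"
      using Hoeffdings_lemma_aux[of "- 3 * s" "2 / 3"] False by simp
    finally show ?thesis by (simp add: E power_mult_distrib)
  qed
qed

section \<open>Exponential moments and powers of bilinear forms\<close>

lemma sum_off_diagonal:
  fixes F :: "nat \<Rightarrow> nat \<Rightarrow> real"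
  shows "(\<Sum>i<r. \<Sum>j<r. if i = j then 0 else F i j)
    = (\<Sum>e\<in>upper_pairs r. F (fst e) (snd e) + F (snd e) (fst e))"
proof -
  have "(\<Sum>i<r. \<Sum>j<r. if i = j then 0 else F i j)
      = (\<Sum>e\<in>{..<r} \<times> {..<r}. if fst e = snd e then 0 else F (fst e) (snd e))"
    by (simp add: sum.cartesian_product case_prod_beta)
  also have "\<dots> = (\<Sum>e\<in>upper_pairs r \<union> prod.swap ` upper_pairs r. F (fst e) (snd e))"
  proof (rule sum.mono_neutral_cong_right)
    have "e \<in> prod.swap ` upper_pairs r" if "e \<in> {..<r} \<times> {..<r}" "\<not> fst e \<le> snd e" for e
      using that by (intro image_eqI[of _ _ "prod.swap e"]) (auto simp: upper_pairs_def)
    moreover have "e \<in> upper_pairs r" if "e \<in> {..<r} \<times> {..<r}" "fst e < snd e" for e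
      using that by (auto simp: upper_pairs_def)
    ultimately have "fst e = snd e"
      if "e \<in> {..<r} \<times> {..<r} - (upper_pairs r \<union> prod.swap ` upper_pairs r)" for e
      using that by (metis DiffE UnCI linorder_not_le order_less_le)
    then show "\<forall>e\<in>{..<r} \<times> {..<r} - (upper_pairs r \<union> prod.swap ` upper_pairs r).
        (if fst e = snd e then 0 else F (fst e) (snd e)) = 0" by simp
  qed (auto simp: upper_pairs_def)
  also have "\<dots> = (\<Sum>e\<in>upper_pairs r. F (fst e) (snd e)) + (\<Sum>e\<in>prod.swap ` upper_pairs r. F (fst e) (snd e))"
    by (rule sum.union_disjoint) (simp, simp, auto simp: upper_pairs_def)
  also have "(\<Sum>e\<in>prod.swap ` upper_pairs r. F (fst e) (snd e)) = (\<Sum>e\<in>upper_pairs r. F (snd e) (fst e))"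
    by (subst sum.reindex) (auto simp: inj_on_def)
  finally show ?thesis by (simp add: sum.distrib)
qed

text \<open>The coefficient of one edge variable in the bilinear form; the variable sits at both
  symmetric entries.\<close>

definition bet :: "(nat \<Rightarrow> real) \<Rightarrow> (nat \<Rightarrow> real) \<Rightarrow> nat \<times> nat \<Rightarrow> real" where
  "bet x y e = x (fst e) * y (snd e) + x (snd e) * y (fst e)"

lemma dot_sym_mat:
  "dot r x (mv r (sym_mat f \<omega>) y) = (\<Sum>e\<in>upper_pairs r. f e (\<omega> e) * bet x y e)"
proof -
  have ed: "ed i j = (i, j)" "ed j i = (i, j)" if "i < j" for i j using that by (auto simp: ed_def)
  have "dot r x (mv r (sym_mat f \<omega>) y) = (\<Sum>i<r. \<Sum>j<r. if i = j then 0 else x i * (f (ed i j) (\<omega> (ed i j)) * y j))"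
    unfolding dot_def mv_def sym_mat_def by (simp add: sum_distrib_left) (intro sum.cong, auto)
  also have "\<dots> = (\<Sum>e\<in>upper_pairs r. f e (\<omega> e) * bet x y e)"
    unfolding sum_off_diagonal by (intro sum.cong) (auto simp: upper_pairs_def ed bet_def algebra_simps)
  finally show ?thesis .
qed

lemma sum_bet_square_le: "(\<Sum>e\<in>upper_pairs r. (bet x y e)\<^sup>2) \<le> 2 * dot r x x * dot r y y"
proof -
  let ?F = "\<lambda>i j. 2 * ((x i)\<^sup>2 * (y j)\<^sup>2)"
  have "(\<Sum>e\<in>upper_pairs r. (bet x y e)\<^sup>2) \<le> (\<Sum>e\<in>upper_pairs r. ?F (fst e) (snd e) + ?F (snd e) (fst e))"
  proof (rule sum_mono)
    fix e
    show "(bet x y e)\<^sup>2 \<le> ?F (fst e) (snd e) + ?F (snd e) (fst e)"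
      using zero_le_power2[of "x (fst e) * y (snd e) - x (snd e) * y (fst e)"]
      by (simp add: bet_def power2_eq_square algebra_simps)
  qed
  also have "\<dots> = (\<Sum>i<r. \<Sum>j<r. if i = j then 0 else ?F i j)" by (rule sum_off_diagonal[symmetric])
  also have "\<dots> \<le> (\<Sum>i<r. \<Sum>j<r. ?F i j)" by (intro sum_mono) auto
  also have "\<dots> = 2 * ((\<Sum>i<r. (x i)\<^sup>2) * (\<Sum>j<r. (y j)\<^sup>2))"
    by (subst sum_product) (simp only: sum_distrib_left)
  also have "\<dots> = 2 * dot r x x * dot r y y" by (simp add: dot_def power2_eq_square)
  finally show ?thesis .
qed

lemma cmp_form_mgf:
  "measure_pmf.expectation (cmp_pmf r) (\<lambda>\<omega>. exp (t * dot r x (mv r (sym_mat cmpv \<omega>) y)))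
    \<le> exp (9 / 4 * t\<^sup>2 * (dot r x x * dot r y y))"
proof -
  have "measure_pmf.expectation (cmp_pmf r) (\<lambda>\<omega>. exp (t * dot r x (mv r (sym_mat cmpv \<omega>) y)))
    = measure_pmf.expectation (cmp_pmf r) (\<lambda>\<omega>. \<Prod>e\<in>upper_pairs r. exp ((t * bet x y e) * cmpv e (\<omega> e)))"
    by (simp add: dot_sym_mat sum_distrib_left exp_sum mult_ac)
  also have "\<dots> = (\<Prod>e\<in>upper_pairs r. measure_pmf.expectation (bernoulli_pmf (1 / 3)) (\<lambda>b. exp ((t * bet x y e) * cmpv e b)))"
    by (rule expectation_prod_Pi_pmf_bool) simp
  also have "\<dots> \<le> (\<Prod>e\<in>upper_pairs r. exp (9 / 8 * (t * bet x y e)\<^sup>2))"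
    by (intro prod_mono conjI cmpv_mgf Bochner_Integration.integral_nonneg) auto
  also have "\<dots> = exp (9 / 8 * t\<^sup>2 * (\<Sum>e\<in>upper_pairs r. (bet x y e)\<^sup>2))"
    by (simp add: exp_sum[symmetric] sum_distrib_left power_mult_distrib mult_ac)
  also have "\<dots> \<le> exp (9 / 8 * t\<^sup>2 * (2 * dot r x x * dot r y y))"
    by (simp only: exp_le_cancel_iff) (intro mult_left_mono sum_bet_square_le, simp)
  finally show ?thesis by (simp add: mult_ac)
qed

text \<open>The even power is traded for \<open>fact (2 * p)\<close> times exponentials at parameter
  1 / sqrt r, where r = 2 p bounds the factorial by r^(2 p). Net vectors have squared norm at most 4
  r, so the exponent is (9/4) (1/r) (4 r)^2 = 36 r.\<close>

lemma cmp_form_moment: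
  assumes p: "0 < p" and r: "r = 2 * p" and x: "dot r x x \<le> 4 * real r" and y: "dot r y y \<le> 4 * real r"
  shows "measure_pmf.expectation (cmp_pmf r) (\<lambda>\<omega>. (dot r x (mv r (sym_mat cmpv \<omega>) y) / real r) ^ (2 * p))
    \<le> 2 * real r ^ p * exp (36 * real r)"
proof -
  define S where "S = (\<lambda>\<omega>. dot r x (mv r (sym_mat cmpv \<omega>) y))"
  define t where "t = 1 / sqrt (real r)"
  have r0: "0 < real r" using p r by simp
  have t2: "t\<^sup>2 = 1 / real r" using r0 by (simp add: t_def power_divide)
  have mgf: "measure_pmf.expectation (cmp_pmf r) (\<lambda>\<omega>. exp (u * S \<omega>)) \<le> exp (36 * real r)"
    if u: "u\<^sup>2 = 1 / real r" for u
  proof -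
    have "dot r x x * dot r y y \<le> (4 * real r) * (4 * real r)"
      by (intro mult_mono x y dot_nonneg) (use r0 in auto)
    then have "9 / 4 * u\<^sup>2 * (dot r x x * dot r y y) \<le> 9 / 4 * u\<^sup>2 * ((4 * real r) * (4 * real r))"
      by (intro mult_left_mono) auto
    also have "\<dots> = 36 * real r" using r0 by (simp add: u)
    finally have "exp (9 / 4 * u\<^sup>2 * (dot r x x * dot r y y)) \<le> exp (36 * real r)" by simp
    with cmp_form_mgf[of r u x y] show ?thesis unfolding S_def by linarith
  qed
  have pt: "(S \<omega> / real r) ^ (2 * p) \<le> real r ^ p * (exp (t * S \<omega>) + exp ((- t) * S \<omega>))" for \<omega>
  proof -
    have "(S \<omega> / real r) ^ (2 * p) = (t * S \<omega>) ^ (2 * p) / real r ^ p"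
      using r0 by (simp add: power_mult_distrib power_divide power_mult t2) (simp add: field_simps power2_eq_square)
    also have "\<dots> \<le> fact (2 * p) * (exp (t * S \<omega>) + exp (- (t * S \<omega>))) / real r ^ p"
      by (intro divide_right_mono even_power_le_exp) auto
    also have "\<dots> \<le> real r ^ (2 * p) * (exp (t * S \<omega>) + exp (- (t * S \<omega>))) / real r ^ p"
    proof (intro divide_right_mono mult_right_mono)
      show "fact (2 * p) \<le> real r ^ (2 * p)"
        using fact_le_power[of "2 * p", where 'a = real] by (simp add: r)
    qed (auto intro: add_nonneg_nonneg)
    also have "\<dots> = real r ^ p * (exp (t * S \<omega>) + exp (- (t * S \<omega>)))"
      using r0 by (simp add: mult_2 power_add)
    finally show ?thesis by simp
  qed
  have "measure_pmf.expectation (cmp_pmf r) (\<lambda>\<omega>. (S \<omega> / real r) ^ (2 * p))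
     \<le> measure_pmf.expectation (cmp_pmf r) (\<lambda>\<omega>. real r ^ p * (exp (t * S \<omega>) + exp ((- t) * S \<omega>)))"
    by (intro integral_mono integrable_Pi_pmf_bool pt) auto
  also have "\<dots> = real r ^ p * (measure_pmf.expectation (cmp_pmf r) (\<lambda>\<omega>. exp (t * S \<omega>))
       + measure_pmf.expectation (cmp_pmf r) (\<lambda>\<omega>. exp ((- t) * S \<omega>)))"
    by (subst Bochner_Integration.integral_mult_right_zero, subst Bochner_Integration.integral_add)
       (auto intro: integrable_Pi_pmf_bool)
  also have "\<dots> \<le> real r ^ p * (exp (36 * real r) + exp (36 * real r))"
    by (intro mult_left_mono add_mono mgf) (simp_all add: t2)
  finally show ?thesis by (simp add: S_def)
qed

lemma cmp_trace_bound:
  assumes p: "0 < p" and r: "r = 2 * p"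
  shows "measure_pmf.expectation (cmp_pmf r) (\<lambda>\<omega>. walk_trace r (sym_mat cmpv \<omega>) (2 * p))
    \<le> real r * ((3 * exp 4) ^ (2 * r) * (2 * real r ^ p * exp (36 * real r)))"
proof -
  let ?s = "\<lambda>z z' \<omega>. (dot r (rv z) (mv r (sym_mat cmpv \<omega>) (rv z')) / real r) ^ (2 * p)"
  let ?b = "2 * real r ^ p * exp (36 * real r)"
  have net: "dot r (rv z) (rv z) \<le> 4 * real r" if "z \<in> net r" for z
  proof -
    have "(\<Sum>i<r. (z i)\<^sup>2) \<le> int (4 * r)" using that by (simp add: net_def)
    then have "real_of_int (\<Sum>i<r. (z i)\<^sup>2) \<le> real_of_int (int (4 * r))" by (simp only: of_int_le_iff)
    then show ?thesis by (simp add: dot_def power2_eq_square)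
  qed
  have "measure_pmf.expectation (cmp_pmf r) (\<lambda>\<omega>. walk_trace r (sym_mat cmpv \<omega>) (2 * p))
    \<le> measure_pmf.expectation (cmp_pmf r) (\<lambda>\<omega>. real r * (\<Sum>z\<in>net r. \<Sum>z'\<in>net r. ?s z z' \<omega>))"
    by (intro integral_mono integrable_Pi_pmf_bool walk_trace_le_net_sum sym_mat_symmetric) (use p r in auto)
  also have "\<dots> = real r * (\<Sum>z\<in>net r. \<Sum>z'\<in>net r. measure_pmf.expectation (cmp_pmf r) (?s z z'))"
    by (simp add: Bochner_Integration.integral_sum integrable_Pi_pmf_bool)
  also have "\<dots> \<le> real r * (\<Sum>z\<in>net r. \<Sum>z'\<in>net r. ?b)"
    by (intro mult_left_mono sum_mono cmp_form_moment[OF p r] net) auto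
  also have "\<dots> = real r * ((real (card (net r)))\<^sup>2 * ?b)" by (simp add: power2_eq_square)
  also have "\<dots> \<le> real r * (((3 * exp 4) ^ r)\<^sup>2 * ?b)"
    by (intro mult_left_mono mult_right_mono power_mono card_net) auto
  finally show ?thesis by (simp only: power_mult[symmetric] mult.commute[of r 2])
qed

text \<open>With r = 2 d, the squared net size is (81 exp 16)^d, the exponential moment is (exp
  72)^d, and r^d gives 2^d beside d^d. A further exp 8 is slack for Markov's inequality: 81 * 2 =
  162 and 16 + 72 + 8 = 96.\<close>

definition conc :: real where
  "conc = 162 * exp 96"

lemma conc_pos: "0 < conc"
  by (simp add: conc_def)

lemma trace_moment_bound:
  fixes q :: "nat \<times> nat \<Rightarrow> real" and d n :: nat
  assumes q: "\<And>e. e \<in> upper_pairs n \<Longrightarrow> 0 \<le> q e \<and> q e \<le> Q" and Q: "Q \<le> 1" "0 \<le> Q" "real n * Q \<le> real d"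
    and d: "0 < d"
  shows "measure_pmf.expectation (Pi_pmf (upper_pairs n) False (\<lambda>e. bernoulli_pmf (q e)))
        (\<lambda>\<omega>. walk_trace n (sym_mat (cbern q) \<omega>) (2 * d))
    \<le> 2 * real n * exp (- 8 * real d) * (conc * real d) ^ d" (is "?E \<le> _")
proof -
  define r where "r = 2 * d"
  have r0: "0 < real r" using d by (simp add: r_def)
  have "real r * ?E \<le> real n * measure_pmf.expectation (cmp_pmf r) (\<lambda>\<omega>. walk_trace r (sym_mat cmpv \<omega>) (2 * d))"
    by (rule trace_comparison[OF q Q d]) (simp_all add: r_def)
  also have "\<dots> \<le> real n * (real r * ((3 * exp 4) ^ (2 * r) * (2 * real r ^ d * exp (36 * real r))))"
    by (intro mult_left_mono cmp_trace_bound d r_def) simp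
  finally have "real r * ?E \<le> real r * (real n * ((3 * exp 4) ^ (2 * r) * (2 * real r ^ d * exp (36 * real r))))"
    by (simp only: mult.left_commute[of "real n"])
  then have "?E \<le> real n * ((3 * exp 4) ^ (2 * r) * (2 * real r ^ d * exp (36 * real r)))"
    using r0 by (simp only: mult_le_cancel_left_pos)
  also have "(3 * exp 4 :: real) ^ (2 * r) = (81 * exp 16) ^ d"
  proof -
    have "2 * r = 4 * d" by (simp add: r_def)
    moreover have "(3 * exp 4 :: real) ^ 4 = 81 * exp 16"
      by (simp add: power_mult_distrib exp_of_nat_mult[of 4 4, symmetric, simplified])
    ultimately show ?thesis by (metis power_mult)
  qed
  also have "exp (36 * real r) = exp 72 ^ d"
    by (simp add: r_def exp_of_nat2_mult)
  also have "real n * ((81 * exp 16) ^ d * (2 * real r ^ d * exp 72 ^ d))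
     = 2 * real n * ((81 * exp 16) * (2 * real d) * exp 72) ^ d"
    by (simp only: power_mult_distrib r_def of_nat_mult of_nat_numeral mult_ac)
  also have "(81 * exp 16) * (2 * real d) * exp 72 = exp (- 8) * (conc * real d)"
    by (simp add: conc_def mult_ac flip: exp_add)
  also have "(exp (- 8) * (conc * real d)) ^ d = exp (- 8 * real d) * (conc * real d) ^ d"
    by (simp only: power_mult_distrib exp_of_nat2_mult)
  finally show ?thesis by (simp add: mult.assoc)
qed

theorem adjacency_concentration:
  fixes q :: "nat \<times> nat \<Rightarrow> real" and n :: nat
  assumes q: "\<And>e. e \<in> upper_pairs n \<Longrightarrow> 0 \<le> q e \<and> q e \<le> Q" and Q: "Q \<le> 1"
    and n: "2 \<le> n" and dense: "ln (real n) / 2 \<le> real n * Q"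
  shows "measure_pmf.prob (Pi_pmf (upper_pairs n) False (\<lambda>e. bernoulli_pmf (q e)))
      {\<omega>. op_bound n (sym_mat (cbern q) \<omega>) (4 * conc * (real n * Q))} \<ge> 1 - 1 / real n"
proof -
  let ?P = "Pi_pmf (upper_pairs n) False (\<lambda>e. bernoulli_pmf (q e))"
  let ?T = "\<lambda>d \<omega>. walk_trace n (sym_mat (cbern q) \<omega>) (2 * d)"
  have "ln 2 \<le> ln (real n)" using n by simp
  \<comment> \<open>A lower bound 1/3 on n \<open>Q\<close> makes rounding up cost at most a factor
    4, since x + 1 \<le> 4 x for such x.\<close>
  with ln2_ge_two_thirds dense have nQ: "1 / 3 \<le> real n * Q" by linarith
  have Q0: "0 \<le> Q"
  proof (rule ccontr)
    assume "\<not> 0 \<le> Q"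
    then have "real n * Q \<le> 0" by (intro mult_nonneg_nonpos) auto
    with nQ show False by linarith
  qed
  define d where "d = nat \<lceil>real n * Q\<rceil>"
  have d: "0 < d" "real n * Q \<le> real d" "real d \<le> 4 * (real n * Q)"
    using nQ unfolding d_def by linarith+
  define c where "c = conc * real d"
  have c0: "0 < c" using d conc_pos by (simp add: c_def)
  have le: "c \<le> 4 * conc * (real n * Q)"
    using mult_left_mono[OF d(3), of conc] conc_pos by (simp add: c_def mult_ac)
  have T0: "0 \<le> ?T d \<omega>" for \<omega>
    unfolding walk_trace_double[OF sym_mat_symmetric] by (intro sum_nonneg) auto
  have "measure_pmf.prob ?P {\<omega> \<in> space (measure_pmf ?P). c ^ d \<le> ?T d \<omega>} \<le> measure_pmf.expectation ?P (?T d) / c ^ d"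
    by (rule integral_Markov_inequality_measure[where A = "{}"])
       (use T0 c0 in \<open>auto intro: integrable_Pi_pmf_bool\<close>)
  also have "\<dots> \<le> 2 * real n * exp (- 8 * real d) * c ^ d / c ^ d"
    unfolding c_def by (intro divide_right_mono trace_moment_bound[OF q Q Q0 d(2) d(1)]) (use conc_pos in auto)
  also have "\<dots> = 2 * real n * exp (- 8 * real d)" using c0 by simp
  \<comment> \<open>Since d \<ge> n \<open>Q\<close> \<ge> (ln n) / 2, the slack exp (- 8 d) is at
    most n^(-4), which absorbs the factor 2 n.\<close>
  also have "\<dots> \<le> 2 * real n * exp (- 4 * ln (real n))"
    using d(2) dense by (intro mult_left_mono) auto
  also have "exp (- 4 * ln (real n)) = 1 / real n ^ 4"
  proof -
    have "exp (4 * ln (real n)) = real n ^ 4"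
      using n exp_of_nat_mult[of 4 "ln (real n)"] by simp
    then show ?thesis by (simp add: exp_minus inverse_eq_divide)
  qed
  also have "2 * real n * (1 / real n ^ 4) \<le> 1 / real n"
  proof -
    have "2 * 1 \<le> real n * real n" using n by (intro mult_mono) auto
    then have "2 * (real n * real n) \<le> real n * real n * (real n * real n)" by (intro mult_right_mono) auto
    then show ?thesis using n by (simp add: field_simps power_numeral_reduce)
  qed
  finally have bad: "measure_pmf.prob ?P {\<omega>. c ^ d \<le> ?T d \<omega>} \<le> 1 / real n" by simp
  have "op_bound n (sym_mat (cbern q) \<omega>) (4 * conc * (real n * Q))" if "\<not> c ^ d \<le> ?T d \<omega>" for \<omega>
  proof -
    have b: "op_bound n (sym_mat (cbern q) \<omega>) c"
      by (rule op_bound_of_trace[OF sym_mat_symmetric]) (use c0 d that in auto)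
    show ?thesis unfolding op_bound_def
      using b[unfolded op_bound_def] mult_right_mono[OF le dot_nonneg] by (meson order_trans)
  qed
  then have "- {\<omega>. c ^ d \<le> ?T d \<omega>} \<subseteq> {\<omega>. op_bound n (sym_mat (cbern q) \<omega>) (4 * conc * (real n * Q))}"
    by blast
  then have "measure_pmf.prob ?P (- {\<omega>. c ^ d \<le> ?T d \<omega>})
     \<le> measure_pmf.prob ?P {\<omega>. op_bound n (sym_mat (cbern q) \<omega>) (4 * conc * (real n * Q))}"
    by (intro measure_pmf.finite_measure_mono) auto
  moreover have "measure_pmf.prob ?P (- {\<omega>. c ^ d \<le> ?T d \<omega>}) = 1 - measure_pmf.prob ?P {\<omega>. c ^ d \<le> ?T d \<omega>}"
    using measure_pmf.prob_compl[of "{\<omega>. c ^ d \<le> ?T d \<omega>}" ?P] by (simp add: Compl_eq_Diff_UNIV)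
  ultimately show ?thesis using bad by linarith
qed

section \<open>Perturbation of block matrices\<close>

abbreviation csize :: "nat \<Rightarrow> (nat \<Rightarrow> nat) \<Rightarrow> nat \<Rightarrow> real" where
  "csize n \<theta> j \<equiv> real (card (comm n \<theta> j))"

lemma finite_comm [simp]: "finite (comm n \<theta> j)"
  by (simp add: comm_def)

lemma sum_by_comm:
  fixes F :: "nat \<Rightarrow> real"
  assumes "\<And>i. i < n \<Longrightarrow> \<theta> i < k"
  shows "(\<Sum>i<n. F i) = (\<Sum>j<k. \<Sum>i\<in>comm n \<theta> j. F i)"
  using sum.group[of "{..<n}" "{..<k}" \<theta> F] assms by (force simp: comm_def)

lemma sum_labels:
  fixes F :: "nat \<Rightarrow> real"
  assumes "\<And>i. i < n \<Longrightarrow> \<theta> i < k"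
  shows "(\<Sum>i<n. F (\<theta> i)) = (\<Sum>j<k. csize n \<theta> j * F j)"
proof -
  have "(\<Sum>i\<in>comm n \<theta> j. F (\<theta> i)) = (\<Sum>i\<in>comm n \<theta> j. F j)" for j
    by (intro sum.cong) (auto simp: comm_def)
  moreover have "(\<Sum>i<n. F (\<theta> i)) = (\<Sum>j<k. \<Sum>i\<in>comm n \<theta> j. F (\<theta> i))"
    by (rule sum_by_comm) fact
  ultimately show ?thesis by simp
qed

text \<open>The deterministic situation on the good event: \<open>M\<close> is a debiased graph with
  eigenbasis \<open>V\<close>, and \<open>c\<close> bounds its squared operator distance from the
  block matrix.\<close>

locale perturbed_blocks =
  fixes n k :: nat and \<theta> :: "nat \<Rightarrow> nat" and B :: "nat \<Rightarrow> nat \<Rightarrow> real" and s :: real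
    and M V :: "nat \<Rightarrow> nat \<Rightarrow> real" and \<mu> :: "nat \<Rightarrow> real" and c :: real
  assumes k: "0 < k"
    and lab: "\<And>i. i < n \<Longrightarrow> \<theta> i < k"
    and nonempty: "\<And>j. j < k \<Longrightarrow> \<exists>i<n. \<theta> i = j"
    and symB: "\<And>i j. i < k \<Longrightarrow> j < k \<Longrightarrow> B i j = B j i"
    and rank: "full_rank k B" and lam: "0 < lambda_min k B" and s: "0 < s"
    and orth: "orthonormal_cols n n V"
    and eig: "\<And>a i. a < n \<Longrightarrow> i < n \<Longrightarrow> mv n M (\<lambda>j. V j a) i = \<mu> a * V i a"
    and top: "\<And>a b. a < k \<Longrightarrow> k \<le> b \<Longrightarrow> b < n \<Longrightarrow> \<bar>\<mu> b\<bar> \<le> \<bar>\<mu> a\<bar>"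
    and err: "op_bound n (\<lambda>i j. M i j - s * B (\<theta> i) (\<theta> j)) c"
begin

abbreviation N :: "nat \<Rightarrow> real" where "N \<equiv> csize n \<theta>"

abbreviation coord :: "nat \<Rightarrow> (nat \<Rightarrow> real) \<Rightarrow> real" where "coord b x \<equiv> dot n (\<lambda>i. V i b) x"

text \<open>Four times the squared ratio of perturbation to spectral gap. It bounds the share of a
  community-wise constant vector lying outside the leading eigenspace.\<close>

definition \<rho> :: real where "\<rho> = 4 * c / (s * real (n_min n k \<theta>) * lambda_min k B)\<^sup>2"

lemma N_pos: "j < k \<Longrightarrow> 0 < card (comm n \<theta> j)"
  using nonempty by (auto simp: card_gt_0_iff comm_def)

lemma n_min_le: "j < k \<Longrightarrow> real (n_min n k \<theta>) \<le> N j"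
  unfolding n_min_def of_nat_le_iff by (intro Min_le) auto

lemma n_min_pos: "0 < n_min n k \<theta>"
  unfolding n_min_def using k N_pos by (subst Min_gr_iff) auto

lemma k_le_n: "k \<le> n"
proof -
  have "{..<k} \<subseteq> \<theta> ` {..<n}" using nonempty by force
  then have "card {..<k} \<le> card (\<theta> ` {..<n})" by (intro card_mono) auto
  also have "\<dots> \<le> card {..<n}" by (rule card_image_le) simp
  finally show ?thesis by simp
qed

lemma VV: "a < n \<Longrightarrow> b < n \<Longrightarrow> coord a (\<lambda>i. V i b) = (if a = b then 1 else 0)"
  using orth by (auto simp: orthonormal_cols_def dot_def)

lemma c_nonneg: "0 \<le> c"
proof -
  let ?e = "\<lambda>i. if i = 0 then 1 else 0 :: real"
  have "0 \<le> c * dot n ?e ?e" using err dot_nonneg unfolding op_bound_def by (meson order_trans)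
  also have "dot n ?e ?e = 1"
    using k k_le_n by (simp add: dot_def if_distrib cong: if_cong)
  finally show ?thesis by simp
qed

lemma blocks_mv:
  "mv n (\<lambda>i j. s * B (\<theta> i) (\<theta> j)) y i = s * (\<Sum>j<k. B (\<theta> i) j * (\<Sum>l\<in>comm n \<theta> j. y l))"
proof -
  have "mv n (\<lambda>i j. s * B (\<theta> i) (\<theta> j)) y i = (\<Sum>j<k. \<Sum>l\<in>comm n \<theta> j. s * B (\<theta> i) (\<theta> l) * y l)"
    unfolding mv_def by (rule sum_by_comm[of n \<theta> k, OF lab])
  also have "\<dots> = (\<Sum>j<k. \<Sum>l\<in>comm n \<theta> j. s * B (\<theta> i) j * y l)"
    by (intro sum.cong refl) (auto simp: comm_def)
  finally show ?thesis by (simp add: sum_distrib_left mult.assoc)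
qed

text \<open>Weyl's inequality in the needed case: the span of \<open>k + 1\<close> eigenvectors meets the kernel of the
  rank \<open>k\<close> block matrix.\<close>
lemma tail_eigenvalue_le:
  assumes b: "k \<le> b" "b < n"
  shows "(\<mu> b)\<^sup>2 \<le> c"
proof -
  \<comment> \<open>The k leading indices together with \<open>b\<close>: every eigenvalue in this
    list is at least as large as \<open>\<mu> b\<close> in absolute value.\<close>
  define idx where "idx = (\<lambda>a. if a < k then a else b)"
  have idx: "idx a < n" "\<bar>\<mu> b\<bar> \<le> \<bar>\<mu> (idx a)\<bar>" if "a \<le> k" for a
    using that b k_le_n top by (auto simp: idx_def)
  have idx_inj: "idx a = idx a' \<longleftrightarrow> a = a'" if "a \<le> k" "a' \<le> k" for a a'
    using that b by (auto simp: idx_def)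
  \<comment> \<open>k equations for k + 1 coefficients: the combination sums to 0 over every
    community, so the block matrix annihilates it.\<close>
  obtain t where t: "\<exists>a\<le>k. t a \<noteq> 0" "\<forall>j<k. (\<Sum>a\<le>k. (\<Sum>l\<in>comm n \<theta> j. V l (idx a)) * t a) = 0"
    using underdetermined[of k "\<lambda>j a. \<Sum>l\<in>comm n \<theta> j. V l (idx a)"] by auto
  define v where "v = (\<lambda>i. \<Sum>a\<le>k. t a * V i (idx a))"
  have norm: "dot n (\<lambda>i. \<Sum>a\<le>k. u a * V i (idx a)) (\<lambda>i. \<Sum>a\<le>k. u a * V i (idx a)) = (\<Sum>a\<le>k. (u a)\<^sup>2)"
    for u :: "nat \<Rightarrow> real"
  proof -
    have "(\<Sum>a'\<le>k. u a' * coord (idx a) (\<lambda>i. V i (idx a'))) = (\<Sum>a'\<le>k. if a' = a then u a else 0)"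
      if "a \<le> k" for a
      using that idx(1) by (intro sum.cong) (auto simp: VV idx_inj)
    then show ?thesis by (simp add: dot_sum_left dot_sum_right power2_eq_square)
  qed
  have "(\<Sum>l\<in>comm n \<theta> j. v l) = 0" if "j < k" for j
    unfolding v_def using t(2) that by (subst sum.swap) (simp add: sum_distrib_left[symmetric] mult.commute)
  then have Pv: "mv n (\<lambda>i j. s * B (\<theta> i) (\<theta> j)) v i = 0" for i by (simp add: blocks_mv)
  have Mv: "mv n M v i = (\<Sum>a\<le>k. (t a * \<mu> (idx a)) * V i (idx a))" if "i < n" for i
    unfolding v_def mv_sum using that idx(1) eig by (intro sum.cong) (auto simp: mult.assoc)
  have "(\<mu> b)\<^sup>2 * (\<Sum>a\<le>k. (t a)\<^sup>2) \<le> (\<Sum>a\<le>k. (t a * \<mu> (idx a))\<^sup>2)"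
    unfolding sum_distrib_left power_mult_distrib
  proof (rule sum_mono)
    fix a assume "a \<in> {..k}"
    then have "(\<mu> b)\<^sup>2 \<le> (\<mu> (idx a))\<^sup>2" using idx(2) by (simp add: abs_le_square_iff)
    then show "(\<mu> b)\<^sup>2 * (t a)\<^sup>2 \<le> (t a)\<^sup>2 * (\<mu> (idx a))\<^sup>2"
      by (subst mult.commute) (auto intro: mult_left_mono)
  qed
  also have "\<dots> = dot n (mv n (\<lambda>i j. M i j - s * B (\<theta> i) (\<theta> j)) v) (mv n (\<lambda>i j. M i j - s * B (\<theta> i) (\<theta> j)) v)"
    unfolding norm[symmetric] by (intro dot_cong) (simp_all add: mv_matrix_diff Pv Mv)
  also have "\<dots> \<le> c * dot n v v" using err by (simp add: op_bound_def)
  also have "dot n v v = (\<Sum>a\<le>k. (t a)\<^sup>2)" unfolding v_def by (rule norm)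
  finally show ?thesis
  proof (rule mult_right_le_imp_le)
    obtain a where "a \<le> k" "t a \<noteq> 0" using t(1) by auto
    then show "0 < (\<Sum>a\<le>k. (t a)\<^sup>2)" by (intro sum_pos2[of _ a]) auto
  qed
qed

lemma coord_mv: "b < n \<Longrightarrow> coord b (mv n M y) = \<mu> b * coord b y"
proof -
  assume b: "b < n"
  have y: "mv n M y i = mv n M (\<lambda>i. \<Sum>a<n. coord a y * V i a) i" for i
    unfolding mv_def using orthonormal_expansion[OF orth, of _ y] by (intro sum.cong) auto
  have "mv n M y i = (\<Sum>a<n. (coord a y * \<mu> a) * V i a)" if "i < n" for i
    unfolding y mv_sum using eig that by (intro sum.cong) auto
  then have "coord b (mv n M y) = coord b (\<lambda>i. \<Sum>a<n. (coord a y * \<mu> a) * V i a)"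
    by (intro dot_cong) auto
  also have "\<dots> = (\<Sum>a<n. if a = b then coord b y * \<mu> b else 0)"
    unfolding dot_sum_right using b by (intro sum.cong) (auto simp: VV)
  finally show ?thesis using b by simp
qed

text \<open>A Davis-Kahan bound: with \<open>x = P y\<close>, the tail part of \<open>x\<close> is that of \<open>M y\<close>
  minus that of \<open>(M - P) y\<close>.\<close>
lemma tail_of_block_vector:
  "(\<Sum>b\<in>{k..<n}. (coord b (\<lambda>i. a (\<theta> i)))\<^sup>2) \<le> \<rho> * (\<Sum>j<k. N j * (a j)\<^sup>2)"
proof -
  let ?P = "\<lambda>i j. s * B (\<theta> i) (\<theta> j)" and ?m = "real (n_min n k \<theta>)" and ?l = "lambda_min k B"
  obtain w where w: "\<And>j. j < k \<Longrightarrow> mv k B w j = a j"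
    using full_rank_surj[OF rank] by blast
  \<comment> \<open>With \<open>w\<close> the preimage of \<open>a\<close> under \<open>B\<close>,
    the community sums of \<open>y\<close> are w / s, which makes \<open>y\<close> a preimage of the
    block vector.\<close>
  define y where "y = (\<lambda>i. w (\<theta> i) / (s * N (\<theta> i)))"
  have "(\<Sum>l\<in>comm n \<theta> j. y l) = w j / s" if "j < k" for j
  proof -
    have "(\<Sum>l\<in>comm n \<theta> j. y l) = (\<Sum>l\<in>comm n \<theta> j. w j / (s * N j))"
      by (intro sum.cong) (auto simp: y_def comm_def)
    then show ?thesis using N_pos[OF that] by (simp add: card_gt_0_iff)
  qed
  then have Py: "mv n ?P y i = a (\<theta> i)" if "i < n" for i
    unfolding blocks_mv using s w[OF lab[OF that]] by (simp add: mv_def sum_divide_distrib[symmetric])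
  let ?e = "mv n (\<lambda>i j. M i j - ?P i j) y"
  have tail: "(coord b (\<lambda>i. a (\<theta> i)))\<^sup>2 \<le> 2 * (c * (coord b y)\<^sup>2) + 2 * (coord b ?e)\<^sup>2"
    if b: "b \<in> {k..<n}" for b
  proof -
    have "coord b (\<lambda>i. a (\<theta> i)) = coord b (\<lambda>i. mv n M y i - ?e i)"
      by (intro dot_cong) (auto simp: mv_matrix_diff Py)
    also have "\<dots> = \<mu> b * coord b y - coord b ?e" using b by (simp add: dot_diff_right coord_mv)
    finally have eq: "coord b (\<lambda>i. a (\<theta> i)) = \<mu> b * coord b y - coord b ?e" .
    have "(\<mu> b * coord b y - coord b ?e)\<^sup>2 \<le> 2 * (\<mu> b * coord b y)\<^sup>2 + 2 * (coord b ?e)\<^sup>2"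
      using zero_le_power2[of "\<mu> b * coord b y + coord b ?e"]
      by (simp add: power2_sum power2_diff)
    also have "(\<mu> b * coord b y)\<^sup>2 \<le> c * (coord b y)\<^sup>2"
      unfolding power_mult_distrib using b by (intro mult_right_mono tail_eigenvalue_le) auto
    finally show ?thesis by (simp add: eq)
  qed
  have part: "(\<Sum>b\<in>{k..<n}. (coord b x)\<^sup>2) \<le> dot n x x" for x
  proof -
    have "(\<Sum>b\<in>{k..<n}. (coord b x)\<^sup>2) \<le> (\<Sum>b<n. (coord b x)\<^sup>2)" by (intro sum_mono2) auto
    then show ?thesis by (simp add: orthonormal_Parseval[OF orth, of x x] power2_eq_square)
  qed
  have "(\<Sum>b\<in>{k..<n}. (coord b (\<lambda>i. a (\<theta> i)))\<^sup>2)
     \<le> 2 * (c * (\<Sum>b\<in>{k..<n}. (coord b y)\<^sup>2)) + 2 * (\<Sum>b\<in>{k..<n}. (coord b ?e)\<^sup>2)"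
    using sum_mono[of "{k..<n}", OF tail] by (simp add: sum.distrib sum_distrib_left)
  also have "\<dots> \<le> 2 * (c * dot n y y) + 2 * (c * dot n y y)"
  proof -
    have "dot n ?e ?e \<le> c * dot n y y" using err by (simp add: op_bound_def)
    moreover have "c * (\<Sum>b\<in>{k..<n}. (coord b y)\<^sup>2) \<le> c * dot n y y"
      by (intro mult_left_mono part c_nonneg)
    ultimately show ?thesis using part[of ?e] by linarith
  qed
  finally have bound: "(\<Sum>b\<in>{k..<n}. (coord b (\<lambda>i. a (\<theta> i)))\<^sup>2) \<le> 4 * (c * dot n y y)" by simp
  have m: "0 < ?m" using n_min_pos by simp
  have ww: "?l\<^sup>2 * (\<Sum>j<k. (w j)\<^sup>2) \<le> (\<Sum>j<k. (a j)\<^sup>2)"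
    using symmetric_lower_bound[of k B w, OF k symB] lam w by (simp add: dot_def power2_eq_square)
  \<comment> \<open>The smallest community size enters twice: here to bound 1 / N j, and at the end
    to pass from the sum of a^2 to the weighted sum. This is why its square appears in
    \<open>\<rho>\<close>.\<close>
  have "dot n y y = (\<Sum>j<k. N j * (w j / (s * N j))\<^sup>2)"
    using sum_labels[of n \<theta> k, OF lab, where F = "\<lambda>j. (w j / (s * N j))\<^sup>2"] by (simp add: dot_def y_def power2_eq_square)
  also have "\<dots> \<le> (\<Sum>j<k. (w j)\<^sup>2 / (s\<^sup>2 * ?m))"
  proof (rule sum_mono)
    fix j assume j: "j \<in> {..<k}"
    have "N j * (w j / (s * N j))\<^sup>2 = (w j)\<^sup>2 / (s\<^sup>2 * N j)"
      using N_pos[of j] j s by (simp add: power2_eq_square field_simps)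
    also have "\<dots> \<le> (w j)\<^sup>2 / (s\<^sup>2 * ?m)"
      using n_min_le[of j] j m s by (intro divide_left_mono mult_left_mono mult_pos_pos) auto
    finally show "N j * (w j / (s * N j))\<^sup>2 \<le> (w j)\<^sup>2 / (s\<^sup>2 * ?m)" .
  qed
  also have "\<dots> = (?l\<^sup>2 * (\<Sum>j<k. (w j)\<^sup>2)) / (s\<^sup>2 * ?m * ?l\<^sup>2)"
    using lam by (simp add: sum_divide_distrib[symmetric])
  also have "\<dots> \<le> (\<Sum>j<k. (a j)\<^sup>2) / (s\<^sup>2 * ?m * ?l\<^sup>2)"
    using m by (intro divide_right_mono ww) auto
  also have "\<dots> = (\<Sum>j<k. ?m * (a j)\<^sup>2) / (s * ?m * ?l)\<^sup>2"
    using m by (simp add: sum_distrib_left[symmetric] power_mult_distrib power2_eq_square)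
  also have "\<dots> \<le> (\<Sum>j<k. N j * (a j)\<^sup>2) / (s * ?m * ?l)\<^sup>2"
    by (intro divide_right_mono sum_mono mult_right_mono n_min_le) auto
  finally have yy: "dot n y y \<le> (\<Sum>j<k. N j * (a j)\<^sup>2) / (s * ?m * ?l)\<^sup>2" .
  have "4 * (c * dot n y y) \<le> 4 * (c * ((\<Sum>j<k. N j * (a j)\<^sup>2) / (s * ?m * ?l)\<^sup>2))"
    by (intro mult_left_mono yy c_nonneg) auto
  with bound show ?thesis by (simp add: \<rho>_def)
qed

text \<open>The mean over community \<open>j\<close> of the entries of eigenvector \<open>b\<close>;
  for b < k these are the cluster means of the embedded vertices.\<close>

definition ctr :: "nat \<Rightarrow> nat \<Rightarrow> real" where
  "ctr j b = coord b (\<lambda>i. if \<theta> i = j then 1 else 0) / N j"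

lemma coord_indicator: "coord b (\<lambda>i. if \<theta> i = j then 1 else 0) = (\<Sum>i\<in>comm n \<theta> j. V i b)"
  unfolding dot_def comm_def by (simp add: if_distrib sum.inter_filter[symmetric] cong: if_cong)

text \<open>The cost is the total squared distance of the k leading eigenvectors from the
  community-wise constant vectors. Both spaces have dimension k, so exchanging sums turns it into
  the distance of the k normalised indicators from the leading eigenspace, at most
  \<open>\<rho>\<close> for each.\<close>

lemma ctr_cost: "km_cost n k V \<theta> ctr \<le> real k * \<rho>"
proof -
  have N: "N j \<noteq> 0" if "j < k" for j using N_pos[OF that] by (simp add: card_gt_0_iff)
  have col: "(\<Sum>i<n. (ctr (\<theta> i) b - V i b)\<^sup>2) = 1 - (\<Sum>j<k. N j * (ctr j b)\<^sup>2)" if b: "b < k" for b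
  proof -
    have "(\<Sum>i<n. ctr (\<theta> i) b * V i b) = (\<Sum>j<k. \<Sum>i\<in>comm n \<theta> j. ctr (\<theta> i) b * V i b)"
      by (rule sum_by_comm[of n \<theta> k, OF lab])
    also have "\<dots> = (\<Sum>j<k. \<Sum>i\<in>comm n \<theta> j. ctr j b * V i b)"
      by (intro sum.cong refl) (auto simp: comm_def)
    also have "\<dots> = (\<Sum>j<k. N j * (ctr j b)\<^sup>2)"
    proof (rule sum.cong[OF refl])
      fix j assume "j \<in> {..<k}"
      then have "coord b (\<lambda>i. if \<theta> i = j then 1 else 0) = N j * ctr j b"
        using N[of j] by (simp add: ctr_def)
      then show "(\<Sum>i\<in>comm n \<theta> j. ctr j b * V i b) = N j * (ctr j b)\<^sup>2"
        by (simp add: sum_distrib_left[symmetric] coord_indicator power2_eq_square)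
    qed
    finally have cross: "(\<Sum>i<n. ctr (\<theta> i) b * V i b) = (\<Sum>j<k. N j * (ctr j b)\<^sup>2)" .
    have "(\<Sum>i<n. (ctr (\<theta> i) b - V i b)\<^sup>2)
       = (\<Sum>i<n. (ctr (\<theta> i) b)\<^sup>2) - 2 * (\<Sum>i<n. ctr (\<theta> i) b * V i b) + coord b (\<lambda>i. V i b)"
      by (simp add: dot_def power2_eq_square algebra_simps sum.distrib sum_subtractf sum_distrib_left)
    also have "(\<Sum>i<n. (ctr (\<theta> i) b)\<^sup>2) = (\<Sum>j<k. N j * (ctr j b)\<^sup>2)"
      by (rule sum_labels[of n \<theta> k, OF lab])
    also have "coord b (\<lambda>i. V i b) = 1" using b k_le_n by (simp add: VV)
    finally show ?thesis unfolding cross by simp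
  qed
  have row: "1 - (\<Sum>b<k. N j * (ctr j b)\<^sup>2) \<le> \<rho>" if j: "j < k" for j
  proof -
    let ?d = "\<lambda>i. if \<theta> i = j then 1 else 0 :: real"
    have "N j = dot n ?d ?d"
      by (simp add: dot_def comm_def if_distrib sum.inter_filter[symmetric] cong: if_cong)
    also have "\<dots> = (\<Sum>b\<in>{..<k} \<union> {k..<n}. (coord b ?d)\<^sup>2)"
      using k_le_n by (simp add: orthonormal_Parseval[OF orth, of ?d ?d] power2_eq_square ivl_disj_un)
    also have "\<dots> = (\<Sum>b<k. (coord b ?d)\<^sup>2) + (\<Sum>b\<in>{k..<n}. (coord b ?d)\<^sup>2)"
      by (rule sum.union_disjoint) auto
    also have "(\<Sum>b\<in>{k..<n}. (coord b ?d)\<^sup>2) \<le> \<rho> * (\<Sum>l<k. N l * (if l = j then 1 else 0)\<^sup>2)"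
      using tail_of_block_vector[of "\<lambda>l. if l = j then 1 else 0"] by simp
    also have "(\<Sum>l<k. N l * (if l = j then 1 else 0)\<^sup>2) = (\<Sum>l<k. if l = j then N l else 0)"
      by (intro sum.cong) auto
    also have "\<dots> = N j" using j by simp
    also have "(\<Sum>b<k. (coord b ?d)\<^sup>2) = N j * (\<Sum>b<k. N j * (ctr j b)\<^sup>2)"
      using N[OF j] by (simp add: ctr_def sum_distrib_left power2_eq_square)
    finally have "N j * 1 \<le> N j * ((\<Sum>b<k. N j * (ctr j b)\<^sup>2) + \<rho>)" by (simp add: algebra_simps)
    then have "1 \<le> (\<Sum>b<k. N j * (ctr j b)\<^sup>2) + \<rho>"
      using N_pos[OF j] by (simp only: mult_le_cancel_left_pos of_nat_0_less_iff)
    then show ?thesis by linarith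
  qed
  have "km_cost n k V \<theta> ctr = (\<Sum>b<k. \<Sum>i<n. (ctr (\<theta> i) b - V i b)\<^sup>2)"
    unfolding km_cost_def by (rule sum.swap)
  also have "\<dots> = (\<Sum>b<k. 1 - (\<Sum>j<k. N j * (ctr j b)\<^sup>2))" by (intro sum.cong) (auto simp: col)
  also have "\<dots> = real k - (\<Sum>b<k. \<Sum>j<k. N j * (ctr j b)\<^sup>2)" by (simp add: sum_subtractf)
  also have "(\<Sum>b<k. \<Sum>j<k. N j * (ctr j b)\<^sup>2) = (\<Sum>j<k. \<Sum>b<k. N j * (ctr j b)\<^sup>2)" by (rule sum.swap)
  also have "real k - \<dots> = (\<Sum>j<k. 1 - (\<Sum>b<k. N j * (ctr j b)\<^sup>2))" by (simp add: sum_subtractf)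
  also have "\<dots> \<le> (\<Sum>j<k. \<rho>)" by (intro sum_mono row) auto
  finally show ?thesis by simp
qed

text \<open>The difference of two normalised indicators has squared norm 1/N j + 1/N l, its leading
  coordinates are the differences of the centers, and at most a share \<open>\<rho>\<close> is lost
  in the tail.\<close>

lemma ctr_separation:
  assumes j: "j < k" and l: "l < k" and "j \<noteq> l"
  shows "(1 - \<rho>) * (1 / N j + 1 / N l) \<le> (\<Sum>b<k. (ctr j b - ctr l b)\<^sup>2)"
proof -
  define a where "a = (\<lambda>m. (if m = j then 1 / N j else 0) - (if m = l then 1 / N l else 0))"
  let ?x = "\<lambda>i. a (\<theta> i)"
  have na: "(\<Sum>m<k. N m * (a m)\<^sup>2) = 1 / N j + 1 / N l"
  proof -
    have "(\<Sum>m<k. N m * (a m)\<^sup>2) = (\<Sum>m<k. (if m = j then 1 / N j else 0) + (if m = l then 1 / N l else 0))"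
      using assms(3) N_pos[OF j] N_pos[OF l] by (intro sum.cong) (auto simp: a_def power2_eq_square)
    then show ?thesis using j l by (simp add: sum.distrib)
  qed
  have ca: "coord b ?x = ctr j b - ctr l b" for b
  proof -
    have "coord b ?x = coord b (\<lambda>i. 1 / N j * (if \<theta> i = j then 1 else 0) - 1 / N l * (if \<theta> i = l then 1 else 0))"
      by (intro dot_cong) (auto simp: a_def)
    then show ?thesis by (simp only: dot_diff_right dot_scale_right ctr_def) simp
  qed
  have "1 / N j + 1 / N l = dot n ?x ?x"
    unfolding na[symmetric] dot_def power2_eq_square
    by (rule sum_labels[of n \<theta> k, OF lab, where F = "\<lambda>m. a m * a m", symmetric])
  also have "\<dots> = (\<Sum>b\<in>{..<k} \<union> {k..<n}. (coord b ?x)\<^sup>2)"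
    using k_le_n by (simp add: orthonormal_Parseval[OF orth, of ?x ?x] power2_eq_square ivl_disj_un)
  also have "\<dots> = (\<Sum>b<k. (coord b ?x)\<^sup>2) + (\<Sum>b\<in>{k..<n}. (coord b ?x)\<^sup>2)"
    by (rule sum.union_disjoint) auto
  also have "\<dots> \<le> (\<Sum>b<k. (coord b ?x)\<^sup>2) + \<rho> * (1 / N j + 1 / N l)"
    using tail_of_block_vector[of a] by (simp add: na)
  finally show ?thesis by (simp add: ca algebra_simps)
qed

end

section \<open>Approximate k-means\<close>

lemma sum_square_diff_le:
  fixes x y z :: "nat \<Rightarrow> real"
  shows "(\<Sum>b<k. (x b - z b)\<^sup>2) \<le> 2 * (\<Sum>b<k. (x b - y b)\<^sup>2) + 2 * (\<Sum>b<k. (y b - z b)\<^sup>2)"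
  unfolding sum_distrib_left sum.distrib[symmetric]
proof (rule sum_mono)
  fix b
  show "(x b - z b)\<^sup>2 \<le> 2 * (x b - y b)\<^sup>2 + 2 * (y b - z b)\<^sup>2"
    using zero_le_power2[of "x b + z b - 2 * y b"] by (simp add: power2_eq_square algebra_simps)
qed

text \<open>Vertices whose estimated center is within \<open>\<Delta> / 8\<close> (in squared distance) of their true center
  get a label that determines their community.\<close>
lemma clustering:
  fixes X Xh :: "nat \<Rightarrow> nat \<Rightarrow> real" and \<Delta> :: "nat \<Rightarrow> real"
  assumes \<theta>: "\<And>i. i < n \<Longrightarrow> \<theta> i < k" and lab: "\<And>i. i < n \<Longrightarrow> lab i < k"
    and \<Delta>: "\<And>j. j < k \<Longrightarrow> 1 \<le> csize n \<theta> j * \<Delta> j" "\<And>j. j < k \<Longrightarrow> 0 \<le> \<Delta> j"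
    and sep: "\<And>j l. j < k \<Longrightarrow> l < k \<Longrightarrow> j \<noteq> l \<Longrightarrow> \<Delta> j / 2 \<le> (\<Sum>b<k. (X j b - X l b)\<^sup>2)"
    and E: "(\<Sum>i<n. \<Sum>b<k. (Xh (lab i) b - X (\<theta> i) b)\<^sup>2) \<le> E" "8 * E < 1"
  obtains \<sigma> S where "\<sigma> permutes {..<k}" "S \<subseteq> {..<n}" "(\<Sum>i\<in>S. \<Delta> (\<theta> i)) \<le> 8 * E"
    "\<And>i. i < n \<Longrightarrow> i \<notin> S \<Longrightarrow> \<sigma> (lab i) = \<theta> i"
proof -
  define err where "err = (\<lambda>i. \<Sum>b<k. (Xh (lab i) b - X (\<theta> i) b)\<^sup>2)"
  define S where "S = {i. i < n \<and> \<Delta> (\<theta> i) / 8 \<le> err i}"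
  have Sn: "S \<subseteq> {..<n}" by (auto simp: S_def)
  have err0: "0 \<le> err i" for i by (simp add: err_def sum_nonneg)
  have "(\<Sum>i\<in>S. \<Delta> (\<theta> i)) \<le> (\<Sum>i\<in>S. 8 * err i)" by (intro sum_mono) (auto simp: S_def)
  also have "\<dots> \<le> (\<Sum>i<n. 8 * err i)" using Sn err0 by (intro sum_mono2) auto
  also have "\<dots> \<le> 8 * E" using E(1) by (simp add: err_def sum_distrib_left[symmetric])
  finally have SE: "(\<Sum>i\<in>S. \<Delta> (\<theta> i)) \<le> 8 * E" .
  \<comment> \<open>A community inside \<open>S\<close> would alone contribute at least 1 to a sum
    that is at most 8 E < 1.\<close>
  have "\<exists>i<n. i \<notin> S \<and> \<theta> i = j" if j: "j < k" for j
  proof (rule ccontr)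
    assume "\<not> ?thesis"
    then have sub: "comm n \<theta> j \<subseteq> S" by (auto simp: comm_def)
    have "1 \<le> csize n \<theta> j * \<Delta> j" by (rule \<Delta>(1)[OF j])
    also have "\<dots> = (\<Sum>i\<in>comm n \<theta> j. \<Delta> j)" by simp
    also have "\<dots> = (\<Sum>i\<in>comm n \<theta> j. \<Delta> (\<theta> i))" by (intro sum.cong) (auto simp: comm_def)
    also have "\<dots> \<le> (\<Sum>i\<in>S. \<Delta> (\<theta> i))"
      using sub Sn \<Delta>(2) \<theta> by (intro sum_mono2 finite_subset[OF Sn]) auto
    finally show False using SE E(2) by linarith
  qed
  then obtain rep where rep: "\<And>j. j < k \<Longrightarrow> rep j < n \<and> rep j \<notin> S \<and> \<theta> (rep j) = j" by metis
  \<comment> \<open>A common label means a common estimated center. The true centers would then be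
    closer than the average of the two separation bounds allows.\<close>
  have same: "\<theta> i = \<theta> i'" if "i < n" "i' < n" "i \<notin> S" "i' \<notin> S" "lab i = lab i'" for i i'
  proof (rule ccontr)
    assume ne: "\<theta> i \<noteq> \<theta> i'"
    let ?D = "\<Sum>b<k. (X (\<theta> i) b - X (\<theta> i') b)\<^sup>2"
    have "?D \<le> 2 * (\<Sum>b<k. (X (\<theta> i) b - Xh (lab i) b)\<^sup>2) + 2 * (\<Sum>b<k. (Xh (lab i) b - X (\<theta> i') b)\<^sup>2)"
      by (rule sum_square_diff_le)
    also have "\<dots> = 2 * err i + 2 * err i'" using that(5) by (simp add: err_def power2_commute)
    also have "\<dots> < \<Delta> (\<theta> i) / 4 + \<Delta> (\<theta> i') / 4" using that by (auto simp: S_def)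
    also have "\<dots> \<le> ?D"
      using sep[of "\<theta> i" "\<theta> i'"] sep[of "\<theta> i'" "\<theta> i"] \<theta> that ne by (simp add: power2_commute)
    finally show False by simp
  qed
  \<comment> \<open>The label of one well-placed vertex per community. It is injective, hence a
    permutation of the labels, and \<open>\<sigma>\<close> is its inverse.\<close>
  define \<tau> where "\<tau> = (\<lambda>j. lab (rep j))"
  have inj: "inj_on \<tau> {..<k}"
  proof (rule inj_onI)
    fix j l assume "j \<in> {..<k}" "l \<in> {..<k}" "\<tau> j = \<tau> l"
    then show "j = l" using same[of "rep j" "rep l"] rep by (auto simp: \<tau>_def)
  qed
  have im: "\<tau> ` {..<k} = {..<k}"
    by (rule endo_inj_surj[OF _ _ inj]) (use rep lab in \<open>auto simp: \<tau>_def\<close>)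
  then have bij: "bij_betw \<tau> {..<k} {..<k}" using inj by (simp add: bij_betw_def)
  define \<sigma> where "\<sigma> = (\<lambda>m. if m < k then inv_into {..<k} \<tau> m else m)"
  have "bij_betw \<sigma> {..<k} {..<k}"
    using bij_betw_inv_into[OF bij] by (subst bij_betw_cong[where g = "inv_into {..<k} \<tau>"]) (auto simp: \<sigma>_def)
  then have perm: "\<sigma> permutes {..<k}" by (rule bij_imp_permutes) (auto simp: \<sigma>_def)
  have "\<sigma> (lab i) = \<theta> i" if i: "i < n" "i \<notin> S" for i
  proof -
    have "lab i \<in> \<tau> ` {..<k}" unfolding im using lab i by simp
    then obtain l where l: "l < k" "lab i = \<tau> l" by auto
    then have "\<theta> i = l" using same[of i "rep l"] rep[OF l(1)] i by (auto simp: \<tau>_def)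
    moreover have "\<sigma> (\<tau> l) = l" using l inj lab[OF i(1)] by (simp add: \<sigma>_def inv_into_f_f)
    ultimately show ?thesis by (simp add: l)
  qed
  with perm Sn SE show ?thesis by (rule that)
qed

text \<open>Two communities occupy different positions in the sorted list, so the smaller one is at
  position k - 2 or before.\<close>

lemma min_le_n_max2:
  assumes "j < k" "l < k" "j \<noteq> l"
  shows "min (card (comm n \<theta> j)) (card (comm n \<theta> l)) \<le> n_max2 n k \<theta>"
proof -
  define xs where "xs = map (\<lambda>j. card (comm n \<theta> j)) [0..<k]"
  have k2: "2 \<le> k" using assms by linarith
  have len: "length (sort xs) = k" by (simp add: xs_def)
  obtain f where f: "bij_betw f {..<length xs} {..<length (sort xs)}" "\<forall>i<length xs. xs ! i = sort xs ! f i"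
    using permutation_Ex_bij[of xs "sort xs"] by auto
  have lx: "length xs = k" by (simp add: xs_def)
  have fr: "f j < k" "f l < k" "f j \<noteq> f l"
    using f(1) assms unfolding lx len by (auto simp: bij_betw_def inj_on_def)
  have "min (sort xs ! a) (sort xs ! b) \<le> sort xs ! (k - 2)" if "a < b" "b < k" for a b
  proof -
    have "sort xs ! a \<le> sort xs ! (k - 2)" by (rule sorted_nth_mono) (use that len in auto)
    then show ?thesis by simp
  qed
  then have "min (sort xs ! f j) (sort xs ! f l) \<le> sort xs ! (k - 2)"
    using fr by (metis linorder_neqE_nat min.commute)
  moreover have "rev (sort xs) ! 1 = sort xs ! (k - 2)"
    using k2 len by (simp add: rev_nth numeral_2_eq_2)
  moreover have "xs ! j = card (comm n \<theta> j)" "xs ! l = card (comm n \<theta> l)"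
    using assms by (simp_all add: xs_def)
  ultimately show ?thesis
    using k2 f(2) assms lx by (simp add: n_max2_def xs_def[symmetric])
qed

context perturbed_blocks
begin

lemma km_inf_le: "(INF p \<in> {p. labeling n k (fst p)}. km_cost n k U (fst p) (snd p)) \<le> km_cost n k U \<theta> X"
proof -
  have "(INF p \<in> {p. labeling n k (fst p)}. km_cost n k U (fst p) (snd p)) \<le> km_cost n k U (fst (\<theta>, X)) (snd (\<theta>, X))"
  proof (rule cINF_lower)
    show "bdd_below ((\<lambda>p. km_cost n k U (fst p) (snd p)) ` {p. labeling n k (fst p)})"
      by (rule bdd_belowI2[where m = 0]) (simp add: km_cost_def sum_nonneg)
  qed (simp add: labeling_def lab)
  then show ?thesis by simp
qed

lemma approx_kmeans_misclassification:
  assumes UV: "\<And>i a. i < n \<Longrightarrow> a < k \<Longrightarrow> U i a = V i a"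
    and km: "approx_kmeans n k \<gamma> U \<theta>h" and \<gamma>: "0 \<le> \<gamma>"
    and small: "16 * (2 + \<gamma>) * real k * \<rho> < 1"
  shows "Ltil n k \<theta> \<theta>h \<le> 16 * (2 + \<gamma>) * real k * \<rho>
    \<and> Lmis n k \<theta> \<theta>h \<le> 16 * (2 + \<gamma>) * real k * \<rho> * real (n_max2 n k \<theta>) / real n"
proof -
  \<comment> \<open>Approximate cost plus comparison cost gives an error of at most 2 (1 + \<gamma>)
    + 2 = 2 (2 + \<gamma>) times k \<open>\<rho>\<close>, which is R / 8, and
    \<open>clustering\<close> multiplies by 8.\<close>
  define R where "R = 16 * (2 + \<gamma>) * real k * \<rho>"
  have cost_UV: "km_cost n k U f X = km_cost n k V f X" for f X
    unfolding km_cost_def using UV by (intro sum.cong) auto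
  obtain Xh where lab_h: "labeling n k \<theta>h"
    and Xh: "km_cost n k U \<theta>h Xh \<le> (1 + \<gamma>) * (INF p \<in> {p. labeling n k (fst p)}. km_cost n k U (fst p) (snd p))"
    using km unfolding approx_kmeans_def by blast
  note Xh
  also have "(1 + \<gamma>) * (INF p \<in> {p. labeling n k (fst p)}. km_cost n k U (fst p) (snd p)) \<le> (1 + \<gamma>) * (real k * \<rho>)"
    using \<gamma> order_trans[OF km_inf_le[of U ctr]] ctr_cost by (intro mult_left_mono) (auto simp: cost_UV)
  finally have cost_h: "km_cost n k V \<theta>h Xh \<le> (1 + \<gamma>) * (real k * \<rho>)" by (simp add: cost_UV)
  have "(\<Sum>i<n. \<Sum>b<k. (Xh (\<theta>h i) b - ctr (\<theta> i) b)\<^sup>2)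
     \<le> (\<Sum>i<n. 2 * (\<Sum>b<k. (Xh (\<theta>h i) b - V i b)\<^sup>2) + 2 * (\<Sum>b<k. (V i b - ctr (\<theta> i) b)\<^sup>2))"
    by (intro sum_mono sum_square_diff_le)
  also have "\<dots> = 2 * km_cost n k V \<theta>h Xh + 2 * km_cost n k V \<theta> ctr"
    unfolding km_cost_def by (simp add: sum.distrib sum_distrib_left[symmetric] power2_commute)
  also have "\<dots> \<le> 2 * ((1 + \<gamma>) * (real k * \<rho>)) + 2 * (real k * \<rho>)"
    by (intro add_mono mult_left_mono cost_h ctr_cost) auto
  also have "\<dots> = R / 8" by (simp add: R_def algebra_simps)
  finally have err: "(\<Sum>i<n. \<Sum>b<k. (Xh (\<theta>h i) b - ctr (\<theta> i) b)\<^sup>2) \<le> R / 8" .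
  \<comment> \<open>The first entry measures errors relative to each community, for
    \<open>Ltil\<close>; the second counts them uniformly, for \<open>Lmis\<close>. Both fit under
    the separation because one of any two communities has size at most
    \<open>n_max2\<close>.\<close>
  define \<Delta> where "\<Delta> = (\<lambda>j. max (1 / N j) (1 / real (n_max2 n k \<theta>)))"
  have \<rho>0: "0 \<le> \<rho>" using c_nonneg by (simp add: \<rho>_def)
  have "32 * \<rho> \<le> 16 * (2 + \<gamma>) * real k * \<rho>"
  proof (rule mult_right_mono[OF _ \<rho>0])
    have "16 * 2 * 1 \<le> 16 * (2 + \<gamma>) * real k" using k \<gamma> by (intro mult_mono) auto
    then show "32 \<le> 16 * (2 + \<gamma>) * real k" by simp
  qed
  with small have \<rho>2: "1 / 2 \<le> 1 - \<rho>" by linarith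
  have Npos: "0 < N j" if "j < k" for j using N_pos[OF that] by (simp add: card_gt_0_iff)
  have max2: "1 / real (n_max2 n k \<theta>) \<le> 1 / N j + 1 / N l" "0 < n_max2 n k \<theta>"
    if "j < k" "l < k" "j \<noteq> l" for j l
  proof -
    have m: "min (card (comm n \<theta> j)) (card (comm n \<theta> l)) \<le> n_max2 n k \<theta>" by (rule min_le_n_max2) fact+
    then show "0 < n_max2 n k \<theta>" using N_pos[OF that(1)] N_pos[OF that(2)] by linarith
    from m have "real (min (card (comm n \<theta> j)) (card (comm n \<theta> l))) \<le> real (n_max2 n k \<theta>)" by (simp only: of_nat_le_iff)
    then have "min (N j) (N l) \<le> real (n_max2 n k \<theta>)" by (simp add: of_nat_min)
    then have "1 / real (n_max2 n k \<theta>) \<le> 1 / min (N j) (N l)"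
      using Npos[OF that(1)] Npos[OF that(2)] by (intro divide_left_mono mult_pos_pos) auto
    also have "\<dots> \<le> 1 / N j + 1 / N l" by (auto simp: min_def)
    finally show "1 / real (n_max2 n k \<theta>) \<le> 1 / N j + 1 / N l" .
  qed
  have \<theta>h: "\<theta>h i < k" if "i < n" for i using lab_h that by (simp add: labeling_def)
  have d1: "1 \<le> N j * \<Delta> j" if "j < k" for j
  proof -
    have "1 = N j * (1 / N j)" using Npos[OF that] by (simp add: card_gt_0_iff)
    also have "\<dots> \<le> N j * \<Delta> j" unfolding \<Delta>_def by (intro mult_left_mono) auto
    finally show ?thesis .
  qed
  have d0: "0 \<le> \<Delta> j" for j by (simp add: \<Delta>_def le_max_iff_disj)
  have sep: "\<Delta> j / 2 \<le> (\<Sum>b<k. (ctr j b - ctr l b)\<^sup>2)" if "j < k" "l < k" "j \<noteq> l" for j l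
  proof -
    have "\<Delta> j / 2 \<le> 1 / 2 * (1 / N j + 1 / N l)"
      using max2(1)[OF that] by (auto simp: \<Delta>_def max_def)
    also have "\<dots> \<le> (1 - \<rho>) * (1 / N j + 1 / N l)" by (intro mult_right_mono \<rho>2) auto
    also have "\<dots> \<le> (\<Sum>b<k. (ctr j b - ctr l b)\<^sup>2)" by (rule ctr_separation) fact+
    finally show ?thesis .
  qed
  have small': "8 * (R / 8) < 1" using small by (simp add: R_def)
  obtain \<sigma> S where S: "\<sigma> permutes {..<k}" "S \<subseteq> {..<n}" "(\<Sum>i\<in>S. \<Delta> (\<theta> i)) \<le> 8 * (R / 8)"
    "\<And>i. i < n \<Longrightarrow> i \<notin> S \<Longrightarrow> \<sigma> (\<theta>h i) = \<theta> i"
    using clustering[OF lab \<theta>h d1 d0 sep err small'] by blast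
  have finS: "finite S" using S(2) finite_subset by blast
  have fin: "finite {\<sigma>. \<sigma> permutes {..<k}}" by (rule finite_permutations) simp
  have "Ltil n k \<theta> \<theta>h \<le> R"
    unfolding Ltil_def
  proof (subst Max_le_iff)
    show "\<forall>a\<in>(\<lambda>j. Min ((\<lambda>\<sigma>. real (card {i \<in> comm n \<theta> j. \<sigma> (\<theta>h i) \<noteq> j}) / N j) ` {\<sigma>. \<sigma> permutes {..<k}})) ` {..<k}. a \<le> R"
    proof safe
      fix j assume j: "j < k"
      have "Min ((\<lambda>\<sigma>. real (card {i \<in> comm n \<theta> j. \<sigma> (\<theta>h i) \<noteq> j}) / N j) ` {\<sigma>. \<sigma> permutes {..<k}})
        \<le> real (card {i \<in> comm n \<theta> j. \<sigma> (\<theta>h i) \<noteq> j}) / N j"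
        using S(1) fin by (intro Min_le) auto
      also have "\<dots> \<le> real (card (S \<inter> comm n \<theta> j)) / N j"
        using S(4) by (intro divide_right_mono of_nat_mono card_mono) (auto simp: comm_def)
      also have "\<dots> = (\<Sum>i\<in>S \<inter> comm n \<theta> j. 1 / N j)" by simp
      also have "\<dots> \<le> (\<Sum>i\<in>S \<inter> comm n \<theta> j. \<Delta> (\<theta> i))"
        by (intro sum_mono) (auto simp: \<Delta>_def comm_def)
      also have "\<dots> \<le> (\<Sum>i\<in>S. \<Delta> (\<theta> i))" using finS d0 by (intro sum_mono2) auto
      also have "\<dots> \<le> R" using S(3) by simp
      finally show "Min ((\<lambda>\<sigma>. real (card {i \<in> comm n \<theta> j. \<sigma> (\<theta>h i) \<noteq> j}) / N j) ` {\<sigma>. \<sigma> permutes {..<k}}) \<le> R" .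
    qed
  qed (use k in auto)
  moreover have "Lmis n k \<theta> \<theta>h \<le> R * real (n_max2 n k \<theta>) / real n"
  proof -
    have R0: "0 \<le> R" using \<rho>0 \<gamma> by (simp add: R_def)
    have cardS: "real (card {i. i < n \<and> \<sigma> (\<theta>h i) \<noteq> \<theta> i}) \<le> R * real (n_max2 n k \<theta>)"
    \<comment> \<open>For k = 1, \<open>n_max2\<close> is 0 by definition, so the bound demands no
      error at all; this holds since there is a single label.\<close>
    proof (cases "k = 1")
      case True
      have "\<sigma> 0 = 0" using permutes_in_image[OF S(1), of 0] True by simp
      then have "{i. i < n \<and> \<sigma> (\<theta>h i) \<noteq> \<theta> i} = {}"
        using True \<theta>h lab by fastforce
      then have z: "real (card {i. i < n \<and> \<sigma> (\<theta>h i) \<noteq> \<theta> i}) = 0" by (simp only: card.empty of_nat_0)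
      show ?thesis unfolding z using R0 by simp
    next
      case False
      then have pos: "0 < n_max2 n k \<theta>" using max2(2)[of 0 1] k by simp
      have "real (card {i. i < n \<and> \<sigma> (\<theta>h i) \<noteq> \<theta> i}) \<le> real (card S)"
        using S(4) finS by (intro of_nat_mono card_mono) auto
      also have "\<dots> = (\<Sum>i\<in>S. 1)" by simp
      also have "\<dots> \<le> (\<Sum>i\<in>S. real (n_max2 n k \<theta>) * \<Delta> (\<theta> i))"
      proof (rule sum_mono)
        fix i
        have "1 = real (n_max2 n k \<theta>) * (1 / real (n_max2 n k \<theta>))" using pos by simp
        also have "\<dots> \<le> real (n_max2 n k \<theta>) * \<Delta> (\<theta> i)" unfolding \<Delta>_def by (intro mult_left_mono) auto
        finally show "1 \<le> real (n_max2 n k \<theta>) * \<Delta> (\<theta> i)" .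
      qed
      also have "\<dots> = real (n_max2 n k \<theta>) * (\<Sum>i\<in>S. \<Delta> (\<theta> i))" by (simp add: sum_distrib_left)
      also have "\<dots> \<le> real (n_max2 n k \<theta>) * R" using S(3) by (intro mult_left_mono) auto
      finally show ?thesis by (simp add: mult.commute)
    qed
    have "Lmis n k \<theta> \<theta>h \<le> real (card {i. i < n \<and> \<sigma> (\<theta>h i) \<noteq> \<theta> i}) / real n"
      unfolding Lmis_def using S(1) fin by (intro Min_le) auto
    also have "\<dots> \<le> R * real (n_max2 n k \<theta>) / real n" by (intro divide_right_mono cardS) simp
    finally show ?thesis .
  qed
  ultimately show ?thesis by (simp add: R_def)
qed

end

section \<open>Debiased edge-flipped graphs\<close>

definition flip :: "ereal \<Rightarrow> real" where
  "flip \<epsilon> = (if \<epsilon> = \<infinity> then 0 else 1 / (exp (real_of_ereal \<epsilon>) + 1))"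

abbreviation contrast :: "ereal \<Rightarrow> real" where
  "contrast \<epsilon> \<equiv> 1 - 2 * flip \<epsilon>"

lemma real_of_ereal_pos': "0 < \<epsilon> \<Longrightarrow> \<epsilon> \<noteq> \<infinity> \<Longrightarrow> 0 < real_of_ereal \<epsilon>"
  by (cases \<epsilon>) auto

lemma flip_bounds:
  assumes "0 < \<epsilon>"
  shows "0 \<le> flip \<epsilon>" "flip \<epsilon> < 1 / 2"
proof -
  have "1 < exp (real_of_ereal \<epsilon>)" if "\<epsilon> \<noteq> \<infinity>" using real_of_ereal_pos'[OF assms that] by simp
  then show "0 \<le> flip \<epsilon>" "flip \<epsilon> < 1 / 2"
    by (auto simp: flip_def field_simps add_pos_pos)
qed

lemma debias_eq: "debias \<epsilon> A i j = (if A i j then 1 else 0) - (if i \<noteq> j then flip \<epsilon> else 0)"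
  by (simp add: debias_def flip_def)

text \<open>The prefactor of \<open>g_eps\<close> is the inverse of the contrast, and the contrast
  divided by exp \<epsilon> - 1 is the flip probability.\<close>

lemma contrast_g_eps:
  assumes "0 < \<epsilon>"
  shows "(contrast \<epsilon>)\<^sup>2 * g_eps \<epsilon> k B = flip \<epsilon> + contrast \<epsilon> * maxB k B"
proof (cases "\<epsilon> = \<infinity>")
  case True
  then show ?thesis by (simp add: flip_def g_eps_def)
next
  case False
  define x where "x = exp (real_of_ereal \<epsilon>)"
  have x: "1 < x" using real_of_ereal_pos'[OF assms False] by (simp add: x_def)
  have f: "flip \<epsilon> = 1 / (x + 1)" using False by (simp add: flip_def x_def)
  have c: "contrast \<epsilon> = (x - 1) / (x + 1)" using x by (simp add: f field_simps)
  have g: "g_eps \<epsilon> k B = (x + 1) / (x - 1) * (maxB k B + 1 / (x - 1))"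
    using False by (simp add: g_eps_def x_def)
  have "(contrast \<epsilon>)\<^sup>2 * g_eps \<epsilon> k B = (contrast \<epsilon> * ((x + 1) / (x - 1))) * (contrast \<epsilon> * (maxB k B + 1 / (x - 1)))"
    unfolding g by (simp add: power2_eq_square)
  also have "contrast \<epsilon> * ((x + 1) / (x - 1)) = 1" using x by (simp add: c)
  also have "contrast \<epsilon> * (maxB k B + 1 / (x - 1)) = flip \<epsilon> + contrast \<epsilon> * maxB k B"
  proof -
    have "contrast \<epsilon> * (1 / (x - 1)) = flip \<epsilon>" unfolding c unfolding f using x by simp
    then show ?thesis by (simp only: distrib_left add.commute)
  qed
  finally show ?thesis by simp
qed

definition edge_prob :: "(nat \<Rightarrow> nat) \<Rightarrow> (nat \<Rightarrow> nat \<Rightarrow> real) \<Rightarrow> ereal \<Rightarrow> nat \<times> nat \<Rightarrow> real" where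
  "edge_prob \<theta> B \<epsilon> e = flip \<epsilon> + contrast \<epsilon> * B (\<theta> (fst e)) (\<theta> (snd e))"

lemma bernoulli_flip:
  assumes "0 \<le> b" "b \<le> 1" "0 \<le> t" "t \<le> 1"
  shows "bind_pmf (bernoulli_pmf b) (\<lambda>y. map_pmf (\<lambda>f. if f then \<not> y else y) (bernoulli_pmf t))
    = bernoulli_pmf (t + (1 - 2 * t) * b)"
proof -
  have "t + (1 - 2 * t) * b = t * (1 - b) + (1 - t) * b" by (simp add: algebra_simps)
  moreover have "0 \<le> t * (1 - b) + (1 - t) * b" using assms by (intro add_nonneg_nonneg mult_nonneg_nonneg) auto
  moreover have "t * (1 - b) + (1 - t) * b \<le> 1 * (1 - b) + 1 * b"
    using assms by (intro add_mono mult_right_mono) auto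
  ultimately have r: "0 \<le> t + (1 - 2 * t) * b" "t + (1 - 2 * t) * b \<le> 1" by simp_all
  show ?thesis
  proof (rule pmf_eqI)
    fix z :: bool
    show "pmf (bind_pmf (bernoulli_pmf b) (\<lambda>y. map_pmf (\<lambda>f. if f then \<not> y else y) (bernoulli_pmf t))) z
       = pmf (bernoulli_pmf (t + (1 - 2 * t) * b)) z"
      using assms r by (cases z) (simp_all add: map_pmf_def pmf_bind algebra_simps)
  qed
qed

text \<open>Flipping acts on each edge separately, so the released graph again has independent
  Bernoulli edges and the concentration theorem applies without conditioning on the original
  graph.\<close>

lemma observed_pmf_eq:
  assumes \<epsilon>: "0 < \<epsilon>" and B: "\<And>i j. i < n \<Longrightarrow> j < n \<Longrightarrow> 0 \<le> B (\<theta> i) (\<theta> j) \<and> B (\<theta> i) (\<theta> j) \<le> 1"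
  shows "observed_pmf n \<theta> B \<epsilon>
    = map_pmf symm_of (Pi_pmf (upper_pairs n) False (\<lambda>e. bernoulli_pmf (edge_prob \<theta> B \<epsilon> e)))"
proof (cases "\<epsilon> = \<infinity>")
  case True
  then have "edge_flip n \<epsilon> = return_pmf" by (intro ext) (simp add: edge_flip_def)
  then have "observed_pmf n \<theta> B \<epsilon> = sbm_pmf n \<theta> B"
    by (simp add: observed_pmf_def bind_return_pmf')
  also have "\<dots> = map_pmf symm_of (Pi_pmf (upper_pairs n) False (\<lambda>e. bernoulli_pmf (edge_prob \<theta> B \<epsilon> e)))"
    unfolding sbm_pmf_def
    by (intro arg_cong[where f = "map_pmf symm_of"] Pi_pmf_cong) (auto simp: edge_prob_def flip_def True)
  finally show ?thesis .
next
  case False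
  let ?U = "upper_pairs n"
  let ?h = "\<lambda>(e :: nat \<times> nat) y. map_pmf (\<lambda>f. if f then \<not> y else y) (bernoulli_pmf (flip \<epsilon>))"
  let ?b = "\<lambda>e :: nat \<times> nat. bernoulli_pmf (B (\<theta> (fst e)) (\<theta> (snd e)))"
  have t: "1 / (1 + exp (real_of_ereal \<epsilon>)) = flip \<epsilon>" using False by (simp add: flip_def add.commute)
  have ef: "edge_flip n \<epsilon> (symm_of P) = map_pmf symm_of (Pi_pmf ?U False (\<lambda>e. ?h e (P e)))" for P
    unfolding edge_flip_def t using False
    by (auto intro!: arg_cong[where f = "map_pmf symm_of"] Pi_pmf_cong simp: upper_pairs_def symm_of_def)
  have "observed_pmf n \<theta> B \<epsilon> = bind_pmf (Pi_pmf ?U False ?b) (\<lambda>P. edge_flip n \<epsilon> (symm_of P))"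
    unfolding observed_pmf_def sbm_pmf_def by (simp add: bind_map_pmf case_prod_unfold)
  also have "\<dots> = map_pmf symm_of (bind_pmf (Pi_pmf ?U False ?b) (\<lambda>P. Pi_pmf ?U False (\<lambda>e. ?h e (P e))))"
    unfolding ef by (simp add: map_bind_pmf)
  also have "bind_pmf (Pi_pmf ?U False ?b) (\<lambda>P. Pi_pmf ?U False (\<lambda>e. ?h e (P e)))
     = Pi_pmf ?U False (\<lambda>e. bind_pmf (?b e) (?h e))"
    by (rule Pi_pmf_bind[symmetric]) simp
  also have "\<dots> = Pi_pmf ?U False (\<lambda>e. bernoulli_pmf (edge_prob \<theta> B \<epsilon> e))"
  proof (rule Pi_pmf_cong[OF refl refl])
    fix e assume "e \<in> ?U"
    then have "fst e < n" "snd e < n" by (auto simp: upper_pairs_def)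
    from B[OF this] flip_bounds[OF \<epsilon>]
    show "bind_pmf (?b e) (?h e) = bernoulli_pmf (edge_prob \<theta> B \<epsilon> e)"
      unfolding edge_prob_def by (intro bernoulli_flip) auto
  qed
  finally show ?thesis .
qed

text \<open>Off the diagonal, the debiased matrix minus the block matrix is exactly the centered adjacency
  matrix; the zero diagonal of the graph costs the second summand.\<close>
lemma debias_op_bound:
  assumes X: "op_bound n (sym_mat (cbern (edge_prob \<theta> B \<epsilon>)) \<omega>) a"
    and sym: "\<And>i j. i < n \<Longrightarrow> j < n \<Longrightarrow> B (\<theta> i) (\<theta> j) = B (\<theta> j) (\<theta> i)"
    and D: "\<And>i. i < n \<Longrightarrow> (contrast \<epsilon> * B (\<theta> i) (\<theta> i))\<^sup>2 \<le> b"
    and c: "2 * a + 2 * b \<le> c"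
  shows "op_bound n (\<lambda>i j. debias \<epsilon> (symm_of \<omega>) i j - contrast \<epsilon> * B (\<theta> i) (\<theta> j)) c"
  unfolding op_bound_def
proof
  fix x
  let ?X = "sym_mat (cbern (edge_prob \<theta> B \<epsilon>)) \<omega>"
  let ?E = "\<lambda>i j. debias \<epsilon> (symm_of \<omega>) i j - contrast \<epsilon> * B (\<theta> i) (\<theta> j)"
  have E: "?E i j = ?X i j - (if j = i then contrast \<epsilon> * B (\<theta> i) (\<theta> i) else 0)" if "i < n" "j < n" for i j
    using sym[OF that] by (auto simp: debias_eq symm_of_def sym_mat_def cbern_def edge_prob_def ed_def)
  have mv: "mv n ?E x i = mv n ?X x i - contrast \<epsilon> * B (\<theta> i) (\<theta> i) * x i" if "i < n" for i
  proof -
    have "mv n ?E x i = (\<Sum>j<n. ?X i j * x j - (if j = i then contrast \<epsilon> * B (\<theta> i) (\<theta> i) * x i else 0))"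
      unfolding mv_def using that E by (intro sum.cong) (auto simp: left_diff_distrib)
    then show ?thesis using that by (simp add: sum_subtractf mv_def)
  qed
  have sq: "(mv n ?E x i)\<^sup>2 \<le> 2 * (mv n ?X x i)\<^sup>2 + 2 * (b * (x i)\<^sup>2)" if "i < n" for i
  proof -
    have "(u - v)\<^sup>2 \<le> 2 * u\<^sup>2 + 2 * v\<^sup>2" for u v :: real
      using zero_le_power2[of "u + v"] by (simp add: power2_eq_square algebra_simps)
    from this[of "mv n ?X x i" "contrast \<epsilon> * B (\<theta> i) (\<theta> i) * x i"]
    have "(mv n ?E x i)\<^sup>2 \<le> 2 * (mv n ?X x i)\<^sup>2 + 2 * ((contrast \<epsilon> * B (\<theta> i) (\<theta> i))\<^sup>2 * (x i)\<^sup>2)"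
      unfolding mv[OF that] power_mult_distrib by simp
    also have "(contrast \<epsilon> * B (\<theta> i) (\<theta> i))\<^sup>2 * (x i)\<^sup>2 \<le> b * (x i)\<^sup>2"
      by (intro mult_right_mono D that) auto
    finally show ?thesis by simp
  qed
  have "dot n (mv n ?E x) (mv n ?E x) = (\<Sum>i<n. (mv n ?E x i)\<^sup>2)" by (simp add: dot_def power2_eq_square)
  also have "\<dots> \<le> (\<Sum>i<n. 2 * (mv n ?X x i)\<^sup>2 + 2 * (b * (x i)\<^sup>2))" by (intro sum_mono sq) auto
  also have "\<dots> = 2 * dot n (mv n ?X x) (mv n ?X x) + 2 * (b * dot n x x)"
    by (simp add: dot_def power2_eq_square sum.distrib sum_distrib_left)
  also have "\<dots> \<le> 2 * (a * dot n x x) + 2 * (b * dot n x x)"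
    using X by (simp add: op_bound_def)
  also have "\<dots> = (2 * a + 2 * b) * dot n x x" by (simp add: algebra_simps)
  also have "\<dots> \<le> c * dot n x x" by (intro mult_right_mono c dot_nonneg)
  finally show "dot n (mv n ?E x) (mv n ?E x) \<le> c * dot n x x" .
qed

lemma maxB_props:
  assumes k: "0 < k" and B: "\<And>i j. i < k \<Longrightarrow> j < k \<Longrightarrow> 0 < B i j \<and> B i j \<le> 1"
  shows "i < k \<Longrightarrow> j < k \<Longrightarrow> B i j \<le> maxB k B" "0 \<le> maxB k B" "maxB k B \<le> 1"
proof -
  have fin: "finite {B i j | i j. i < k \<and> j < k}"
    by (rule finite_subset[of _ "(\<lambda>(i, j). B i j) ` ({..<k} \<times> {..<k})"]) auto
  show le: "B i j \<le> maxB k B" if "i < k" "j < k" for i j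
    unfolding maxB_def by (rule Max_ge[OF fin]) (use that in auto)
  have "0 < B 0 0" using B k by auto
  with le[OF k k] show "0 \<le> maxB k B" by linarith
  have "maxB k B \<in> {B i j | i j. i < k \<and> j < k}"
    unfolding maxB_def by (rule Max_in[OF fin]) (use k in auto)
  then show "maxB k B \<le> 1" using B by auto
qed

text \<open>16 from \<open>approx_kmeans_misclassification\<close> times 4 from
  \<open>\<rho>\<close> gives 64. The bracket is 2 a + 2 b in \<open>debias_op_bound\<close>, in
  units of n \<open>Q\<close>, with a = 4 \<open>conc\<close> and b = 1 for the diagonal.\<close>

definition uconst :: real where
  "uconst = 64 * (8 * conc + 2)"

lemma uconst_pos: "0 < uconst"
  using conc_pos by (simp add: uconst_def)

theorem theorem2:
  shows "\<exists>c1 > 0. \<forall>(n::nat) (k::nat) (\<theta>::nat \<Rightarrow> nat) (B::nat \<Rightarrow> nat \<Rightarrow> real) (\<epsilon>::ereal) (\<gamma>::real)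
      (alg :: (nat \<Rightarrow> nat \<Rightarrow> bool) \<Rightarrow> nat \<Rightarrow> nat).
    1 \<le> k \<and> (\<forall>i<n. \<theta> i < k) \<and> (\<forall>j<k. \<exists>i<n. \<theta> i = j) \<and>
    (\<forall>i<k. \<forall>j<k. 0 < B i j \<and> B i j \<le> 1 \<and> B i j = B j i) \<and>
    full_rank k B \<and> lambda_min k B > 0 \<and>
    maxB k B \<ge> ln (real n) / real n \<and>
    0 < \<epsilon> \<and> 0 \<le> \<gamma> \<and>
    (\<forall>A \<in> set_pmf (observed_pmf n \<theta> B \<epsilon>). algA_output n k \<gamma> \<epsilon> A (alg A)) \<and>
    (2 + \<gamma>) * real k * real n / ((real (n_min n k \<theta>))\<^sup>2 * (lambda_min k B)\<^sup>2) * g_eps \<epsilon> k B < 1 / c1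
    \<longrightarrow>
    measure_pmf.prob (observed_pmf n \<theta> B \<epsilon>)
      {A. Ltil n k \<theta> (alg A) \<le> c1 * ((2 + \<gamma>) * real k * real n /
              ((real (n_min n k \<theta>))\<^sup>2 * (lambda_min k B)\<^sup>2) * g_eps \<epsilon> k B)
        \<and> Lmis n k \<theta> (alg A) \<le> c1 * ((2 + \<gamma>) * real k * real (n_max2 n k \<theta>) /
              ((real (n_min n k \<theta>))\<^sup>2 * (lambda_min k B)\<^sup>2) * g_eps \<epsilon> k B)}
      \<ge> 1 - 1 / real n"
proof (intro exI[of _ uconst] conjI uconst_pos allI impI, elim conjE)
  fix n k :: nat and \<theta> :: "nat \<Rightarrow> nat" and B :: "nat \<Rightarrow> nat \<Rightarrow> real" and \<epsilon> :: ereal and \<gamma> :: real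
    and alg :: "(nat \<Rightarrow> nat \<Rightarrow> bool) \<Rightarrow> nat \<Rightarrow> nat"
  let ?m = "real (n_min n k \<theta>)" and ?l = "lambda_min k B" and ?g = "g_eps \<epsilon> k B" and ?s = "contrast \<epsilon>"
  let ?Good = "{A. Ltil n k \<theta> (alg A) \<le> uconst * ((2 + \<gamma>) * real k * real n / (?m\<^sup>2 * ?l\<^sup>2) * ?g)
        \<and> Lmis n k \<theta> (alg A) \<le> uconst * ((2 + \<gamma>) * real k * real (n_max2 n k \<theta>) / (?m\<^sup>2 * ?l\<^sup>2) * ?g)}"
  assume k: "1 \<le> k" and \<theta>: "\<forall>i<n. \<theta> i < k" and ne: "\<forall>j<k. \<exists>i<n. \<theta> i = j"
    and B: "\<forall>i<k. \<forall>j<k. 0 < B i j \<and> B i j \<le> 1 \<and> B i j = B j i"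
    and rank: "full_rank k B" and lam: "?l > 0"
    and dense: "maxB k B \<ge> ln (real n) / real n" and \<epsilon>: "0 < \<epsilon>" and \<gamma>: "0 \<le> \<gamma>"
    and alg: "\<forall>A \<in> set_pmf (observed_pmf n \<theta> B \<epsilon>). algA_output n k \<gamma> \<epsilon> A (alg A)"
    and small: "(2 + \<gamma>) * real k * real n / (?m\<^sup>2 * ?l\<^sup>2) * ?g < 1 / uconst"
  have n0: "0 < n" using ne k by fastforce
  define Q where "Q = flip \<epsilon> + ?s * maxB k B"
  define q where "q = edge_prob \<theta> B \<epsilon>"
  define c where "c = (8 * conc + 2) * (real n * Q)"
  let ?P = "Pi_pmf (upper_pairs n) False (\<lambda>e. bernoulli_pmf (q e))"
  note t = flip_bounds[OF \<epsilon>]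
  have k0: "0 < k" using k by simp
  have Bp: "0 < B i j \<and> B i j \<le> 1" if "i < k" "j < k" for i j using B that by blast
  note mB = maxB_props[of k B, OF k0 Bp]
  have Qg: "?s\<^sup>2 * ?g = Q" unfolding Q_def by (rule contrast_g_eps[OF \<epsilon>])
  have sB: "?s * maxB k B \<le> Q" "0 \<le> ?s * maxB k B" using t mB(2) by (simp_all add: Q_def)
  have Q1: "Q \<le> 1"
  proof -
    have "Q \<le> flip \<epsilon> + ?s * 1"
      unfolding Q_def using t mB(3) by (intro add_left_mono mult_left_mono) auto
    also have "\<dots> \<le> 1" using t by simp
    finally show ?thesis .
  qed
  \<comment> \<open>Flipping at most halves the maximal edge probability, so the density hypothesis
    on \<open>maxB\<close> carries over to \<open>Q\<close> as n \<open>Q\<close> \<ge> (ln n) /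
    2.\<close>
  have Q2: "maxB k B / 2 \<le> Q"
  proof -
    have "0 \<le> flip \<epsilon> * (1 - maxB k B) + maxB k B * (1 / 2 - flip \<epsilon>)"
      using t mB by (intro add_nonneg_nonneg mult_nonneg_nonneg) auto
    then show ?thesis by (simp add: Q_def algebra_simps)
  qed
  have qQ: "0 \<le> q e \<and> q e \<le> Q" if e: "e \<in> upper_pairs n" for e
  proof -
    have "\<theta> (fst e) < k" "\<theta> (snd e) < k" using e \<theta> by (auto simp: upper_pairs_def)
    then have "0 \<le> B (\<theta> (fst e)) (\<theta> (snd e))" "B (\<theta> (fst e)) (\<theta> (snd e)) \<le> maxB k B"
      using Bp mB(1) by (auto intro: less_imp_le)
    then have "0 \<le> ?s * B (\<theta> (fst e)) (\<theta> (snd e))" "?s * B (\<theta> (fst e)) (\<theta> (snd e)) \<le> ?s * maxB k B"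
      using t by (auto intro!: mult_nonneg_nonneg mult_left_mono)
    then show ?thesis using t by (simp add: q_def edge_prob_def Q_def)
  qed
  have obs: "observed_pmf n \<theta> B \<epsilon> = map_pmf symm_of ?P"
    unfolding q_def by (rule observed_pmf_eq[OF \<epsilon>]) (use Bp \<theta> in \<open>auto intro: less_imp_le\<close>)
  \<comment> \<open>Membership in the support is kept beside the norm bound because
    \<open>alg\<close> is constrained only on graphs that can occur.\<close>
  have good: "symm_of \<omega> \<in> ?Good"
    if \<omega>: "\<omega> \<in> set_pmf ?P" and op: "op_bound n (sym_mat (cbern q) \<omega>) (4 * conc * (real n * Q))" for \<omega>
  proof -
    have "symm_of \<omega> \<in> set_pmf (observed_pmf n \<theta> B \<epsilon>)" using \<omega> by (simp add: obs)
    with alg have "algA_output n k \<gamma> \<epsilon> (symm_of \<omega>) (alg (symm_of \<omega>))" by blast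
    then obtain U V \<mu> where km: "approx_kmeans n k \<gamma> U (alg (symm_of \<omega>))" and V: "orthonormal_cols n n V"
      "\<forall>a<n. \<forall>i<n. (\<Sum>j<n. debias \<epsilon> (symm_of \<omega>) i j * V j a) = \<mu> a * V i a"
      "\<forall>a<k. \<forall>b. k \<le> b \<and> b < n \<longrightarrow> \<bar>\<mu> b\<bar> \<le> \<bar>\<mu> a\<bar>" "\<forall>i<n. \<forall>a<k. U i a = V i a"
      unfolding algA_output_def top_k_eigvecs_def by blast
    have D: "(?s * B (\<theta> i) (\<theta> i))\<^sup>2 \<le> real n * Q" if "i < n" for i
    proof -
      have b: "0 \<le> B (\<theta> i) (\<theta> i)" "B (\<theta> i) (\<theta> i) \<le> maxB k B"
        using that \<theta> Bp[of "\<theta> i" "\<theta> i"] mB(1)[of "\<theta> i" "\<theta> i"] by auto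
      have u: "0 \<le> ?s * B (\<theta> i) (\<theta> i)" "?s * B (\<theta> i) (\<theta> i) \<le> Q"
        using b t order_trans[OF mult_left_mono[OF b(2), of ?s] sB(1)] by auto
      then have "(?s * B (\<theta> i) (\<theta> i)) * (?s * B (\<theta> i) (\<theta> i)) \<le> 1 * Q"
        using Q1 by (intro mult_mono) auto
      also have "\<dots> \<le> real n * Q" using n0 u by (intro mult_right_mono) auto
      finally show ?thesis by (simp add: power2_eq_square)
    qed
    have err: "op_bound n (\<lambda>i j. debias \<epsilon> (symm_of \<omega>) i j - ?s * B (\<theta> i) (\<theta> j)) c"
      by (rule debias_op_bound[OF op[unfolded q_def] _ D]) (use B \<theta> in \<open>auto simp: c_def algebra_simps\<close>)
    interpret perturbed_blocks n k \<theta> B ?s "debias \<epsilon> (symm_of \<omega>)" V \<mu> c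
      using k0 \<theta> ne B rank lam t V err by unfold_locales (auto simp: mv_def)
    have "16 * (2 + \<gamma>) * real k * \<rho> = 64 * (8 * conc + 2) * ((2 + \<gamma>) * real k * real n * (?s\<^sup>2 * ?g) / (?s * ?m * ?l)\<^sup>2)"
      unfolding \<rho>_def unfolding c_def Qg by (simp, simp add: algebra_simps)
    also have "\<dots> = uconst * ((2 + \<gamma>) * real k * real n / (?m\<^sup>2 * ?l\<^sup>2) * ?g)"
      using s by (simp add: uconst_def power_mult_distrib)
    finally have R: "16 * (2 + \<gamma>) * real k * \<rho> = uconst * ((2 + \<gamma>) * real k * real n / (?m\<^sup>2 * ?l\<^sup>2) * ?g)" .
    have "16 * (2 + \<gamma>) * real k * \<rho> < 1"
      unfolding R using mult_strict_left_mono[OF small uconst_pos] uconst_pos by simp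
    from approx_kmeans_misclassification[OF _ km \<gamma> this] V(4)
    have L: "Ltil n k \<theta> (alg (symm_of \<omega>)) \<le> 16 * (2 + \<gamma>) * real k * \<rho>"
      "Lmis n k \<theta> (alg (symm_of \<omega>)) \<le> 16 * (2 + \<gamma>) * real k * \<rho> * real (n_max2 n k \<theta>) / real n" by auto
    have R': "16 * (2 + \<gamma>) * real k * \<rho> * real (n_max2 n k \<theta>) / real n
      = uconst * ((2 + \<gamma>) * real k * real (n_max2 n k \<theta>) / (?m\<^sup>2 * ?l\<^sup>2) * ?g)"
      unfolding R using n0 by simp
    show ?thesis using L(1)[unfolded R] L(2)[unfolded R'] by (intro CollectI conjI)
  qed
  show "measure_pmf.prob (observed_pmf n \<theta> B \<epsilon>) ?Good \<ge> 1 - 1 / real n"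
  proof (cases "2 \<le> n")
    case False
    \<comment> \<open>The claimed probability 1 - 1/n is then 0.\<close>
    then have "n = 1" using n0 by simp
    then show ?thesis by simp
  next
    case True
    have "ln (real n) \<le> real n * maxB k B" using dense n0 by (simp add: field_simps)
    also have "\<dots> \<le> real n * (2 * Q)" using Q2 by (intro mult_left_mono) auto
    finally have "ln (real n) / 2 \<le> real n * Q" by simp
    from adjacency_concentration[OF qQ Q1 True this]
    have "1 - 1 / real n \<le> measure_pmf.prob ?P {\<omega>. op_bound n (sym_mat (cbern q) \<omega>) (4 * conc * (real n * Q))}" .
    also have "\<dots> \<le> measure_pmf.prob ?P (symm_of -` ?Good)"
    proof (rule measure_pmf.finite_measure_mono_AE)
      show "AE \<omega> in measure_pmf ?P. \<omega> \<in> {\<omega>. op_bound n (sym_mat (cbern q) \<omega>) (4 * conc * (real n * Q))}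
          \<longrightarrow> \<omega> \<in> symm_of -` ?Good"
        using good by (auto simp: AE_measure_pmf_iff)
    qed auto
    also have "\<dots> = measure_pmf.prob (observed_pmf n \<theta> B \<epsilon>) ?Good"
      unfolding obs by simp
    finally show ?thesis .
  qed
qed

end
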